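(* Let $(f^t,g^t,h^t)_{t\in\mathbb{N}_0}$ be the iterates of the Sinkhorn algorithm for entropic vector quantile regression started from $(f^0,g^0,h^0)\in\mathcal{C}_\diamond(\mathcal{U})\times\mathcal{C}_\diamond(\mathcal{U};\mathbb{R}^{d_x})\times\mathcal{C}(\mathcal{X}\times\mathcal{Y})$, and let $(\bar f,\bar g,\bar h)\in\mathcal{C}_\diamond(\mathcal{U})\times\mathcal{C}_\diamond(\mathcal{U};\mathbb{R}^{d_x})\times\mathcal{C}(\mathcal{X}\times\mathcal{Y})$ be the dual potentials. Put $\bar D:=D(\bar f,\bar g,\bar h)$, $D_0:=D(f^0,g^0,h^0)$ and $$\tau:=\frac{(1\wedge\underline{\lambda})\,e^{-5\bar K/\varepsilon}}{3M_x^2}>0 .$$ Then for every $t\in\mathbb{N}_0$, $$\bar D-D(f^t,g^t,h^t)\le(1+\tau)^{-t}\,(\bar D-D_0).$$ Furthermore, as $t\to\infty$, $$\|f^t-\bar f\|_{L^2(\mu)}^2+\|g^t-\bar g\|_{L^2(\mu)}^2+\|h^t-\bar h\|_{L^2(\nu)}^2=O\big((1+\tau)^{-t}\big).$$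
   Context: Setting. Let $(X,Y)$ be a random vector in $\mathbb{R}^{d_x}\times\mathbb{R}^{d_y}$ with law $\nu$; let $\mathcal{X}$, $\mathcal{Y}$ be the supports of $X$, $Y$. Let $\mu$ be a Borel probability measure on $\mathbb{R}^{d_y}$ with support $\mathcal{U}$. Assume $\mathcal{U},\mathcal{X},\mathcal{Y}$ are compact, $\mathbb{E}[X]=0$ and $\Sigma_X:=\mathbb{E}[XX^\top]$ is invertible. Fix $\varepsilon>0$; $c(u,y):=\|u-y\|^2/2$. The dual objective is $$D(f,g,h):=\int f\,d\mu+\int h\,d\nu-\varepsilon\left(\int e^{(f(u)+\langle g(u),x\rangle+h(x,y)-c(u,y))/\varepsilon}\,d(\mu\otimes\nu)(u,x,y)-1\right).$$ Spaces. $\mathcal{C}_\diamond(\mathcal{U})$ (resp. $\mathcal{C}_\diamond(\mathcal{U};\mathbb{R}^{d_x})$) is the set of continuous $f:\mathcal{U}\to\mathbb{R}$ (resp. $g:\mathcal{U}\to\mathbb{R}^{d_x}$) with $\int f\,d\mu=0$ (resp. $\int g\,d\mu=0$). $\|\cdot\|_\infty$ is the sup norm over the domain ($\mathcal{U}$ or $\mathcal{X}\times\mathcal{Y}$), using the Euclidean norm for vector values; $\|g\|_{L^2(\mu)}^2=\int\|g\|^2d\mu$. Dual potentials. These are maximizers of $D$ over $L^1(\mu)\times L^1(\mu;\mathbb{R}^{d_x})\times L^1(\nu)$. It is known that there is a unique triple $(\bar f,\bar g,\bar h)\in\mathcal{C}_\diamond(\mathcal{U})\times\mathcal{C}_\diamond(\mathcal{U};\mathbb{R}^{d_x})\times\mathcal{C}(\mathcal{X}\times\mathcal{Y})$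 of dual potentials satisfying, for all $u\in\mathcal{U}$ and all $(x,y)\in\mathcal{X}\times\mathcal{Y}$: $\bar f(u)=-\varepsilon\log\int e^{(\langle\bar g(u),x\rangle+\bar h(x,y)-c(u,y))/\varepsilon}d\nu(x,y)$; $\int x\,e^{(\langle\bar g(u),x\rangle+\bar h(x,y)-c(u,y))/\varepsilon}d\nu(x,y)=0$; $\bar h(x,y)=-\varepsilon\log\int e^{(\bar f(u)+\langle\bar g(u),x\rangle-c(u,y))/\varepsilon}d\mu(u)$. "The dual potentials" means this triple. Sinkhorn algorithm. Given $(f^t,g^t,h^t)$: (1) for each $u\in\mathcal{U}$ let $\tilde g^{t+1}(u)\in\mathbb{R}^{d_x}$ be the (unique; continuous in $u$) vector with $\int x\,e^{(\langle\tilde g^{t+1}(u),x\rangle+h^t(x,y)-c(u,y))/\varepsilon}d\nu(x,y)=0$; (2) $\tilde f^{t+1}(u)=-\varepsilon\log\int e^{(\langle\tilde g^{t+1}(u),x\rangle+h^t(x,y)-c(u,y))/\varepsilon}d\nu(x,y)$ and $\tilde h^{t+1}(x,y)=-\varepsilon\log\int e^{(\tilde f^{t+1}(u)+\langle\tilde g^{t+1}(u),x\rangle-c(u,y))/\varepsilon}d\mu(u)$; (3) $f^{t+1}=\tilde f^{t+1}-\int\tilde f^{t+1}d\mu$, $g^{t+1}=\tilde g^{t+1}-\int\tilde g^{t+1}d\mu$, $h^{t+1}(x,y)=\tilde h^{t+1}(x,y)+\int\tilde f^{t+1}d\mu+\langle\int\tilde g^{t+1}d\mu,x\rangle$. Constants.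 $\underline\lambda$ is the smallest eigenvalue of $\Sigma_X$; $\|c\|_\infty:=\sup_{\mathcal{U}\times\mathcal{Y}}c$; $L_c:=\sup_{u\in\mathcal{U}}\|u\|+\sup_{y\in\mathcal{Y}}\|y\|$; $D_0^-:=\max\{-D_0,0\}$; $M_x:=\max\{1,\sup_{x\in\mathcal{X}}\|x\|\}$; $K_f:=\max\{L_c\,\mathrm{diam}(\mathcal{U})+\|c\|_\infty+D_0^-+\|h^0\|_\infty,\ \|\bar f\|_\infty,\ \|f^0\|_\infty\}$; $K_g:=\max\{4\|\Sigma_X^{-1}\|_{\mathrm{op}}M_x(4\|c\|_\infty-\tfrac32D_0+K_f+\|h^0\|_\infty+\varepsilon\log\tfrac32),\ \|\bar g\|_\infty,\ \|g^0\|_\infty\}$; $K_h:=\max\{\|c\|_\infty+K_f+K_gM_x,\ \|\bar h\|_\infty,\ \|h^0\|_\infty\}$; $\bar K:=K_f+K_gM_x+K_h+\|c\|_\infty$. *)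

theory Defs
  imports "HOL-Probability.Probability" "HOL-Library.Landau_Symbols"
begin

text \<open>
  The law of \<open>(X, Y)\<close> is a Borel probability measure \<open>\<nu>\<close> on \<open>real ^ 'n \<times> real ^ 'm\<close>, and \<open>\<mu>\<close> is a
  Borel probability measure on \<open>real ^ 'm\<close>.  Potentials are total functions of which only the
  values on the supports are meaningful.  Outside the supports they may fail to be measurable, so
  every integral involving a potential is a set integral over a support.
\<close>

definition measure_support :: "'a::topological_space measure \<Rightarrow> 'a set" where
  "measure_support M = {x. \<forall>S. open S \<and> x \<in> S \<longrightarrow> emeasure M S > 0}"

definition suppX :: "((real ^ 'n) \<times> (real ^ 'm)) measure \<Rightarrow> (real ^ 'n) set" where
  "suppX \<nu> = measure_support (distr \<nu> borel fst)"

definition suppY :: "((real ^ 'n) \<times> (real ^ 'm)) measure \<Rightarrow> (real ^ 'm) set" where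
  "suppY \<nu> = measure_support (distr \<nu> borel snd)"

definition suppXY :: "((real ^ 'n) \<times> (real ^ 'm)) measure \<Rightarrow> ((real ^ 'n) \<times> (real ^ 'm)) set" where
  "suppXY \<nu> = suppX \<nu> \<times> suppY \<nu>"

definition second_moment_X :: "((real ^ 'n) \<times> (real ^ 'm)) measure \<Rightarrow> real ^ 'n ^ 'n" where
  "second_moment_X \<nu> = (\<chi> i j. LINT z|\<nu>. fst z $ i * fst z $ j)"

definition smallest_eigenvalue :: "real ^ 'n ^ 'n \<Rightarrow> real" where
  "smallest_eigenvalue A = (LEAST l. \<exists>v. v \<noteq> 0 \<and> A *v v = l *\<^sub>R v)"

definition cost :: "real ^ 'm \<Rightarrow> real ^ 'm \<Rightarrow> real" where
  "cost u y = (norm (u - y))\<^sup>2 / 2"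

definition gibbs_kernel ::
  "real \<Rightarrow> (real ^ 'm \<Rightarrow> real) \<Rightarrow> (real ^ 'm \<Rightarrow> real ^ 'n) \<Rightarrow> ((real ^ 'n) \<times> (real ^ 'm) \<Rightarrow> real)
    \<Rightarrow> (real ^ 'm) \<times> ((real ^ 'n) \<times> (real ^ 'm)) \<Rightarrow> real" where
  "gibbs_kernel \<epsilon> f g h = (\<lambda>(u, (x, y)). exp ((f u + g u \<bullet> x + h (x, y) - cost u y) / \<epsilon>))"

definition dual_obj ::
  "(real ^ 'm) measure \<Rightarrow> ((real ^ 'n) \<times> (real ^ 'm)) measure \<Rightarrow> real
    \<Rightarrow> (real ^ 'm \<Rightarrow> real) \<Rightarrow> (real ^ 'm \<Rightarrow> real ^ 'n) \<Rightarrow> ((real ^ 'n) \<times> (real ^ 'm) \<Rightarrow> real) \<Rightarrow> real" where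
  "dual_obj \<mu> \<nu> \<epsilon> f g h =
     (LINT u:measure_support \<mu>|\<mu>. f u) + (LINT z:suppXY \<nu>|\<nu>. h z)
     - \<epsilon> * ((LINT w:(measure_support \<mu> \<times> suppXY \<nu>)|(\<mu> \<Otimes>\<^sub>M \<nu>). gibbs_kernel \<epsilon> f g h w) - 1)"

definition C_diamond :: "(real ^ 'm) measure \<Rightarrow> (real ^ 'm \<Rightarrow> 'b::euclidean_space) \<Rightarrow> bool" where
  "C_diamond \<mu> f \<longleftrightarrow>
     continuous_on (measure_support \<mu>) f \<and> (LINT u:measure_support \<mu>|\<mu>. f u) = 0"

definition admissible_triple ::
  "(real ^ 'm) measure \<Rightarrow> ((real ^ 'n) \<times> (real ^ 'm)) measure
    \<Rightarrow> (real ^ 'm \<Rightarrow> real) \<Rightarrow> (real ^ 'm \<Rightarrow> real ^ 'n) \<Rightarrow> ((real ^ 'n) \<times> (real ^ 'm) \<Rightarrow> real) \<Rightarrow> bool" where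
  "admissible_triple \<mu> \<nu> f g h \<longleftrightarrow>
     C_diamond \<mu> f \<and> C_diamond \<mu> g \<and> continuous_on (suppXY \<nu>) h"

text \<open>
  On an \<open>L\<^sup>1\<close> triple whose Gibbs kernel is not integrable, the exponential term of the objective is
  infinite and the objective is minus infinity.  Such a triple can never beat another one, whereas the
  Bochner integral in \<^const>\<open>dual_obj\<close> would give it the junk value 0; it is therefore excluded.
\<close>

definition dual_competitor ::
  "(real ^ 'm) measure \<Rightarrow> ((real ^ 'n) \<times> (real ^ 'm)) measure \<Rightarrow> real
    \<Rightarrow> (real ^ 'm \<Rightarrow> real) \<Rightarrow> (real ^ 'm \<Rightarrow> real ^ 'n) \<Rightarrow> ((real ^ 'n) \<times> (real ^ 'm) \<Rightarrow> real) \<Rightarrow> bool" where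
  "dual_competitor \<mu> \<nu> \<epsilon> f g h \<longleftrightarrow>
     set_integrable \<mu> (measure_support \<mu>) f \<and>
     set_integrable \<mu> (measure_support \<mu>) g \<and>
     set_integrable \<nu> (suppXY \<nu>) h \<and>
     set_integrable (\<mu> \<Otimes>\<^sub>M \<nu>) (measure_support \<mu> \<times> suppXY \<nu>) (gibbs_kernel \<epsilon> f g h)"

definition dual_maximizer ::
  "(real ^ 'm) measure \<Rightarrow> ((real ^ 'n) \<times> (real ^ 'm)) measure \<Rightarrow> real
    \<Rightarrow> (real ^ 'm \<Rightarrow> real) \<Rightarrow> (real ^ 'm \<Rightarrow> real ^ 'n) \<Rightarrow> ((real ^ 'n) \<times> (real ^ 'm) \<Rightarrow> real) \<Rightarrow> bool" where
  "dual_maximizer \<mu> \<nu> \<epsilon> f g h \<longleftrightarrow>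
     dual_competitor \<mu> \<nu> \<epsilon> f g h \<and>
     (\<forall>f' g' h'. dual_competitor \<mu> \<nu> \<epsilon> f' g' h' \<longrightarrow> dual_obj \<mu> \<nu> \<epsilon> f' g' h' \<le> dual_obj \<mu> \<nu> \<epsilon> f g h)"

definition f_update ::
  "((real ^ 'n) \<times> (real ^ 'm)) measure \<Rightarrow> real \<Rightarrow> (real ^ 'm \<Rightarrow> real ^ 'n)
    \<Rightarrow> ((real ^ 'n) \<times> (real ^ 'm) \<Rightarrow> real) \<Rightarrow> real ^ 'm \<Rightarrow> real" where
  "f_update \<nu> \<epsilon> g h u =
     - \<epsilon> * ln (LINT (x, y):suppXY \<nu>|\<nu>. exp ((g u \<bullet> x + h (x, y) - cost u y) / \<epsilon>))"

definition g_equation ::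
  "((real ^ 'n) \<times> (real ^ 'm)) measure \<Rightarrow> real \<Rightarrow> (real ^ 'm \<Rightarrow> real ^ 'n)
    \<Rightarrow> ((real ^ 'n) \<times> (real ^ 'm) \<Rightarrow> real) \<Rightarrow> real ^ 'm \<Rightarrow> bool" where
  "g_equation \<nu> \<epsilon> g h u \<longleftrightarrow>
     (LINT (x, y):suppXY \<nu>|\<nu>. exp ((g u \<bullet> x + h (x, y) - cost u y) / \<epsilon>) *\<^sub>R x) = 0"

definition h_update ::
  "(real ^ 'm) measure \<Rightarrow> real \<Rightarrow> (real ^ 'm \<Rightarrow> real) \<Rightarrow> (real ^ 'm \<Rightarrow> real ^ 'n)
    \<Rightarrow> (real ^ 'n) \<times> (real ^ 'm) \<Rightarrow> real" where
  "h_update \<mu> \<epsilon> f g = (\<lambda>(x, y).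
     - \<epsilon> * ln (LINT u:measure_support \<mu>|\<mu>. exp ((f u + g u \<bullet> x - cost u y) / \<epsilon>)))"

definition dual_potentials ::
  "(real ^ 'm) measure \<Rightarrow> ((real ^ 'n) \<times> (real ^ 'm)) measure \<Rightarrow> real
    \<Rightarrow> (real ^ 'm \<Rightarrow> real) \<Rightarrow> (real ^ 'm \<Rightarrow> real ^ 'n) \<Rightarrow> ((real ^ 'n) \<times> (real ^ 'm) \<Rightarrow> real) \<Rightarrow> bool" where
  "dual_potentials \<mu> \<nu> \<epsilon> f g h \<longleftrightarrow>
     admissible_triple \<mu> \<nu> f g h \<and> dual_maximizer \<mu> \<nu> \<epsilon> f g h \<and>
     (\<forall>u\<in>measure_support \<mu>. f u = f_update \<nu> \<epsilon> g h u) \<and>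
     (\<forall>u\<in>measure_support \<mu>. g_equation \<nu> \<epsilon> g h u) \<and>
     (\<forall>z\<in>suppXY \<nu>. h z = h_update \<mu> \<epsilon> f g z)"

text \<open>
  One iteration, from \<open>h\<close> to \<open>(f', g', h')\<close>; the current \<open>f\<close> and \<open>g\<close> do not enter.  On the support of
  \<open>\<mu>\<close> the equation for \<open>gt\<close> determines \<open>gt\<close> uniquely (and makes it continuous there).
\<close>

definition sinkhorn_step ::
  "(real ^ 'm) measure \<Rightarrow> ((real ^ 'n) \<times> (real ^ 'm)) measure \<Rightarrow> real
    \<Rightarrow> ((real ^ 'n) \<times> (real ^ 'm) \<Rightarrow> real)
    \<Rightarrow> (real ^ 'm \<Rightarrow> real) \<Rightarrow> (real ^ 'm \<Rightarrow> real ^ 'n) \<Rightarrow> ((real ^ 'n) \<times> (real ^ 'm) \<Rightarrow> real) \<Rightarrow> bool" where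
  "sinkhorn_step \<mu> \<nu> \<epsilon> h f' g' h' \<longleftrightarrow>
     (\<exists>gt. (\<forall>u\<in>measure_support \<mu>. g_equation \<nu> \<epsilon> gt h u) \<and>
       (let ft = f_update \<nu> \<epsilon> gt h;
            ht = h_update \<mu> \<epsilon> ft gt;
            a = (LINT u:measure_support \<mu>|\<mu>. ft u);
            b = (LINT u:measure_support \<mu>|\<mu>. gt u)
        in (\<forall>u\<in>measure_support \<mu>. f' u = ft u - a) \<and>
           (\<forall>u\<in>measure_support \<mu>. g' u = gt u - b) \<and>
           (\<forall>(x, y)\<in>suppXY \<nu>. h' (x, y) = ht (x, y) + a + b \<bullet> x)))"

definition sup_norm :: "'a set \<Rightarrow> ('a \<Rightarrow> 'b::real_normed_vector) \<Rightarrow> real" where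
  "sup_norm S f = (SUP x\<in>S. norm (f x))"

definition cost_sup :: "(real ^ 'm) measure \<Rightarrow> ((real ^ 'n) \<times> (real ^ 'm)) measure \<Rightarrow> real" where
  "cost_sup \<mu> \<nu> = (SUP (u, y)\<in>measure_support \<mu> \<times> suppY \<nu>. cost u y)"

definition L_c :: "(real ^ 'm) measure \<Rightarrow> ((real ^ 'n) \<times> (real ^ 'm)) measure \<Rightarrow> real" where
  "L_c \<mu> \<nu> = (SUP u\<in>measure_support \<mu>. norm u) + (SUP y\<in>suppY \<nu>. norm y)"

definition M_x :: "((real ^ 'n) \<times> (real ^ 'm)) measure \<Rightarrow> real" where
  "M_x \<nu> = max 1 (SUP x\<in>suppX \<nu>. norm x)"

text \<open>
  In the constants below, \<open>D0\<close> stands for the value of the dual objective at the initial triple and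
  \<open>fb gb hb\<close> for the dual potentials.
\<close>

definition K_f ::
  "(real ^ 'm) measure \<Rightarrow> ((real ^ 'n) \<times> (real ^ 'm)) measure \<Rightarrow> real
    \<Rightarrow> (real ^ 'm \<Rightarrow> real) \<Rightarrow> ((real ^ 'n) \<times> (real ^ 'm) \<Rightarrow> real) \<Rightarrow> (real ^ 'm \<Rightarrow> real) \<Rightarrow> real" where
  "K_f \<mu> \<nu> D0 f0 h0 fb =
     Max {L_c \<mu> \<nu> * diameter (measure_support \<mu>) + cost_sup \<mu> \<nu> + max (- D0) 0
            + sup_norm (suppXY \<nu>) h0,
          sup_norm (measure_support \<mu>) fb,
          sup_norm (measure_support \<mu>) f0}"

definition K_g ::
  "(real ^ 'm) measure \<Rightarrow> ((real ^ 'n) \<times> (real ^ 'm)) measure \<Rightarrow> real \<Rightarrow> real \<Rightarrow> real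
    \<Rightarrow> (real ^ 'm \<Rightarrow> real ^ 'n) \<Rightarrow> ((real ^ 'n) \<times> (real ^ 'm) \<Rightarrow> real) \<Rightarrow> (real ^ 'm \<Rightarrow> real ^ 'n) \<Rightarrow> real" where
  "K_g \<mu> \<nu> \<epsilon> D0 Kf g0 h0 gb =
     Max {4 * onorm (\<lambda>v. matrix_inv (second_moment_X \<nu>) *v v) * M_x \<nu>
            * (4 * cost_sup \<mu> \<nu> - 3 / 2 * D0 + Kf + sup_norm (suppXY \<nu>) h0 + \<epsilon> * ln (3 / 2)),
          sup_norm (measure_support \<mu>) gb,
          sup_norm (measure_support \<mu>) g0}"

definition K_h ::
  "(real ^ 'm) measure \<Rightarrow> ((real ^ 'n) \<times> (real ^ 'm)) measure \<Rightarrow> real \<Rightarrow> real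
    \<Rightarrow> ((real ^ 'n) \<times> (real ^ 'm) \<Rightarrow> real) \<Rightarrow> ((real ^ 'n) \<times> (real ^ 'm) \<Rightarrow> real) \<Rightarrow> real" where
  "K_h \<mu> \<nu> Kf Kg h0 hb =
     Max {cost_sup \<mu> \<nu> + Kf + Kg * M_x \<nu>, sup_norm (suppXY \<nu>) hb, sup_norm (suppXY \<nu>) h0}"

definition K_bar ::
  "(real ^ 'm) measure \<Rightarrow> ((real ^ 'n) \<times> (real ^ 'm)) measure \<Rightarrow> real
    \<Rightarrow> (real ^ 'm \<Rightarrow> real) \<Rightarrow> (real ^ 'm \<Rightarrow> real ^ 'n) \<Rightarrow> ((real ^ 'n) \<times> (real ^ 'm) \<Rightarrow> real)
    \<Rightarrow> (real ^ 'm \<Rightarrow> real) \<Rightarrow> (real ^ 'm \<Rightarrow> real ^ 'n) \<Rightarrow> ((real ^ 'n) \<times> (real ^ 'm) \<Rightarrow> real) \<Rightarrow> real" where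
  "K_bar \<mu> \<nu> \<epsilon> f0 g0 h0 fb gb hb =
     (let D0 = dual_obj \<mu> \<nu> \<epsilon> f0 g0 h0;
          Kf = K_f \<mu> \<nu> D0 f0 h0 fb;
          Kg = K_g \<mu> \<nu> \<epsilon> D0 Kf g0 h0 gb;
          Kh = K_h \<mu> \<nu> Kf Kg h0 hb
      in Kf + Kg * M_x \<nu> + Kh + cost_sup \<mu> \<nu>)"

definition rate ::
  "(real ^ 'm) measure \<Rightarrow> ((real ^ 'n) \<times> (real ^ 'm)) measure \<Rightarrow> real
    \<Rightarrow> (real ^ 'm \<Rightarrow> real) \<Rightarrow> (real ^ 'm \<Rightarrow> real ^ 'n) \<Rightarrow> ((real ^ 'n) \<times> (real ^ 'm) \<Rightarrow> real)
    \<Rightarrow> (real ^ 'm \<Rightarrow> real) \<Rightarrow> (real ^ 'm \<Rightarrow> real ^ 'n) \<Rightarrow> ((real ^ 'n) \<times> (real ^ 'm) \<Rightarrow> real) \<Rightarrow> real" where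
  "rate \<mu> \<nu> \<epsilon> f0 g0 h0 fb gb hb =
     min 1 (smallest_eigenvalue (second_moment_X \<nu>))
       * exp (- 5 * K_bar \<mu> \<nu> \<epsilon> f0 g0 h0 fb gb hb / \<epsilon>) / (3 * (M_x \<nu>)\<^sup>2)"

definition L2_dist_sq :: "'a measure \<Rightarrow> 'a set \<Rightarrow> ('a \<Rightarrow> 'b::euclidean_space) \<Rightarrow> ('a \<Rightarrow> 'b) \<Rightarrow> real" where
  "L2_dist_sq M S f f' = (LINT x:S|M. (norm (f x - f' x))\<^sup>2)"

end

theory Submission
  imports Defs
begin

text \<open>
  The dual objective depends on the potentials only through the exponent
  \<open>\<xi> = f + \<langle>g, x\<rangle> + h - c\<close>, and it is strongly concave in \<open>\<xi>\<close> on bounded sets.  Let \<open>p\<close> be the Gibbs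
  density after the update of \<open>(f, g)\<close>, \<open>q\<close> the one after the update of \<open>h\<close>, and \<open>r\<close> the marginal
  of \<open>p\<close> in \<open>(x, y)\<close>, so that \<open>p = q r\<close>.  The \<open>h\<close>-update increases the objective by
  \<open>\<epsilon> \<integral> (r - 1 - ln r) d\<nu>\<close>.  At the new iterate the \<open>h\<close>-gradient vanishes, and the \<open>(f, g)\<close>-gradient
  is given by the density \<open>p - q = q (r - 1)\<close> since \<open>p\<close> satisfies the \<open>(f, g)\<close>-constraints; strong concavity
  therefore bounds the remaining gap by a multiple of \<open>\<integral> (p - q)\<^sup>2\<close>, which is at most a multiple of
  \<open>\<integral> (r - 1 - ln r) d\<nu>\<close>.  Altogether the gap is at most \<open>e\<^bsup>3K/\<epsilon>\<^esup>\<close> times the gain of the step, where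
  \<open>K\<close> bounds \<open>\<xi>\<close>, and this beats the rate \<open>\<tau>\<close>.

  The bounds: \<open>f\<close> inherits the oscillation of the cost; \<open>g\<close> is controlled in terms of \<open>\<integral> \<bar>\<langle>g, x\<rangle>\<bar> d\<nu>\<close>, which is twice
  the integral of the positive part because \<open>x\<close> has mean zero; and \<open>h\<close> is a soft minimum.
\<close>

text \<open>The three factors exp (K / \<epsilon>) in the constant have separate origins: the
  modulus of strong concavity, the bound on q in (p - q)^2 = q * q * (r - 1)^2, and the bound on r
  that lets r - 1 - ln r, which grows only linearly, dominate (r - 1)^2. Centring is what makes
  strong concavity usable: for centred differences the h-part of a difference of exponents is
  orthogonal in L2 to its (f, g)-part, so the quadratic term of the (f, g)-part survives and absorbs
  the gradient term. Two obstacles shape the development. The initial h need not be an h-update, so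
  its bounds have to be carried separately from those of later iterates. And the solution of the
  g-equation comes as a bare function without any measurability; a Lipschitz estimate has to supply
  it. The measures are restricted to the supports, where all potentials become bounded measurable
  functions, and the analysis itself runs on abstract probability spaces.\<close>

section \<open>Elementary inequalities\<close>

text \<open>Strong convexity: on [m, infinity) the second derivative of exp is at least exp m. This
  is the pointwise source of the concavity modulus of the objective.\<close>

lemma exp_ge_tangent_quadratic:
  fixes a b :: real
  assumes "m \<le> a" "m \<le> b"
  shows "exp a + exp a * (b - a) + exp m / 2 * (b - a)\<^sup>2 \<le> exp b"
proof (cases "a \<le> b")
  case True
  have "1 + (b - a) + (b - a)\<^sup>2 / 2 \<le> exp (b - a)"
    using exp_lower_Taylor_quadratic[of "b - a"] True by simp
  then have "exp a * (1 + (b - a) + (b - a)\<^sup>2 / 2) \<le> exp a * exp (b - a)"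
    by simp
  also have "\<dots> = exp b" by (simp flip: exp_add)
  finally have "exp a + exp a * (b - a) + exp a / 2 * (b - a)\<^sup>2 \<le> exp b"
    by (simp add: algebra_simps)
  moreover have "exp m / 2 * (b - a)\<^sup>2 \<le> exp a / 2 * (b - a)\<^sup>2"
    using assms by (intro mult_right_mono) auto
  ultimately show ?thesis by linarith
next
  case False
  \<comment> \<open>The quadratic Taylor lower bound fails for negative increments. Dividing by exp
    b, where b is the smaller point, turns the claim into exp s * (1 - s) + s^2 / 2 <= 1 for s >=
    0.\<close>
  define s where "s = a - b"
  have s: "0 \<le> s" using False by (simp add: s_def)
  have "exp 0 * (0 - 1) + 1 - 0\<^sup>2 / 2 \<le> exp s * (s - 1) + 1 - s\<^sup>2 / 2"
  proof (rule DERIV_nonneg_imp_nondecreasing[OF s])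
    fix x :: real assume "0 \<le> x" "x \<le> s"
    show "\<exists>y. ((\<lambda>x. exp x * (x - 1) + 1 - x\<^sup>2 / 2) has_real_derivative y) (at x) \<and> 0 \<le> y"
    proof (intro exI[of _ "x * (exp x - 1)"] conjI)
      show "((\<lambda>x. exp x * (x - 1) + 1 - x\<^sup>2 / 2) has_real_derivative x * (exp x - 1)) (at x)"
        by (auto intro!: derivative_eq_intros simp: algebra_simps)
      show "0 \<le> x * (exp x - 1)" using \<open>0 \<le> x\<close> by (intro mult_nonneg_nonneg) auto
    qed
  qed
  then have "exp s * (1 - s) + s\<^sup>2 / 2 \<le> 1" by (simp add: algebra_simps)
  then have "exp b * (exp s * (1 - s) + s\<^sup>2 / 2) \<le> exp b" by simp
  moreover have "exp b * (exp s * (1 - s) + s\<^sup>2 / 2) = exp a + exp a * (b - a) + exp b / 2 * (b - a)\<^sup>2"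
  proof -
    have "exp b * exp s = exp a" by (simp add: s_def flip: exp_add)
    then have "exp b * (exp s * (1 - s)) = exp a * (1 - s)" by (metis mult.assoc)
    then show ?thesis by (simp add: distrib_left s_def power2_commute algebra_simps)
  qed
  moreover have "exp m / 2 * (b - a)\<^sup>2 \<le> exp b / 2 * (b - a)\<^sup>2"
    using assms by (intro mult_right_mono) auto
  ultimately show ?thesis by linarith
qed

text \<open>The tangent inequalities at \<open>a\<close> and at \<open>b\<close> are added; the
  values of exp cancel.\<close>

lemma exp_strongly_monotone:
  fixes a b :: real
  assumes "m \<le> a" "m \<le> b"
  shows "exp m * (b - a)\<^sup>2 \<le> (exp b - exp a) * (b - a)"
  using exp_ge_tangent_quadratic[OF assms] exp_ge_tangent_quadratic[OF assms(2,1)]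
  by (simp add: algebra_simps power2_commute)

lemma abs_exp_diff_le:
  fixes a b :: real
  assumes "a \<le> B" "b \<le> B"
  shows "\<bar>exp b - exp a\<bar> \<le> exp B * \<bar>b - a\<bar>"
proof -
  have *: "exp y - exp x \<le> exp B * \<bar>y - x\<bar>" if "y \<le> B" for x y :: real
  proof -
    have "exp y * (1 + (x - y)) \<le> exp y * exp (x - y)"
      using exp_ge_add_one_self[of "x - y"] by (intro mult_left_mono) auto
    then have "exp y - exp x \<le> exp y * (y - x)" by (simp add: algebra_simps flip: exp_add)
    also have "\<dots> \<le> exp y * \<bar>y - x\<bar>" by simp
    also have "\<dots> \<le> exp B * \<bar>y - x\<bar>" using that by (intro mult_right_mono) auto
    finally show ?thesis .
  qed
  show ?thesis using *[of a b] *[of b a] assms by (simp add: abs_le_iff abs_minus_commute)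
qed

text \<open>The entropy term grows only linearly in \<open>r\<close>, so the upper bound
  \<open>B\<close> has to pay for the square. This turns the gain of the h-update into an L2 bound
  on r - 1.\<close>

lemma power2_diff_one_le_entropy:
  fixes r B :: real
  assumes "0 < r" "r \<le> B" "1 \<le> B"
  shows "(r - 1)\<^sup>2 \<le> 2 * B * (r - 1 - ln r)"
proof (cases "r \<le> 1")
  case True
  have "1 - 1 - ln 1 - (1 - 1)\<^sup>2 / 2 \<le> r - 1 - ln r - (r - 1)\<^sup>2 / 2"
  proof (rule DERIV_nonpos_imp_nonincreasing[OF True])
    fix x :: real assume x: "r \<le> x" "x \<le> 1"
    then have "0 < x" using assms by simp
    show "\<exists>y. ((\<lambda>x. x - 1 - ln x - (x - 1)\<^sup>2 / 2) has_real_derivative y) (at x) \<and> y \<le> 0"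
    proof (intro exI[of _ "- ((x - 1)\<^sup>2 / x)"] conjI)
      show "((\<lambda>x. x - 1 - ln x - (x - 1)\<^sup>2 / 2) has_real_derivative - ((x - 1)\<^sup>2 / x)) (at x)"
        using \<open>0 < x\<close>
        by (auto intro!: derivative_eq_intros simp: field_simps power2_eq_square)
    qed (use \<open>0 < x\<close> in simp)
  qed
  then have h: "(r - 1)\<^sup>2 \<le> 2 * (r - 1 - ln r)" by simp
  have "0 \<le> r - 1 - ln r" using ln_le_minus_one[of r] assms by simp
  then have "2 * (r - 1 - ln r) \<le> 2 * B * (r - 1 - ln r)"
    using assms by (intro mult_right_mono) auto
  with h show ?thesis by linarith
next
  case False
  \<comment> \<open>This is 2 * ln r <= r - 1/r for r >= 1; multiplied by \<open>r\<close> it gives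
    the claim with \<open>r\<close> in place of \<open>B\<close>.\<close>
  have "1 - 1/1 - 2 * ln 1 \<le> r - 1/r - 2 * ln r"
  proof (rule DERIV_nonneg_imp_nondecreasing[of 1])
    show "1 \<le> r" using False by simp
    fix x :: real assume x: "1 \<le> x" "x \<le> r"
    then have "0 < x" by simp
    show "\<exists>y. ((\<lambda>x. x - 1/x - 2 * ln x) has_real_derivative y) (at x) \<and> 0 \<le> y"
    proof (intro exI[of _ "(1 - 1/x)\<^sup>2"] conjI)
      show "((\<lambda>x. x - 1/x - 2 * ln x) has_real_derivative (1 - 1/x)\<^sup>2) (at x)"
        using \<open>0 < x\<close>
        by (auto intro!: derivative_eq_intros simp: power2_eq_square field_simps)
    qed simp
  qed
  then have "r * (2 * ln r) \<le> r * (r - 1/r)" using assms by (intro mult_left_mono) auto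
  then have h: "(r - 1)\<^sup>2 \<le> 2 * r * (r - 1 - ln r)"
    using assms by (simp add: algebra_simps power2_eq_square)
  have "0 \<le> r - 1 - ln r" using ln_le_minus_one[of r] assms by simp
  then have "2 * r * (r - 1 - ln r) \<le> 2 * B * (r - 1 - ln r)"
    using assms by (intro mult_right_mono) auto
  with h show ?thesis by linarith
qed

text \<open>Any constant at least \<open>e\<^sup>-\<^sup>1\<close> would do; \<open>ln (3/2)\<close> is the one in \<open>K_g\<close>.\<close>

lemma le_ln_three_halves_mult_exp: "(y::real) \<le> ln (3/2) * exp y"
proof -
  \<comment> \<open>The goal is exp (-1) <= 2/5 <= ln (3/2). The second inequality is nearly sharp,
    so 1 + x <= exp x is applied at -1/40 and raised to the 16th power: (39/40)^16 still exceeds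
    2/3.\<close>
  have "exp (-2/5::real) = exp (-(1/40)) ^ 16" by (simp flip: exp_of_nat_mult)
  moreover have "(39/40) ^ 16 \<le> exp (-(1/40)::real) ^ 16"
    using exp_ge_add_one_self[of "-(1/40)::real"] by (intro power_mono) auto
  ultimately have "2/3 \<le> exp (-2/5::real)" by (simp add: power_divide)
  then have "exp (2/5::real) \<le> 3/2" by (simp add: exp_minus field_simps)
  then have 1: "2/5 \<le> ln (3/2::real)" using ln_ge_iff[of "3/2" "2/5"] by simp
  have "5/2 \<le> exp (1::real)" using exp_lower_Taylor_quadratic[of 1] by simp
  then have 2: "exp (-1::real) \<le> 2/5" by (simp add: exp_minus field_simps)
  have "y \<le> exp (y - 1)" using exp_ge_add_one_self[of "y - 1"] by simp
  also have "\<dots> = exp (-1) * exp y" by (simp flip: exp_add)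
  also have "\<dots> \<le> ln (3/2) * exp y" using 1 2 by (intro mult_right_mono) auto
  finally show ?thesis .
qed

section \<open>Symmetric matrices and supports\<close>

text \<open>A \<open>LEAST\<close> over the reals has no meaning until a minimum is exhibited. It is
  the minimum of the quadratic form on the unit sphere: the minimiser is an eigenvector, and every
  eigenvalue is a value of the form.\<close>

lemma smallest_eigenvalue_Rayleigh:
  fixes A :: "real ^ 'n ^ 'n"
  assumes sym: "transpose A = A"
  obtains v where "v \<noteq> 0" "A *v v = smallest_eigenvalue A *\<^sub>R v"
    "\<And>w. smallest_eigenvalue A * (norm w)\<^sup>2 \<le> w \<bullet> (A *v w)"
proof -
  define S where "S = sphere (0 :: real ^ 'n) 1"
  have symi: "x \<bullet> (A *v y) = y \<bullet> (A *v x)" for x y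
  proof -
    have "x \<bullet> (A *v y) = (transpose A *v x) \<bullet> y"
      by (simp only: transpose_matrix_vector dot_lmul_matrix)
    then show ?thesis by (simp only: sym inner_commute)
  qed
  obtain e :: "real ^ 'n" where "norm e = 1" using vector_choose_size[of 1] by auto
  then have "S \<noteq> {}" by (auto simp: S_def)
  moreover have "continuous_on S (\<lambda>v. v \<bullet> (A *v v))"
    by (intro continuous_on_inner continuous_on_id matrix_vector_mult_linear_continuous_on)
  ultimately obtain v where v: "v \<in> S" "\<And>w. w \<in> S \<Longrightarrow> v \<bullet> (A *v v) \<le> w \<bullet> (A *v w)"
    using continuous_attains_inf[of S "\<lambda>v. v \<bullet> (A *v v)"] by (auto simp: S_def)
  define l where "l = v \<bullet> (A *v v)"
  have vn: "norm v = 1" using v by (simp add: S_def)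
  have ray: "l * (norm w)\<^sup>2 \<le> w \<bullet> (A *v w)" for w
  proof (cases "w = 0")
    case False
    have "l \<le> (w /\<^sub>R norm w) \<bullet> (A *v (w /\<^sub>R norm w))"
      unfolding l_def using False by (intro v(2)) (simp add: S_def)
    also have "\<dots> = (w \<bullet> (A *v w)) / (norm w)\<^sup>2"
      by (simp add: matrix_vector_mult_scaleR divide_simps power2_eq_square)
    finally show ?thesis using False by (simp add: field_simps)
  qed simp
  have eig: "A *v v = l *\<^sub>R v"
  proof -
    \<comment> \<open>First variation in the direction of the residual: the form minus
      \<open>l\<close> times the squared norm is nonnegative and vanishes at \<open>v\<close>, and
      its linear term along \<open>w\<close> is 2 s |w|^2, which forces \<open>w\<close> to be
      zero.\<close>
    define w where "w = A *v v - l *\<^sub>R v"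
    define b where "b = w \<bullet> (A *v w) - l * (norm w)\<^sup>2"
    have "0 \<le> 2 * s * (norm w)\<^sup>2 + s\<^sup>2 * b" for s
    proof -
      have e: "A *v (v + s *\<^sub>R w) = A *v v + s *\<^sub>R (A *v w)"
        by (simp add: matrix_vector_right_distrib matrix_vector_mult_scaleR)
      have n: "(norm w)\<^sup>2 = w \<bullet> (A *v v) - l * (w \<bullet> v)"
        by (simp add: power2_norm_eq_inner w_def inner_diff_left inner_diff_right algebra_simps
            inner_commute)
      have "(v + s *\<^sub>R w) \<bullet> (A *v (v + s *\<^sub>R w)) - l * (norm (v + s *\<^sub>R w))\<^sup>2
        = (v \<bullet> (A *v v) - l * (norm v)\<^sup>2) + 2 * s * (w \<bullet> (A *v v) - l * (w \<bullet> v)) + s\<^sup>2 * b"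
        unfolding e b_def power2_norm_eq_inner using symi[of v w]
        by (simp add: inner_add_left inner_add_right algebra_simps power2_eq_square inner_commute)
      also have "\<dots> = 2 * s * (norm w)\<^sup>2 + s\<^sup>2 * b" using n by (simp add: l_def vn)
      finally show ?thesis using ray[of "v + s *\<^sub>R w"] by linarith
    qed note q = this
    have "(norm w)\<^sup>2 \<le> 0"
    proof (rule ccontr)
      assume "\<not> (norm w)\<^sup>2 \<le> 0"
      then have pos: "0 < (norm w)\<^sup>2" by simp
      have b: "0 < \<bar>b\<bar> + 1" by simp
      \<comment> \<open>A negative step so short that the linear term outweighs s^2 * b.\<close>
      have "0 \<le> 2 * (- ((norm w)\<^sup>2 / (\<bar>b\<bar> + 1))) * (norm w)\<^sup>2 + (- ((norm w)\<^sup>2 / (\<bar>b\<bar> + 1)))\<^sup>2 * b"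
        by (rule q)
      also have "\<dots> = ((norm w)\<^sup>2)\<^sup>2 / (\<bar>b\<bar> + 1)\<^sup>2 * (b - 2 * (\<bar>b\<bar> + 1))"
        using b by (simp add: power2_eq_square divide_simps) (simp add: algebra_simps)
      also have "\<dots> < 0" using pos b by (intro mult_pos_neg) (auto intro!: divide_pos_pos)
      finally show False by simp
    qed
    then show ?thesis by (simp add: w_def)
  qed
  have "smallest_eigenvalue A = l" unfolding smallest_eigenvalue_def
  proof (rule Least_equality)
    show "\<exists>v. v \<noteq> 0 \<and> A *v v = l *\<^sub>R v" using eig vn by (intro exI[of _ v]) auto
    fix k assume "\<exists>w. w \<noteq> 0 \<and> A *v w = k *\<^sub>R w"
    then obtain w where w: "w \<noteq> 0" "A *v w = k *\<^sub>R w" by auto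
    from ray[of w] show "l \<le> k" using w by (simp add: power2_norm_eq_inner)
  qed
  with that[of v] vn eig ray show thesis by fastforce
qed

text \<open>\<open>K_g\<close> is written with the operator norm of the inverse, while the estimates
  produce the inverse of the smallest eigenvalue. Testing the inverse matrix on the eigenvector
  compares the two.\<close>

lemma inverse_eigenvalue_le_onorm:
  fixes A :: "real ^ 'n ^ 'n"
  assumes "invertible A" "A *v v = l *\<^sub>R v" "v \<noteq> 0" "0 < l"
  shows "1 / l \<le> onorm (\<lambda>v. matrix_inv A *v v)"
proof -
  have "v = matrix_inv A *v (A *v v)"
    using someI_ex[OF assms(1)[unfolded invertible_def]]
    by (simp add: matrix_vector_mul_assoc matrix_inv_def)
  then have "v = l *\<^sub>R (matrix_inv A *v v)"
    by (simp add: assms(2) matrix_vector_mult_scaleR)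
  then have "norm v = l * norm (matrix_inv A *v v)"
    using \<open>0 < l\<close> by (metis abs_of_pos norm_scaleR)
  then have "1 / l = norm (matrix_inv A *v v) / norm v"
    using assms by (auto simp: field_simps)
  also have "\<dots> \<le> onorm (\<lambda>v. matrix_inv A *v v)"
    by (rule le_onorm) (rule matrix_vector_mul_bounded_linear)
  finally show ?thesis .
qed

text \<open>The complement of the support is the union of all open null sets; by Lindelof countably
  many of them suffice.\<close>

lemma AE_in_measure_support:
  fixes M :: "'a::second_countable_topology measure"
  assumes "sets M = sets borel"
  shows "AE x in M. x \<in> measure_support M"
proof -
  let ?F = "{S. open S \<and> emeasure M S = 0}"
  obtain G where G: "G \<subseteq> ?F" "countable G" "\<Union>G = \<Union>?F"
    using Lindelof[of ?F] by blast
  have "\<Union>G \<in> null_sets M"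
    using G assms by (intro null_sets_UN'[of G "\<lambda>x. x", simplified]) (auto intro!: null_setsI)
  moreover have "- measure_support M = \<Union>?F"
    by (auto simp: measure_support_def)
  ultimately have "- measure_support M \<in> null_sets M" using G by simp
  then show ?thesis by (rule AE_I') auto
qed

text \<open>\<open>suppXY\<close> is the product of the marginal supports, which may exceed the
  support of the joint law; it has full measure because each coordinate lies in its marginal support
  almost surely.\<close>

lemma AE_in_suppXY:
  assumes "sets \<nu> = sets borel"
  shows "AE z in \<nu>. z \<in> suppXY \<nu>"
proof -
  have "AE z in \<nu>. fst z \<in> suppX \<nu>"
    unfolding suppX_def by (rule AE_distrD[OF _ AE_in_measure_support])
      (simp_all add: measurable_cong_sets[OF assms refl] borel_measurable_continuous_onI continuous_on_fst continuous_on_snd)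
  moreover have "AE z in \<nu>. snd z \<in> suppY \<nu>"
    unfolding suppY_def by (rule AE_distrD[OF _ AE_in_measure_support])
      (simp_all add: measurable_cong_sets[OF assms refl] borel_measurable_continuous_onI continuous_on_fst continuous_on_snd)
  ultimately show ?thesis by eventually_elim (auto simp: suppXY_def mem_Times_iff)
qed

section \<open>Bounded measurable functions\<close>

text \<open>A class closed under every operation below, exp included, on which integrability and
  Fubini come for free. The bound is pointwise on the whole space, which suits measures already
  restricted to their supports.\<close>

definition bounded_measurable :: "'a measure \<Rightarrow> ('a \<Rightarrow> 'b::euclidean_space) \<Rightarrow> bool" where
  "bounded_measurable M f \<longleftrightarrow> f \<in> borel_measurable M \<and> (\<exists>B. \<forall>x\<in>space M. norm (f x) \<le> B)"

lemma bounded_measurableI: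
  "f \<in> borel_measurable M \<Longrightarrow> (\<And>x. x \<in> space M \<Longrightarrow> norm (f x) \<le> B) \<Longrightarrow> bounded_measurable M f"
  by (auto simp: bounded_measurable_def)

lemma bounded_measurableD:
  assumes "bounded_measurable M f"
  shows "f \<in> borel_measurable M" "\<exists>B. \<forall>x\<in>space M. norm (f x) \<le> B"
  using assms by (auto simp: bounded_measurable_def)

lemma bounded_measurableE:
  assumes "bounded_measurable M f"
  obtains B where "0 \<le> B" "\<And>x. x \<in> space M \<Longrightarrow> norm (f x) \<le> B"
proof -
  obtain B where "\<forall>x\<in>space M. norm (f x) \<le> B" using assms by (auto simp: bounded_measurable_def)
  then show thesis by (intro that[of "max 0 B"]) (auto intro: max.coboundedI2)
qed

lemma bounded_measurable_cong:
  "(\<And>x. x \<in> space M \<Longrightarrow> f x = g x) \<Longrightarrow> bounded_measurable M f \<longleftrightarrow> bounded_measurable M g"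
  by (auto simp: bounded_measurable_def cong: measurable_cong)

named_theorems bm_intros

lemma bm_const [bm_intros]: "bounded_measurable M (\<lambda>x. c)"
  by (auto simp: bounded_measurable_def)

lemma bm_add [bm_intros]:
  assumes "bounded_measurable M f" "bounded_measurable M g"
  shows "bounded_measurable M (\<lambda>x. f x + g x)"
proof -
  obtain A B where "\<And>x. x \<in> space M \<Longrightarrow> norm (f x) \<le> A" "\<And>x. x \<in> space M \<Longrightarrow> norm (g x) \<le> B"
    using assms by (metis bounded_measurableE)
  then show ?thesis using assms[THEN bounded_measurableD(1)]
    by (intro bounded_measurableI[of _ _ "A + B"]) (auto intro: norm_triangle_mono)
qed

lemma bm_scaleR [bm_intros]:
  assumes "bounded_measurable M f" "bounded_measurable M g"
  shows "bounded_measurable M (\<lambda>x. f x *\<^sub>R g x)"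
proof -
  obtain A B where "0 \<le> A" "\<And>x. x \<in> space M \<Longrightarrow> norm (f x) \<le> A" "\<And>x. x \<in> space M \<Longrightarrow> norm (g x) \<le> B"
    using assms by (metis bounded_measurableE)
  then show ?thesis using assms[THEN bounded_measurableD(1)]
    by (intro bounded_measurableI[of _ _ "A * B"]) (auto intro!: mult_mono)
qed

lemma bm_mult [bm_intros]:
  fixes f g :: "'a \<Rightarrow> real"
  shows "bounded_measurable M f \<Longrightarrow> bounded_measurable M g \<Longrightarrow> bounded_measurable M (\<lambda>x. f x * g x)"
  using bm_scaleR[of M f g] by simp

lemma bm_minus [bm_intros]:
  assumes "bounded_measurable M f"
  shows "bounded_measurable M (\<lambda>x. - f x)"
  using bm_scaleR[OF bm_const[of M "-1"] assms] by simp

lemma bm_diff [bm_intros]: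
  assumes "bounded_measurable M f" "bounded_measurable M g"
  shows "bounded_measurable M (\<lambda>x. f x - g x)"
  using bm_add[OF assms(1) bm_minus[OF assms(2)]] by simp

lemma bm_divide [bm_intros]:
  fixes f :: "'a \<Rightarrow> real"
  assumes "bounded_measurable M f"
  shows "bounded_measurable M (\<lambda>x. f x / c)"
  using bm_mult[OF assms bm_const[of M "1/c"]] by simp

lemma bm_power2 [bm_intros]:
  fixes f :: "'a \<Rightarrow> real"
  assumes "bounded_measurable M f"
  shows "bounded_measurable M (\<lambda>x. (f x)\<^sup>2)"
  using bm_mult[OF assms assms] by (simp add: power2_eq_square)

lemma bm_norm [bm_intros]:
  assumes "bounded_measurable M f"
  shows "bounded_measurable M (\<lambda>x. norm (f x))"
  using assms by (auto simp: bounded_measurable_def)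

lemma bm_abs [bm_intros]:
  fixes f :: "'a \<Rightarrow> real"
  assumes "bounded_measurable M f"
  shows "bounded_measurable M (\<lambda>x. \<bar>f x\<bar>)"
  using bm_norm[OF assms] by simp

lemma bm_max [bm_intros]:
  fixes f :: "'a \<Rightarrow> real"
  assumes "bounded_measurable M f" "bounded_measurable M g"
  shows "bounded_measurable M (\<lambda>x. max (f x) (g x))"
proof -
  have "(\<lambda>x. max (f x) (g x)) = (\<lambda>x. (f x + g x + \<bar>f x - g x\<bar>) / 2)" by (auto simp: max_def)
  then show ?thesis using assms by (auto intro!: bm_intros)
qed

lemma bm_inner [bm_intros]:
  fixes f :: "'a \<Rightarrow> 'b::euclidean_space"
  assumes "bounded_measurable M f" "bounded_measurable M g"
  shows "bounded_measurable M (\<lambda>x. f x \<bullet> g x)"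
proof -
  obtain A B where "0 \<le> A" "\<And>x. x \<in> space M \<Longrightarrow> norm (f x) \<le> A" "\<And>x. x \<in> space M \<Longrightarrow> norm (g x) \<le> B"
    using assms by (metis bounded_measurableE)
  then show ?thesis using assms[THEN bounded_measurableD(1)]
    by (intro bounded_measurableI[of _ _ "A * B"])
      (auto intro!: mult_mono Cauchy_Schwarz_ineq2[THEN order_trans])
qed

lemma bm_exp [bm_intros]:
  fixes f :: "'a \<Rightarrow> real"
  assumes "bounded_measurable M f"
  shows "bounded_measurable M (\<lambda>x. exp (f x))"
proof -
  obtain A where "\<And>x. x \<in> space M \<Longrightarrow> norm (f x) \<le> A"
    using assms by (metis bounded_measurableE)
  then show ?thesis using bounded_measurableD(1)[OF assms]
    by (intro bounded_measurableI[of _ _ "exp A"]) (auto simp: abs_le_iff)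
qed

lemma bm_fst:
  assumes "bounded_measurable M f"
  shows "bounded_measurable (M \<Otimes>\<^sub>M N) (\<lambda>w. f (fst w))"
  using assms by (auto simp: bounded_measurable_def space_pair_measure)

lemma bm_snd:
  assumes "bounded_measurable N f"
  shows "bounded_measurable (M \<Otimes>\<^sub>M N) (\<lambda>w. f (snd w))"
  using assms by (auto simp: bounded_measurable_def space_pair_measure)

lemma bm_Pair1:
  assumes "bounded_measurable (M \<Otimes>\<^sub>M N) (\<lambda>w. k (fst w) (snd w))" "u \<in> space M"
  shows "bounded_measurable N (\<lambda>z. k u z)"
proof -
  have "(\<lambda>w. k (fst w) (snd w)) \<circ> Pair u \<in> borel_measurable N"
    using assms by (intro measurable_comp[OF measurable_Pair1'[OF assms(2)] bounded_measurableD(1)])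
  then show ?thesis using assms by (fastforce simp: bounded_measurable_def space_pair_measure o_def)
qed

lemma bm_Pair2:
  assumes "bounded_measurable (M \<Otimes>\<^sub>M N) (\<lambda>w. k (fst w) (snd w))" "z \<in> space N"
  shows "bounded_measurable M (\<lambda>u. k u z)"
proof -
  have "(\<lambda>w. k (fst w) (snd w)) \<circ> (\<lambda>u. (u, z)) \<in> borel_measurable M"
    using assms by (intro measurable_comp[OF measurable_Pair2'[OF assms(2)] bounded_measurableD(1)])
  then show ?thesis using assms by (fastforce simp: bounded_measurable_def space_pair_measure o_def)
qed

section \<open>Integration and Fubini for bounded measurable functions\<close>

context prob_space
begin

lemma bm_integrable: "bounded_measurable M f \<Longrightarrow> integrable M f"
  by (auto simp: bounded_measurable_def intro!: integrable_const_bound AE_I2)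

lemma bm_integral_mono:
  fixes f g :: "'a \<Rightarrow> real"
  assumes "bounded_measurable M f" "bounded_measurable M g" "\<And>x. x \<in> space M \<Longrightarrow> f x \<le> g x"
  shows "integral\<^sup>L M f \<le> integral\<^sup>L M g"
  using assms by (intro integral_mono bm_integrable) auto

lemma bm_norm_integral_le:
  assumes "bounded_measurable M f" "\<And>x. x \<in> space M \<Longrightarrow> norm (f x) \<le> B"
  shows "norm (integral\<^sup>L M f) \<le> B"
proof -
  have "norm (integral\<^sup>L M f) \<le> (\<integral>x. norm (f x) \<partial>M)" by (rule integral_norm_bound)
  also have "\<dots> \<le> (\<integral>x. B \<partial>M)" using assms by (intro bm_integral_mono bm_intros) auto
  finally show ?thesis by (simp add: prob_space)
qed

lemma bm_integral_le:
  fixes f :: "'a \<Rightarrow> real"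
  assumes "bounded_measurable M f" "\<And>x. x \<in> space M \<Longrightarrow> f x \<le> B"
  shows "integral\<^sup>L M f \<le> B"
  using bm_integral_mono[OF assms(1) bm_const[of M B]] assms(2) by (simp add: prob_space)

lemma bm_integral_ge:
  fixes f :: "'a \<Rightarrow> real"
  assumes "bounded_measurable M f" "\<And>x. x \<in> space M \<Longrightarrow> B \<le> f x"
  shows "B \<le> integral\<^sup>L M f"
  using bm_integral_mono[OF bm_const[of M B] assms(1)] assms(2) by (simp add: prob_space)

end

context pair_prob_space
begin

lemma bm_Fubini1:
  assumes "bounded_measurable (M1 \<Otimes>\<^sub>M M2) (\<lambda>w. k (fst w) (snd w))"
  shows "(\<integral>w. k (fst w) (snd w) \<partial>(M1 \<Otimes>\<^sub>M M2)) = (\<integral>u. (\<integral>z. k u z \<partial>M2) \<partial>M1)"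
  using integral_fst[of k] bm_integrable[OF assms] by (simp add: case_prod_beta')

lemma bm_Fubini2:
  assumes "bounded_measurable (M1 \<Otimes>\<^sub>M M2) (\<lambda>w. k (fst w) (snd w))"
  shows "(\<integral>w. k (fst w) (snd w) \<partial>(M1 \<Otimes>\<^sub>M M2)) = (\<integral>z. (\<integral>u. k u z \<partial>M1) \<partial>M2)"
  using integral_snd[of k] bm_integrable[OF assms] by (simp add: case_prod_beta')

lemma bm_integral1:
  assumes k: "bounded_measurable (M1 \<Otimes>\<^sub>M M2) (\<lambda>w. k (fst w) (snd w))"
  shows "bounded_measurable M1 (\<lambda>u. \<integral>z. k u z \<partial>M2)"
proof -
  obtain B where B0: "\<And>w. w \<in> space (M1 \<Otimes>\<^sub>M M2) \<Longrightarrow> norm (k (fst w) (snd w)) \<le> B"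
    using bounded_measurableD(2)[OF k] by blast
  have B: "norm (k u z) \<le> B" if "u \<in> space M1" "z \<in> space M2" for u z
    using B0[of "(u, z)"] that by (simp add: space_pair_measure)
  have "case_prod k \<in> borel_measurable (M1 \<Otimes>\<^sub>M M2)"
    using bounded_measurableD(1)[OF k] by (simp add: case_prod_beta')
  then have "(\<lambda>u. \<integral>z. k u z \<partial>M2) \<in> borel_measurable M1"
    by (rule M2.borel_measurable_lebesgue_integral)
  then show ?thesis
    by (rule bounded_measurableI[of _ _ B]) (intro M2.bm_norm_integral_le bm_Pair1[of _ _ k, OF k] B)
qed

lemma bm_integral2:
  assumes k: "bounded_measurable (M1 \<Otimes>\<^sub>M M2) (\<lambda>w. k (fst w) (snd w))"
  shows "bounded_measurable M2 (\<lambda>z. \<integral>u. k u z \<partial>M1)"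
proof -
  obtain B where B0: "\<And>w. w \<in> space (M1 \<Otimes>\<^sub>M M2) \<Longrightarrow> norm (k (fst w) (snd w)) \<le> B"
    using bounded_measurableD(2)[OF k] by blast
  have B: "norm (k u z) \<le> B" if "u \<in> space M1" "z \<in> space M2" for u z
    using B0[of "(u, z)"] that by (simp add: space_pair_measure)
  have "(\<lambda>(z, u). k u z) \<in> borel_measurable (M2 \<Otimes>\<^sub>M M1)"
    using measurable_compose[OF measurable_pair_swap' bounded_measurableD(1)[OF k]]
    by (simp add: case_prod_beta')
  then have "(\<lambda>z. \<integral>u. k u z \<partial>M1) \<in> borel_measurable M2"
    by (rule M1.borel_measurable_lebesgue_integral)
  then show ?thesis
    by (rule bounded_measurableI[of _ _ B]) (intro M1.bm_norm_integral_le bm_Pair2[of _ _ k, OF k] B)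
qed

end

section \<open>The dual objective with bounded potentials\<close>

text \<open>The Euclidean data reduced to what the estimates use: \<open>z\<close> stands for the
  pair (x, y), \<open>X\<close> is a bounded centred vector, the cost has values in [0, C] and
  oscillates in \<open>u\<close> by at most \<open>L\<close>, and \<open>lam\<close> is a coercivity
  constant of the second moment. In the application \<open>R\<close> is \<open>M_x\<close> and
  \<open>L\<close> is \<open>L_c\<close> times the diameter of the support of \<mu>.\<close>

locale quantile_dual = pair_prob_space M N
  for M :: "'a measure" and N :: "'z measure" +
  fixes X :: "'z \<Rightarrow> 'e::euclidean_space" and c :: "'a \<Rightarrow> 'z \<Rightarrow> real" and \<epsilon> R C L lam :: real
  assumes X_measurable: "X \<in> borel_measurable N"
    and X_le: "z \<in> space N \<Longrightarrow> norm (X z) \<le> R"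
    and R_ge: "1 \<le> R"
    and X_mean: "(\<integral>z. X z \<partial>N) = 0"
    and X_coercive: "lam * (norm v)\<^sup>2 \<le> (\<integral>z. (v \<bullet> X z)\<^sup>2 \<partial>N)"
    and lam_pos: "0 < lam"
    and c_measurable: "(\<lambda>w. c (fst w) (snd w)) \<in> borel_measurable (M \<Otimes>\<^sub>M N)"
    and c_nonneg: "u \<in> space M \<Longrightarrow> z \<in> space N \<Longrightarrow> 0 \<le> c u z"
    and c_le: "u \<in> space M \<Longrightarrow> z \<in> space N \<Longrightarrow> c u z \<le> C"
    and c_osc: "u \<in> space M \<Longrightarrow> u' \<in> space M \<Longrightarrow> z \<in> space N \<Longrightarrow> \<bar>c u z - c u' z\<bar> \<le> L"
    and eps_pos: "0 < \<epsilon>"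
begin

abbreviation "P \<equiv> M \<Otimes>\<^sub>M N"

definition xi where "xi f g h u z = f u + g u \<bullet> X z + h z - c u z"

definition gibbs where "gibbs f g h u z = exp (xi f g h u z / \<epsilon>)"

definition D where
  "D f g h = (\<integral>u. f u \<partial>M) + (\<integral>z. h z \<partial>N)
    - \<epsilon> * ((\<integral>w. gibbs f g h (fst w) (snd w) \<partial>P) - 1)"

definition bm_triple :: "('a \<Rightarrow> real) \<Rightarrow> ('a \<Rightarrow> 'e) \<Rightarrow> ('z \<Rightarrow> real) \<Rightarrow> bool" where
  "bm_triple f g h \<longleftrightarrow> bounded_measurable M f \<and> bounded_measurable M g \<and> bounded_measurable N h"

lemma bm_X: "bounded_measurable N X"
  using X_measurable X_le by (rule bounded_measurableI)

lemma bm_c: "bounded_measurable P (\<lambda>w. c (fst w) (snd w))"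
  using c_measurable c_nonneg c_le
  by (intro bounded_measurableI[of _ _ C]) (auto simp: space_pair_measure)

lemma C_nonneg: "0 \<le> C"
proof -
  obtain u z where "u \<in> space M" "z \<in> space N" using M1.not_empty M2.not_empty by blast
  then show ?thesis using c_nonneg c_le by force
qed

lemma inner_X_abs_le: "z \<in> space N \<Longrightarrow> \<bar>v \<bullet> X z\<bar> \<le> norm v * R"
  using X_le by (intro Cauchy_Schwarz_ineq2[THEN order_trans] mult_left_mono) auto

lemma xi_bm:
  assumes "bm_triple f g h"
  shows "bounded_measurable P (\<lambda>w. xi f g h (fst w) (snd w))"
  using assms unfolding xi_def bm_triple_def by (auto intro!: bm_intros bm_c bm_X bm_fst bm_snd)

lemma gibbs_bm:
  assumes "bm_triple f g h"
  shows "bounded_measurable P (\<lambda>w. gibbs f g h (fst w) (snd w))"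
  unfolding gibbs_def using xi_bm[OF assms] by (auto intro!: bm_intros)

lemma gibbs_pos: "0 < gibbs f g h u z"
  by (simp add: gibbs_def)

lemma integral_inner_X: "(\<integral>z. v \<bullet> X z \<partial>N) = 0"
  using integral_inner_right[of v N X] M2.bm_integrable[OF bm_X] X_mean by simp

text \<open>The g-term integrates to zero because \<open>X\<close> has mean zero. So the linear part
  of the objective, in which g does not occur, is the integral of \<open>xi\<close> up to the
  cost.\<close>

lemma integral_xi:
  assumes "bm_triple f g h"
  shows "(\<integral>w. xi f g h (fst w) (snd w) \<partial>P)
    = (\<integral>u. f u \<partial>M) + (\<integral>z. h z \<partial>N) - (\<integral>w. c (fst w) (snd w) \<partial>P)"
proof -
  note b = assms[unfolded bm_triple_def]
  have f: "bounded_measurable P (\<lambda>w. f (fst w))" and h: "bounded_measurable P (\<lambda>w. h (snd w))"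
    and g: "bounded_measurable P (\<lambda>w. g (fst w) \<bullet> X (snd w))"
    using b by (auto intro!: bm_inner bm_fst bm_snd bm_X)
  have 1: "(\<integral>w. f (fst w) \<partial>P) = (\<integral>u. f u \<partial>M)"
    using bm_Fubini1[of "\<lambda>u z. f u", OF f] by (simp add: M2.prob_space)
  have 2: "(\<integral>w. h (snd w) \<partial>P) = (\<integral>z. h z \<partial>N)"
    using bm_Fubini1[of "\<lambda>u z. h z", OF h] by (simp add: M1.prob_space)
  have 3: "(\<integral>w. g (fst w) \<bullet> X (snd w) \<partial>P) = 0"
    using bm_Fubini1[of "\<lambda>u z. g u \<bullet> X z", OF g] by (simp add: integral_inner_X)
  show ?thesis unfolding xi_def using 1 2 3 f g h bm_c by (simp add: bm_integrable)
qed

text \<open>The objective becomes the integral of one concave function of \<open>xi\<close>, so that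
  concavity can be argued pointwise.\<close>

lemma D_eq:
  assumes "bm_triple f g h"
  shows "D f g h = (\<integral>w. c (fst w) (snd w) \<partial>P) + \<epsilon>
    + (\<integral>w. xi f g h (fst w) (snd w) - \<epsilon> * gibbs f g h (fst w) (snd w) \<partial>P)"
  unfolding D_def using integral_xi[OF assms] xi_bm[OF assms] gibbs_bm[OF assms]
  by (simp add: bm_integrable algebra_simps)

lemma D_cong:
  assumes "\<And>u. u \<in> space M \<Longrightarrow> f u = f' u" "\<And>u. u \<in> space M \<Longrightarrow> g u = g' u"
    "\<And>z. z \<in> space N \<Longrightarrow> h z = h' z"
  shows "D f g h = D f' g' h'"
proof -
  have "(\<integral>w. gibbs f g h (fst w) (snd w) \<partial>P) = (\<integral>w. gibbs f' g' h' (fst w) (snd w) \<partial>P)"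
    using assms by (intro Bochner_Integration.integral_cong)
      (auto simp: gibbs_def xi_def space_pair_measure)
  moreover have "(\<integral>u. f u \<partial>M) = (\<integral>u. f' u \<partial>M)" "(\<integral>z. h z \<partial>N) = (\<integral>z. h' z \<partial>N)"
    using assms by (auto intro!: Bochner_Integration.integral_cong)
  ultimately show ?thesis by (simp add: D_def)
qed

text \<open>The function s - \<epsilon> * exp (s / \<epsilon>) is at most -\<epsilon>. For the
  starting triple this yields D0 <= C, on which the signs of several constants depend.\<close>

lemma D_le_C:
  assumes "bm_triple f g h"
  shows "D f g h \<le> C"
proof -
  have "(\<integral>w. xi f g h (fst w) (snd w) - \<epsilon> * gibbs f g h (fst w) (snd w) \<partial>P) \<le> - \<epsilon>"
  proof (rule bm_integral_le)
    fix w
    have "1 + xi f g h (fst w) (snd w) / \<epsilon> \<le> gibbs f g h (fst w) (snd w)"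
      unfolding gibbs_def by (rule exp_ge_add_one_self)
    then show "xi f g h (fst w) (snd w) - \<epsilon> * gibbs f g h (fst w) (snd w) \<le> - \<epsilon>"
      using eps_pos by (simp add: field_simps)
  qed (intro bm_intros xi_bm gibbs_bm assms)
  moreover have "(\<integral>w. c (fst w) (snd w) \<partial>P) \<le> C"
    using bm_c c_le by (intro bm_integral_le) (auto simp: space_pair_measure)
  ultimately show ?thesis unfolding D_eq[OF assms] by simp
qed

text \<open>Strong concavity. The factor \<open>1 - gibbs\<close> is the density of the gradient,
  and the common lower bound -K on the exponents determines the modulus.\<close>

lemma D_diff_le:
  assumes t: "bm_triple f g h" and t': "bm_triple f' g' h'"
    and ge: "\<And>u z. u \<in> space M \<Longrightarrow> z \<in> space N \<Longrightarrow> - K \<le> xi f g h u z"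
      "\<And>u z. u \<in> space M \<Longrightarrow> z \<in> space N \<Longrightarrow> - K \<le> xi f' g' h' u z"
  shows "D f' g' h' - D f g h
    \<le> (\<integral>w. (1 - gibbs f g h (fst w) (snd w)) * (xi f' g' h' (fst w) (snd w) - xi f g h (fst w) (snd w))
         - exp (- K / \<epsilon>) / (2 * \<epsilon>) * (xi f' g' h' (fst w) (snd w) - xi f g h (fst w) (snd w))\<^sup>2 \<partial>P)"
    (is "_ \<le> integral\<^sup>L P ?rhs")
proof -
  let ?lhs = "\<lambda>w. (xi f' g' h' (fst w) (snd w) - \<epsilon> * gibbs f' g' h' (fst w) (snd w))
    - (xi f g h (fst w) (snd w) - \<epsilon> * gibbs f g h (fst w) (snd w))"
  have "D f' g' h' - D f g h = integral\<^sup>L P ?lhs"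
    unfolding D_eq[OF t] D_eq[OF t']
    by (subst Bochner_Integration.integral_diff)
      (auto intro!: bm_integrable bm_intros xi_bm gibbs_bm t t')
  also have "\<dots> \<le> integral\<^sup>L P ?rhs"
  proof (rule bm_integral_mono)
    fix w assume "w \<in> space P"
    then have w: "fst w \<in> space M" "snd w \<in> space N" by (auto simp: space_pair_measure)
    define a where "a = xi f g h (fst w) (snd w)"
    define b where "b = xi f' g' h' (fst w) (snd w)"
    have "exp (a/\<epsilon>) + exp (a/\<epsilon>) * (b/\<epsilon> - a/\<epsilon>) + exp (- K/\<epsilon>) / 2 * (b/\<epsilon> - a/\<epsilon>)\<^sup>2 \<le> exp (b/\<epsilon>)"
      using ge(1)[OF w] ge(2)[OF w] eps_pos
      by (intro exp_ge_tangent_quadratic) (simp_all add: a_def b_def field_simps)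
    then have "\<epsilon> * (exp (a/\<epsilon>) + exp (a/\<epsilon>) * (b/\<epsilon> - a/\<epsilon>) + exp (- K/\<epsilon>) / 2 * (b/\<epsilon> - a/\<epsilon>)\<^sup>2)
        \<le> \<epsilon> * exp (b/\<epsilon>)"
      using eps_pos by simp
    moreover have "\<epsilon> * (exp (a/\<epsilon>) + exp (a/\<epsilon>) * (b/\<epsilon> - a/\<epsilon>) + exp (- K/\<epsilon>) / 2 * (b/\<epsilon> - a/\<epsilon>)\<^sup>2)
      = \<epsilon> * exp (a/\<epsilon>) + exp (a/\<epsilon>) * (b - a) + exp (- K/\<epsilon>) / (2 * \<epsilon>) * (b - a)\<^sup>2"
      using eps_pos by (simp add: field_simps power2_eq_square)
    ultimately show "?lhs w \<le> ?rhs w"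
      unfolding gibbs_def a_def[symmetric] b_def[symmetric] by (simp add: algebra_simps)
  qed (intro bm_intros xi_bm gibbs_bm t t')+
  finally show ?thesis .
qed

text \<open>For each \<open>u\<close> the density \<open>p u\<close> has the same mass and the same
  X-mean as the constant 1. Hence \<open>1 - p\<close> is orthogonal to all functions affine in
  \<open>X\<close> with coefficients depending on \<open>u\<close>, which are the (f,
  g)-directions.\<close>

lemma integral_fg_stationary:
  assumes p: "bounded_measurable P (\<lambda>w. p (fst w) (snd w))"
    and p1: "\<And>u. u \<in> space M \<Longrightarrow> (\<integral>z. p u z \<partial>N) = 1"
    and pX: "\<And>u. u \<in> space M \<Longrightarrow> (\<integral>z. p u z *\<^sub>R X z \<partial>N) = 0"
    and a: "bounded_measurable M a" and b: "bounded_measurable M b"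
  shows "(\<integral>w. (1 - p (fst w) (snd w)) * (a (fst w) + b (fst w) \<bullet> X (snd w)) \<partial>P) = 0"
proof -
  have "(\<integral>w. (1 - p (fst w) (snd w)) * (a (fst w) + b (fst w) \<bullet> X (snd w)) \<partial>P)
    = (\<integral>u. (\<integral>z. (1 - p u z) * (a u + b u \<bullet> X z) \<partial>N) \<partial>M)"
    by (rule bm_Fubini1[of "\<lambda>u z. (1 - p u z) * (a u + b u \<bullet> X z)"])
      (intro bm_intros p bm_fst[OF a] bm_fst[OF b] bm_snd[OF bm_X])
  also have "\<dots> = (\<integral>u. 0 \<partial>M)"
  proof (rule Bochner_Integration.integral_cong[OF refl])
    fix u assume u: "u \<in> space M"
    note pu = bm_Pair1[of _ _ p, OF p u]
    have i: "integrable N (\<lambda>z. p u z)" "integrable N X" "integrable N (\<lambda>z. p u z *\<^sub>R X z)"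
      by (intro M2.bm_integrable bm_intros pu bm_X)+
    have "(\<integral>z. (1 - p u z) * (a u + b u \<bullet> X z) \<partial>N)
      = (\<integral>z. a u + b u \<bullet> X z - a u * p u z - b u \<bullet> (p u z *\<^sub>R X z) \<partial>N)"
      by (simp add: algebra_simps)
    also have "\<dots> = a u + b u \<bullet> (\<integral>z. X z \<partial>N) - a u * (\<integral>z. p u z \<partial>N) - b u \<bullet> (\<integral>z. p u z *\<^sub>R X z \<partial>N)"
      using i by (simp add: M2.prob_space del: inner_scaleR_right)
    also have "\<dots> = 0" using p1[OF u] pX[OF u] X_mean by simp
    finally show "(\<integral>z. (1 - p u z) * (a u + b u \<bullet> X z) \<partial>N) = 0" .
  qed
  finally show ?thesis by simp
qed

lemma integral_h_stationary:
  fixes h :: "'z \<Rightarrow> real"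
  assumes p: "bounded_measurable P (\<lambda>w. p (fst w) (snd w))"
    and p1: "\<And>z. z \<in> space N \<Longrightarrow> (\<integral>u. p u z \<partial>M) = 1"
    and h: "bounded_measurable N h"
  shows "(\<integral>w. (1 - p (fst w) (snd w)) * h (snd w) \<partial>P) = 0"
proof -
  have "(\<integral>w. (1 - p (fst w) (snd w)) * h (snd w) \<partial>P) = (\<integral>z. (\<integral>u. (1 - p u z) * h z \<partial>M) \<partial>N)"
    by (rule bm_Fubini2[of "\<lambda>u z. (1 - p u z) * h z"]) (intro bm_intros p bm_snd[OF h])
  also have "\<dots> = (\<integral>z. 0 \<partial>N)"
    using M1.bm_integrable[OF bm_Pair2[of _ _ p, OF p]] p1
    by (intro Bochner_Integration.integral_cong) (auto simp: M1.prob_space)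
  finally show ?thesis by simp
qed

text \<open>The purpose of the normalisation: integrating first over \<open>u\<close> kills the
  cross term when \<open>a\<close> and \<open>b\<close> have mean zero.\<close>

lemma integral_square_split:
  assumes t: "bm_triple a b d" and a: "(\<integral>u. a u \<partial>M) = 0" and b: "(\<integral>u. b u \<partial>M) = 0"
  shows "(\<integral>w. (a (fst w) + b (fst w) \<bullet> X (snd w) + d (snd w))\<^sup>2 \<partial>P)
    = (\<integral>w. (a (fst w) + b (fst w) \<bullet> X (snd w))\<^sup>2 \<partial>P) + (\<integral>z. (d z)\<^sup>2 \<partial>N)"
proof -
  note bm = t[unfolded bm_triple_def]
  let ?A = "\<lambda>u z. a u + b u \<bullet> X z"
  have A: "bounded_measurable P (\<lambda>w. ?A (fst w) (snd w))" and d: "bounded_measurable P (\<lambda>w. d (snd w))"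
    using bm by (auto intro!: bm_intros bm_fst bm_snd bm_X)
  have "(\<integral>w. ?A (fst w) (snd w) * d (snd w) \<partial>P) = (\<integral>z. (\<integral>u. ?A u z * d z \<partial>M) \<partial>N)"
    by (rule bm_Fubini2[of "\<lambda>u z. ?A u z * d z"]) (intro bm_mult A d)
  also have "\<dots> = (\<integral>z. 0 \<partial>N)"
    using bm a b by (intro Bochner_Integration.integral_cong) (auto simp: M1.bm_integrable)
  finally have cross: "(\<integral>w. ?A (fst w) (snd w) * d (snd w) \<partial>P) = 0" by simp
  have dd: "(\<integral>w. (d (snd w))\<^sup>2 \<partial>P) = (\<integral>z. (d z)\<^sup>2 \<partial>N)"
    using bm_Fubini1[of "\<lambda>u z. (d z)\<^sup>2", OF bm_power2[OF d]] by (simp add: M1.prob_space)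
  have "(\<integral>w. (?A (fst w) (snd w) + d (snd w))\<^sup>2 \<partial>P)
    = (\<integral>w. (?A (fst w) (snd w))\<^sup>2 + 2 * (?A (fst w) (snd w) * d (snd w)) + (d (snd w))\<^sup>2 \<partial>P)"
    by (rule Bochner_Integration.integral_cong) (simp_all add: power2_sum algebra_simps)
  also have "\<dots> = (\<integral>w. (?A (fst w) (snd w))\<^sup>2 \<partial>P)
      + 2 * (\<integral>w. ?A (fst w) (snd w) * d (snd w) \<partial>P) + (\<integral>w. (d (snd w))\<^sup>2 \<partial>P)"
    using A d bm_power2[OF A] bm_power2[OF d] bm_mult[OF A d]
    by (simp add: bm_integrable del: distrib_right_numeral)
  finally show ?thesis using cross dd by simp
qed

text \<open>For fixed \<open>u\<close> the cross term of the square vanishes because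
  \<open>X\<close> is centred, and coercivity bounds what is left in \<open>b\<close>.\<close>

lemma integral_square_ge:
  assumes "bounded_measurable M a" "bounded_measurable M b"
  shows "(\<integral>u. (a u)\<^sup>2 \<partial>M) + lam * (\<integral>u. (norm (b u))\<^sup>2 \<partial>M)
    \<le> (\<integral>w. (a (fst w) + b (fst w) \<bullet> X (snd w))\<^sup>2 \<partial>P)"
proof -
  have bmi: "bounded_measurable P (\<lambda>w. (a (fst w) + b (fst w) \<bullet> X (snd w))\<^sup>2)"
    using assms by (auto intro!: bm_power2 bm_add bm_inner bm_fst bm_snd bm_X)
  have "(\<integral>u. (a u)\<^sup>2 \<partial>M) + lam * (\<integral>u. (norm (b u))\<^sup>2 \<partial>M)
      = (\<integral>u. (a u)\<^sup>2 + lam * (norm (b u))\<^sup>2 \<partial>M)"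
    using assms by (simp add: M1.bm_integrable bm_intros)
  also have "\<dots> \<le> (\<integral>u. (\<integral>z. (a u + b u \<bullet> X z)\<^sup>2 \<partial>N) \<partial>M)"
  proof (rule M1.bm_integral_mono)
    fix u assume "u \<in> space M"
    have "(\<integral>z. (a u + b u \<bullet> X z)\<^sup>2 \<partial>N) = (\<integral>z. (a u)\<^sup>2 + 2 * a u * (b u \<bullet> X z) + (b u \<bullet> X z)\<^sup>2 \<partial>N)"
      by (simp add: power2_sum algebra_simps)
    also have "\<dots> = (a u)\<^sup>2 + 2 * a u * (\<integral>z. b u \<bullet> X z \<partial>N) + (\<integral>z. (b u \<bullet> X z)\<^sup>2 \<partial>N)"
      by (simp add: M2.bm_integrable bm_intros bm_X M2.prob_space)
    finally show "(a u)\<^sup>2 + lam * (norm (b u))\<^sup>2 \<le> (\<integral>z. (a u + b u \<bullet> X z)\<^sup>2 \<partial>N)"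
      using X_coercive[of "b u"] by (simp add: integral_inner_X)
  qed (use assms in \<open>auto intro!: bm_intros bm_integral1[of "\<lambda>u z. (a u + b u \<bullet> X z)\<^sup>2", OF bmi]\<close>)
  also have "\<dots> = (\<integral>w. (a (fst w) + b (fst w) \<bullet> X (snd w))\<^sup>2 \<partial>P)"
    using bm_Fubini1[of "\<lambda>u z. (a u + b u \<bullet> X z)\<^sup>2", OF bmi] by simp
  finally show ?thesis .
qed

end

section \<open>The two half steps\<close>

lemma (in prob_space) exp_integral_bounds:
  fixes f :: "'a \<Rightarrow> real"
  assumes "bounded_measurable M f" "\<And>x. x \<in> space M \<Longrightarrow> A \<le> f x" "\<And>x. x \<in> space M \<Longrightarrow> f x \<le> B"
  shows "A \<le> ln (\<integral>x. exp (f x) \<partial>M)" "ln (\<integral>x. exp (f x) \<partial>M) \<le> B" "0 < (\<integral>x. exp (f x) \<partial>M)"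
proof -
  have 1: "exp A \<le> (\<integral>x. exp (f x) \<partial>M)"
    using assms by (intro bm_integral_ge bm_intros) auto
  have 2: "(\<integral>x. exp (f x) \<partial>M) \<le> exp B"
    using assms by (intro bm_integral_le bm_intros) auto
  show 3: "0 < (\<integral>x. exp (f x) \<partial>M)" using 1 exp_gt_zero[of A] by linarith
  show "A \<le> ln (\<integral>x. exp (f x) \<partial>M)" using 1 3 by (simp add: ln_ge_iff)
  show "ln (\<integral>x. exp (f x) \<partial>M) \<le> B" using 2 3 by (metis exp_le_cancel_iff exp_ln)
qed

lemma (in prob_space) exp_integral_pos:
  fixes f :: "'a \<Rightarrow> real"
  assumes "bounded_measurable M f"
  shows "0 < (\<integral>x. exp (f x) \<partial>M)"
proof -
  obtain B where "\<forall>x\<in>space M. norm (f x) \<le> B" using bounded_measurableD(2)[OF assms] by blast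
  then show ?thesis using assms by (intro exp_integral_bounds[of _ "-B" B]) (auto simp: abs_le_iff)
qed

text \<open>The logarithm stays bounded because the integral lies between exp (-B) and exp
  B.\<close>

lemma (in pair_prob_space) bm_ln_integral_exp1:
  fixes k :: "'a \<Rightarrow> 'b \<Rightarrow> real"
  assumes k: "bounded_measurable (M1 \<Otimes>\<^sub>M M2) (\<lambda>w. k (fst w) (snd w))"
  shows "bounded_measurable M1 (\<lambda>u. ln (\<integral>z. exp (k u z) \<partial>M2))"
proof -
  obtain B where B0: "\<And>w. w \<in> space (M1 \<Otimes>\<^sub>M M2) \<Longrightarrow> norm (k (fst w) (snd w)) \<le> B"
    using bounded_measurableD(2)[OF k] by blast
  have B: "- B \<le> k u z" "k u z \<le> B" if "u \<in> space M1" "z \<in> space M2" for u z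
    using B0[of "(u, z)"] that by (simp_all add: space_pair_measure abs_le_iff)
  have "(\<lambda>u. \<integral>z. exp (k u z) \<partial>M2) \<in> borel_measurable M1"
    by (intro bounded_measurableD(1) bm_integral1[of "\<lambda>u z. exp (k u z)"] bm_intros k)
  then show ?thesis
    using M2.exp_integral_bounds(1,2)[OF bm_Pair1[of _ _ k, OF k], where A="-B" and B=B] B
    by (intro bounded_measurableI[of _ _ B]) (auto simp: abs_le_iff minus_le_iff)
qed

lemma (in pair_prob_space) bm_ln_integral_exp2:
  fixes k :: "'a \<Rightarrow> 'b \<Rightarrow> real"
  assumes k: "bounded_measurable (M1 \<Otimes>\<^sub>M M2) (\<lambda>w. k (fst w) (snd w))"
  shows "bounded_measurable M2 (\<lambda>z. ln (\<integral>u. exp (k u z) \<partial>M1))"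
proof -
  obtain B where B0: "\<And>w. w \<in> space (M1 \<Otimes>\<^sub>M M2) \<Longrightarrow> norm (k (fst w) (snd w)) \<le> B"
    using bounded_measurableD(2)[OF k] by blast
  have B: "- B \<le> k u z" "k u z \<le> B" if "u \<in> space M1" "z \<in> space M2" for u z
    using B0[of "(u, z)"] that by (simp_all add: space_pair_measure abs_le_iff)
  have "(\<lambda>z. \<integral>u. exp (k u z) \<partial>M1) \<in> borel_measurable M2"
    by (intro bounded_measurableD(1) bm_integral2[of "\<lambda>u z. exp (k u z)"] bm_intros k)
  then show ?thesis
    using M1.exp_integral_bounds(1,2)[OF bm_Pair2[of _ _ k, OF k], where A="-B" and B=B] B
    by (intro bounded_measurableI[of _ _ B]) (auto simp: abs_le_iff minus_le_iff)
qed

context quantile_dual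
begin

text \<open>Up to the factor \<epsilon>, the gradient in \<open>v\<close> of the partition integral
  vanishes. The predicate takes a vector rather than a function, so that solutions at different
  \<open>u\<close> can be compared before any regularity in \<open>u\<close> is known.\<close>

definition stationary where
  "stationary h u v \<longleftrightarrow> (\<integral>z. exp ((v \<bullet> X z + h z - c u z) / \<epsilon>) *\<^sub>R X z \<partial>N) = 0"

definition fup where
  "fup g h u = - \<epsilon> * ln (\<integral>z. exp ((g u \<bullet> X z + h z - c u z) / \<epsilon>) \<partial>N)"

definition hup where
  "hup f g z = - \<epsilon> * ln (\<integral>u. exp ((f u + g u \<bullet> X z - c u z) / \<epsilon>) \<partial>M)"

lemma bm_c_slice: "u \<in> space M \<Longrightarrow> bounded_measurable N (\<lambda>z. c u z)"
  using bm_Pair1[of _ _ c, OF bm_c] .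

lemma bm_slice:
  "bounded_measurable N h \<Longrightarrow> u \<in> space M \<Longrightarrow> bounded_measurable N (\<lambda>z. (v \<bullet> X z + h z - c u z) / \<epsilon>)"
  by (intro bm_intros bm_X bm_c_slice)

lemma bm_fup:
  assumes "bounded_measurable M g" "bounded_measurable N h"
  shows "bounded_measurable M (fup g h)"
  unfolding fup_def
  by (intro bm_mult bm_const bm_ln_integral_exp1[of "\<lambda>u z. (g u \<bullet> X z + h z - c u z) / \<epsilon>"] bm_intros
      bm_fst[OF assms(1)] bm_snd[OF assms(2)] bm_snd[OF bm_X] bm_c)

lemma bm_hup:
  assumes "bounded_measurable M f" "bounded_measurable M g"
  shows "bounded_measurable N (hup f g)"
  unfolding hup_def
  by (intro bm_mult bm_const bm_ln_integral_exp2[of "\<lambda>u z. (f u + g u \<bullet> X z - c u z) / \<epsilon>"] bm_intros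
      bm_fst[OF assms(1)] bm_fst[OF assms(2)] bm_snd[OF bm_X] bm_c)

lemma integral_gibbs_fup:
  assumes h: "bounded_measurable N h" and u: "u \<in> space M"
  shows "(\<integral>z. gibbs (fup g h) g h u z \<partial>N) = 1"
proof -
  let ?W = "\<integral>z. exp ((g u \<bullet> X z + h z - c u z) / \<epsilon>) \<partial>N"
  have W: "0 < ?W" by (intro M2.exp_integral_pos bm_slice h u)
  have "gibbs (fup g h) g h u z = (1 / ?W) * exp ((g u \<bullet> X z + h z - c u z) / \<epsilon>)" for z
  proof -
    have "xi (fup g h) g h u z / \<epsilon> = - ln ?W + (g u \<bullet> X z + h z - c u z) / \<epsilon>"
      using eps_pos by (simp add: xi_def fup_def field_simps)
    then show ?thesis unfolding gibbs_def
      by (simp only: exp_add exp_minus exp_ln[OF W] inverse_eq_divide)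
  qed
  then show ?thesis using W by simp
qed

lemma integral_gibbs_fup_X:
  assumes "stationary h u (g u)"
  shows "(\<integral>z. gibbs f g h u z *\<^sub>R X z \<partial>N) = 0"
proof -
  have "gibbs f g h u z *\<^sub>R X z
      = exp (f u / \<epsilon>) *\<^sub>R (exp ((g u \<bullet> X z + h z - c u z) / \<epsilon>) *\<^sub>R X z)" for z
    by (simp add: gibbs_def xi_def add_divide_distrib diff_divide_distrib flip: exp_add)
  then show ?thesis using assms by (simp only: stationary_def integral_scaleR_right scaleR_zero_right)
qed

lemma integral_gibbs_hup:
  assumes f: "bounded_measurable M f" and g: "bounded_measurable M g" and z: "z \<in> space N"
  shows "(\<integral>u. gibbs f g (hup f g) u z \<partial>M) = 1"
proof -
  let ?W = "\<integral>u. exp ((f u + g u \<bullet> X z - c u z) / \<epsilon>) \<partial>M"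
  have W: "0 < ?W" using bm_Pair2[of _ _ c, OF bm_c z] f g
    by (intro M1.exp_integral_pos bm_intros)
  have "gibbs f g (hup f g) u z = (1 / ?W) * exp ((f u + g u \<bullet> X z - c u z) / \<epsilon>)" for u
  proof -
    have "xi f g (hup f g) u z / \<epsilon> = - ln ?W + (f u + g u \<bullet> X z - c u z) / \<epsilon>"
      using eps_pos by (simp add: xi_def hup_def field_simps)
    then show ?thesis unfolding gibbs_def
      by (simp only: exp_add exp_minus exp_ln[OF W] inverse_eq_divide)
  qed
  then show ?thesis using W by simp
qed

text \<open>The partition integral is convex in the vector, so a critical point is a global
  minimiser.\<close>

lemma stationary_minimal:
  assumes h: "bounded_measurable N h" and u: "u \<in> space M" and s: "stationary h u v"
  shows "(\<integral>z. exp ((v \<bullet> X z + h z - c u z) / \<epsilon>) \<partial>N) \<le> (\<integral>z. exp ((v' \<bullet> X z + h z - c u z) / \<epsilon>) \<partial>N)"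
proof -
  let ?e = "\<lambda>v z. exp ((v \<bullet> X z + h z - c u z) / \<epsilon>)"
  note bm = bm_slice[OF h u]
  have "?e v z + ((v' - v) /\<^sub>R \<epsilon>) \<bullet> (?e v z *\<^sub>R X z) \<le> ?e v' z" for z
  proof -
    have *: "exp a + (b - a) * exp a \<le> exp b" for a b :: real
      using exp_ge_tangent_quadratic[of "min a b" a b]
      by (smt (verit) mult.commute mult_nonneg_nonneg exp_ge_zero zero_le_power2 divide_nonneg_pos)
    show ?thesis
      using *[of "(v \<bullet> X z + h z - c u z) / \<epsilon>" "(v' \<bullet> X z + h z - c u z) / \<epsilon>"]
      by (simp add: inner_diff_left divide_inverse algebra_simps)
  qed
  then have "(\<integral>z. ?e v z + ((v' - v) /\<^sub>R \<epsilon>) \<bullet> (?e v z *\<^sub>R X z) \<partial>N) \<le> (\<integral>z. ?e v' z \<partial>N)"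
    by (intro M2.bm_integral_mono bm_intros bm bm_X)
  moreover have "(\<integral>z. ?e v z + ((v' - v) /\<^sub>R \<epsilon>) \<bullet> (?e v z *\<^sub>R X z) \<partial>N)
      = (\<integral>z. ?e v z \<partial>N) + ((v' - v) /\<^sub>R \<epsilon>) \<bullet> (\<integral>z. ?e v z *\<^sub>R X z \<partial>N)"
    by (subst Bochner_Integration.integral_add, (intro M2.bm_integrable bm_intros bm bm_X)+,
        subst integral_inner_right) (intro refl M2.bm_integrable bm_intros bm bm_X)+
  ultimately show ?thesis using s by (simp add: stationary_def)
qed

text \<open>By minimality, \<open>g u\<close> at the point \<open>u\<close> may be replaced by
  \<open>g u'\<close> at the cost of an inequality. The two integrals then differ only in the cost
  function, so the bound does not involve the size of \<open>g\<close>.\<close>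

lemma fup_osc:
  assumes h: "bounded_measurable N h" and s: "\<And>u. u \<in> space M \<Longrightarrow> stationary h u (g u)"
    and u: "u \<in> space M" and u': "u' \<in> space M"
  shows "\<bar>fup g h u - fup g h u'\<bar> \<le> L"
proof -
  have *: "fup g h u' - L \<le> fup g h u" if u: "u \<in> space M" and u': "u' \<in> space M" for u u'
  proof -
    let ?e = "\<lambda>u v. \<integral>z. exp ((v \<bullet> X z + h z - c u z) / \<epsilon>) \<partial>N"
    have "?e u (g u) \<le> ?e u (g u')" using h u s[OF u] by (rule stationary_minimal)
    also have "\<dots> \<le> (\<integral>z. exp (L / \<epsilon>) * exp ((g u' \<bullet> X z + h z - c u' z) / \<epsilon>) \<partial>N)"
    proof (intro M2.bm_integral_mono bm_intros bm_slice bm_X bm_c_slice h u u')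
      fix z assume "z \<in> space N"
      then have "c u' z - L \<le> c u z" using c_osc[OF u' u, of z] by linarith
      then show "exp ((g u' \<bullet> X z + h z - c u z) / \<epsilon>)
          \<le> exp (L / \<epsilon>) * exp ((g u' \<bullet> X z + h z - c u' z) / \<epsilon>)"
        using eps_pos by (simp flip: exp_add add_divide_distrib) (intro divide_right_mono, auto)
    qed
    also have "\<dots> = exp (L / \<epsilon>) * ?e u' (g u')" by simp
    finally have "ln (?e u (g u)) \<le> ln (exp (L / \<epsilon>) * ?e u' (g u'))"
      using M2.exp_integral_pos[OF bm_slice[OF h u]] by (intro ln_mono) auto
    also have "\<dots> = L / \<epsilon> + ln (?e u' (g u'))"
      using M2.exp_integral_pos[OF bm_slice[OF h u'], of "g u'"] by (simp add: ln_mult_pos)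
    finally have "\<epsilon> * ln (?e u (g u)) \<le> \<epsilon> * (L / \<epsilon> + ln (?e u' (g u')))"
      using eps_pos by simp
    then show ?thesis using eps_pos by (simp add: fup_def algebra_simps)
  qed
  show ?thesis using *[OF u u'] *[OF u' u] by (simp add: abs_le_iff)
qed

text \<open>Jensen in the form 1 + s <= exp s: the Gibbs density has mass 1, so \<open>xi\<close>
  has nonpositive mean over \<open>z\<close>, and the g-term contributes nothing to that
  mean.\<close>

lemma fup_le:
  assumes h: "bounded_measurable N h" and u: "u \<in> space M"
  shows "fup g h u \<le> C - (\<integral>z. h z \<partial>N)"
proof -
  have i: "integrable N h" "integrable N X" "integrable N (\<lambda>z. c u z)"
    by (intro M2.bm_integrable h bm_X bm_c_slice u)+
  have bx: "bounded_measurable N (\<lambda>z. xi (fup g h) g h u z)"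
    unfolding xi_def by (intro bm_intros h bm_X bm_c_slice u)
  have "(\<integral>z. 1 + xi (fup g h) g h u z / \<epsilon> \<partial>N) \<le> (\<integral>z. gibbs (fup g h) g h u z \<partial>N)"
    unfolding gibbs_def by (intro M2.bm_integral_mono bm_intros bx exp_ge_add_one_self)
  also have "\<dots> = 1" by (rule integral_gibbs_fup[OF h u])
  finally have "(\<integral>z. xi (fup g h) g h u z \<partial>N) \<le> 0"
    using M2.bm_integrable[OF bx] eps_pos by (simp add: M2.prob_space field_simps)
  moreover have "(\<integral>z. xi (fup g h) g h u z \<partial>N) = fup g h u + (\<integral>z. h z \<partial>N) - (\<integral>z. c u z \<partial>N)"
    unfolding xi_def using i by (simp add: M2.prob_space X_mean)
  moreover have "(\<integral>z. c u z \<partial>N) \<le> C" using c_le u by (intro M2.bm_integral_le bm_c_slice)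
  ultimately show ?thesis by simp
qed

text \<open>Write <v, X> = xi + c - f - h. Here \<open>xi\<close> is \<epsilon> times the logarithm
  of the Gibbs density, hence at most \<epsilon> * ln (3/2) times that density, whose mass is 1. So
  the positive part of <v, X> is controlled by the integral of the negative part of
  \<open>h\<close>, not by its supremum. Coercivity and |<v, X>| <= norm v * R turn this L1 bound
  into one on the norm.\<close>

lemma stationary_norm_le:
  assumes h: "bounded_measurable N h" and u: "u \<in> space M" and s: "stationary h u (g u)"
    and f: "- F \<le> fup g h u" and H: "(\<integral>z. max (- h z) 0 \<partial>N) \<le> H" and F: "0 \<le> F"
  shows "norm (g u) \<le> 2 * R / lam * (\<epsilon> * ln (3/2) + C + F + H)"
proof (cases "g u = 0")
  case True
  have "0 \<le> (\<integral>z. max (- h z) 0 \<partial>N)" by simp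
  moreover have "0 \<le> \<epsilon> * ln (3/2)" using eps_pos by simp
  ultimately have "0 \<le> \<epsilon> * ln (3/2) + C + F + H" using H F C_nonneg by linarith
  then show ?thesis using True R_ge lam_pos by simp
next
  case False
  define v where "v = g u"
  let ?p = "\<lambda>z. gibbs (fup g h) g h u z"
  have bp: "bounded_measurable N ?p"
    unfolding gibbs_def xi_def by (intro bm_intros h bm_X bm_c_slice u)
  have pt: "\<bar>v \<bullet> X z\<bar> \<le> 2 * (\<epsilon> * ln (3/2) * ?p z + C + F + max (- h z) 0) - v \<bullet> X z"
    if z: "z \<in> space N" for z
  proof -
    have "v \<bullet> X z = \<epsilon> * (xi (fup g h) g h u z / \<epsilon>) + c u z - fup g h u - h z"
      using eps_pos by (simp add: xi_def v_def)
    also have "\<dots> \<le> \<epsilon> * (ln (3/2) * ?p z) + C + F + max (- h z) 0"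
    proof -
      have "\<epsilon> * (xi (fup g h) g h u z / \<epsilon>) \<le> \<epsilon> * (ln (3/2) * ?p z)"
        unfolding gibbs_def using eps_pos by (intro mult_left_mono le_ln_three_halves_mult_exp) auto
      then show ?thesis using c_le[OF u z] f max.cobounded1[of "- h z" 0] by linarith
    qed
    finally have "v \<bullet> X z \<le> \<epsilon> * (ln (3/2) * ?p z) + C + F + max (- h z) 0" .
    moreover have "0 \<le> \<epsilon> * (ln (3/2) * ?p z) + C + F + max (- h z) 0"
      using C_nonneg F eps_pos gibbs_pos[of "fup g h" g h u z] by simp
    ultimately show ?thesis by (simp add: abs_le_iff algebra_simps)
  qed
  have "lam * (norm v)\<^sup>2 \<le> (\<integral>z. (v \<bullet> X z)\<^sup>2 \<partial>N)" by (rule X_coercive)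
  also have "\<dots> \<le> (\<integral>z. (norm v * R) * \<bar>v \<bullet> X z\<bar> \<partial>N)"
  proof (intro M2.bm_integral_mono bm_intros bm_X)
    fix z assume "z \<in> space N"
    then have "\<bar>v \<bullet> X z\<bar> * \<bar>v \<bullet> X z\<bar> \<le> (norm v * R) * \<bar>v \<bullet> X z\<bar>"
      by (intro mult_right_mono inner_X_abs_le) auto
    then show "(v \<bullet> X z)\<^sup>2 \<le> (norm v * R) * \<bar>v \<bullet> X z\<bar>" by (simp add: power2_eq_square)
  qed
  also have "\<dots> = (norm v * R) * (\<integral>z. \<bar>v \<bullet> X z\<bar> \<partial>N)" by simp
  also have "\<dots> \<le> (norm v * R) * (2 * (\<epsilon> * ln (3/2) + C + F + H))"
  proof (intro mult_left_mono)
    have "(\<integral>z. \<bar>v \<bullet> X z\<bar> \<partial>N)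
      \<le> (\<integral>z. 2 * (\<epsilon> * ln (3/2) * ?p z + C + F + max (- h z) 0) - v \<bullet> X z \<partial>N)"
      by (intro M2.bm_integral_mono bm_intros bm_X bp h pt)
    also have "\<dots> = 2 * (\<epsilon> * ln (3/2) * (\<integral>z. ?p z \<partial>N) + C + F + (\<integral>z. max (- h z) 0 \<partial>N)) - (\<integral>z. v \<bullet> X z \<partial>N)"
    proof -
      have i: "integrable N ?p" "integrable N (\<lambda>z. max (- h z) 0)" "integrable N (\<lambda>z. v \<bullet> X z)"
        by (intro M2.bm_integrable bm_intros bm_X bp h)+
      show ?thesis using i by (simp add: M2.prob_space)
    qed
    also have "\<dots> \<le> 2 * (\<epsilon> * ln (3/2) + C + F + H)"
      using H by (simp add: integral_gibbs_fup[OF h u] integral_inner_X)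
    finally show "(\<integral>z. \<bar>v \<bullet> X z\<bar> \<partial>N) \<le> 2 * (\<epsilon> * ln (3/2) + C + F + H)" .
  qed (use R_ge in auto)
  finally have "norm v * (lam * norm v) \<le> norm v * (R * (2 * (\<epsilon> * ln (3/2) + C + F + H)))"
    by (simp add: power2_eq_square algebra_simps)
  moreover have "0 < norm v" using False by (simp add: v_def)
  ultimately have "lam * norm v \<le> R * (2 * (\<epsilon> * ln (3/2) + C + F + H))"
    by (simp only: mult_le_cancel_left_pos)
  then show ?thesis using lam_pos by (simp add: v_def field_simps)
qed

text \<open>A crude bound for a single solution, viewed as the constant function with value
  \<open>v\<close>. Minimality against the zero vector gives the lower bound -H for
  \<open>fup\<close>.\<close>

lemma stationary_bounded:
  assumes h: "bounded_measurable N h" and H: "\<And>z. z \<in> space N \<Longrightarrow> \<bar>h z\<bar> \<le> H"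
    and u: "u \<in> space M" and s: "stationary h u v"
  shows "norm v \<le> 2 * R / lam * (\<epsilon> * ln (3/2) + C + H + H)"
proof -
  have H0: "0 \<le> H" using M2.not_empty H by force
  have "ln (\<integral>z. exp ((v \<bullet> X z + h z - c u z) / \<epsilon>) \<partial>N) \<le> ln (\<integral>z. exp ((0 \<bullet> X z + h z - c u z) / \<epsilon>) \<partial>N)"
    using stationary_minimal[OF h u s, of 0] M2.exp_integral_pos[OF bm_slice[OF h u]] by (intro ln_mono) auto
  also have "\<dots> \<le> H / \<epsilon>"
  proof (rule M2.exp_integral_bounds(2)[OF bm_slice[OF h u]])
    fix z assume z: "z \<in> space N"
    have "h z \<le> H" "- H \<le> h z" using H[OF z] by (auto simp: abs_le_iff)
    then show "(0 \<bullet> X z + h z - c u z) / \<epsilon> \<le> H / \<epsilon>" "- (H + C) / \<epsilon> \<le> (0 \<bullet> X z + h z - c u z) / \<epsilon>"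
      using c_nonneg[OF u z] c_le[OF u z] eps_pos by (auto intro!: divide_right_mono)
  qed
  finally have "- H \<le> fup (\<lambda>_. v) h u" using eps_pos by (simp add: fup_def field_simps)
  moreover have "(\<integral>z. max (- h z) 0 \<partial>N) \<le> H"
    using H H0 by (intro M2.bm_integral_le bm_intros h) (auto simp: abs_le_iff minus_le_iff)
  ultimately show ?thesis using stationary_norm_le[of h u "\<lambda>_. v" H H] h u s H0 by simp
qed

text \<open>The left-hand side of the stationarity equation is strongly monotone in \<open>v\<close>.\<close>

lemma stationary_lipschitz:
  assumes h: "bounded_measurable N h"
  obtains B where "0 \<le> B"
    "\<And>u u' v v' d. u \<in> space M \<Longrightarrow> u' \<in> space M \<Longrightarrow> stationary h u v \<Longrightarrow> stationary h u' v'
      \<Longrightarrow> (\<And>z. z \<in> space N \<Longrightarrow> \<bar>c u z - c u' z\<bar> \<le> d) \<Longrightarrow> norm (v - v') \<le> B * d"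
proof -
  obtain H where H: "\<And>z. z \<in> space N \<Longrightarrow> \<bar>h z\<bar> \<le> H"
    using bounded_measurableD(2)[OF h] by auto
  \<comment> \<open>\<open>V\<close> bounds every solution and \<open>E\<close> then bounds every
    exponent; on [-E, E] exp is strongly monotone with modulus exp (-E) and Lipschitz with constant
    exp E.\<close>
  define V where "V = 2 * R / lam * (\<epsilon> * ln (3/2) + C + H + H)"
  define E where "E = (V * R + H + C) / \<epsilon>"
  have main: "norm (v - v') \<le> (R * exp E / (exp (- E) * lam)) * d"
    if u: "u \<in> space M" and u': "u' \<in> space M" and s: "stationary h u v" and s': "stationary h u' v'"
      and d: "\<And>z. z \<in> space N \<Longrightarrow> \<bar>c u z - c u' z\<bar> \<le> d" for u u' v v' d
  proof -
    have V: "norm v \<le> V" "norm v' \<le> V"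
      using stationary_bounded[OF h H u s] stationary_bounded[OF h H u' s'] by (simp_all add: V_def)
    have d0: "0 \<le> d" using M2.not_empty d by force
    \<comment> \<open>Inside this proof \<open>D\<close> is the increment of the vector, not the
      objective.\<close>
    define D where "D = v - v'"
    let ?a = "\<lambda>u v z. (v \<bullet> X z + h z - c u z) / \<epsilon>"
    have bnd: "\<bar>?a y w z\<bar> \<le> E" if "y \<in> space M" "norm w \<le> V" "z \<in> space N" for y w z
    proof -
      have "\<bar>w \<bullet> X z\<bar> \<le> norm w * R" by (rule inner_X_abs_le[OF that(3)])
      also have "\<dots> \<le> V * R" using that R_ge by (intro mult_right_mono) auto
      finally have "\<bar>w \<bullet> X z + h z - c y z\<bar> \<le> V * R + H + C"
        using H[OF that(3)] c_nonneg[OF that(1,3)] c_le[OF that(1,3)] by (auto simp: abs_le_iff)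
      then show ?thesis using eps_pos by (simp add: E_def abs_divide divide_right_mono)
    qed
    have lo: "- E \<le> ?a y w z" "?a y w z \<le> E" if "y \<in> space M" "norm w \<le> V" "z \<in> space N" for y w z
      using bnd[OF that] by (auto simp only: abs_le_iff minus_le_iff)
    have bm: "bounded_measurable N (?a y w)" if "y \<in> space M" for y w using bm_slice[OF h that] .
    have z1: "(\<integral>z. (D \<bullet> X z) * exp (?a u v z) \<partial>N) = 0"
    proof -
      have "(\<integral>z. D \<bullet> (exp (?a u v z) *\<^sub>R X z) \<partial>N) = D \<bullet> (\<integral>z. exp (?a u v z) *\<^sub>R X z \<partial>N)"
        by (intro integral_inner_right M2.bm_integrable bm_intros bm u bm_X)
      then show ?thesis using s by (simp add: stationary_def mult.commute)
    qed
    have z2: "(\<integral>z. (D \<bullet> X z) * exp (?a u' v' z) \<partial>N) = 0"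
    proof -
      have "(\<integral>z. D \<bullet> (exp (?a u' v' z) *\<^sub>R X z) \<partial>N) = D \<bullet> (\<integral>z. exp (?a u' v' z) *\<^sub>R X z \<partial>N)"
        by (intro integral_inner_right M2.bm_integrable bm_intros bm u' bm_X)
      then show ?thesis using s' by (simp add: stationary_def mult.commute)
    qed
    have "exp (- E) / \<epsilon> * (lam * (norm D)\<^sup>2) \<le> exp (- E) / \<epsilon> * (\<integral>z. (D \<bullet> X z)\<^sup>2 \<partial>N)"
      using X_coercive eps_pos by (intro mult_left_mono) auto
    also have "\<dots> = (\<integral>z. exp (- E) / \<epsilon> * (D \<bullet> X z)\<^sup>2 \<partial>N)" by simp
    also have "\<dots> \<le> (\<integral>z. (D \<bullet> X z) * exp (?a u v z) - (D \<bullet> X z) * exp (?a u v' z) \<partial>N)"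
    proof (intro M2.bm_integral_mono bm_intros bm_c_slice h u bm_X)
      fix z assume z: "z \<in> space N"
      have e: "?a u v z - ?a u v' z = (D \<bullet> X z) / \<epsilon>"
        by (simp add: D_def inner_diff_left diff_divide_distrib add_divide_distrib)
      have "exp (- E) * ((D \<bullet> X z) / \<epsilon>)\<^sup>2 \<le> (exp (?a u v z) - exp (?a u v' z)) * ((D \<bullet> X z) / \<epsilon>)"
        using exp_strongly_monotone[OF lo(1)[OF u V(2) z] lo(1)[OF u V(1) z]] unfolding e .
      then have "\<epsilon> * (exp (- E) * ((D \<bullet> X z) / \<epsilon>)\<^sup>2)
          \<le> \<epsilon> * ((exp (?a u v z) - exp (?a u v' z)) * ((D \<bullet> X z) / \<epsilon>))"
        using eps_pos by (intro mult_left_mono) auto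
      moreover have "\<epsilon> * (exp (- E) * ((D \<bullet> X z) / \<epsilon>)\<^sup>2) = exp (- E) / \<epsilon> * (D \<bullet> X z)\<^sup>2"
        using eps_pos by (simp add: power2_eq_square field_simps)
      moreover have "\<epsilon> * ((exp (?a u v z) - exp (?a u v' z)) * ((D \<bullet> X z) / \<epsilon>))
          = (D \<bullet> X z) * exp (?a u v z) - (D \<bullet> X z) * exp (?a u v' z)"
        using eps_pos by (simp add: algebra_simps)
      ultimately show "exp (- E) / \<epsilon> * (D \<bullet> X z)\<^sup>2
          \<le> (D \<bullet> X z) * exp (?a u v z) - (D \<bullet> X z) * exp (?a u v' z)" by simp
    qed
    \<comment> \<open>Both stationarity integrals vanish, so the one at (u, v) may be exchanged for
      the one at (u', v'). What remains compares the costs of \<open>u\<close> and \<open>u'\<close>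
      at the same vector \<open>v'\<close>.\<close>
    also have "\<dots> = (\<integral>z. (D \<bullet> X z) * exp (?a u' v' z) - (D \<bullet> X z) * exp (?a u v' z) \<partial>N)"
    proof -
      have i: "integrable N (\<lambda>z. (D \<bullet> X z) * exp (?a y w z))" if "y \<in> space M" for y w
        by (intro M2.bm_integrable bm_intros bm that bm_X)
      show ?thesis
        using z1 z2 Bochner_Integration.integral_diff[OF i[OF u, of v] i[OF u, of v']]
          Bochner_Integration.integral_diff[OF i[OF u', of v'] i[OF u, of v']] by linarith
    qed
    also have "\<dots> \<le> norm D * R * (exp E * (d / \<epsilon>))"
    proof (intro M2.bm_integral_le bm_intros bm_c_slice h u u' bm_X)
      fix z assume z: "z \<in> space N"
      have "\<bar>exp (?a u' v' z) - exp (?a u v' z)\<bar> \<le> exp E * \<bar>?a u' v' z - ?a u v' z\<bar>"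
        by (intro abs_exp_diff_le lo z V u u')
      also have "?a u' v' z - ?a u v' z = (c u z - c u' z) / \<epsilon>"
        by (simp add: diff_divide_distrib add_divide_distrib)
      also have "exp E * \<bar>(c u z - c u' z) / \<epsilon>\<bar> \<le> exp E * (d / \<epsilon>)"
        using d[OF z] eps_pos by (intro mult_left_mono) (auto simp: abs_divide divide_right_mono)
      finally have *: "\<bar>exp (?a u' v' z) - exp (?a u v' z)\<bar> \<le> exp E * (d / \<epsilon>)" .
      have "(D \<bullet> X z) * exp (?a u' v' z) - (D \<bullet> X z) * exp (?a u v' z)
        \<le> \<bar>D \<bullet> X z\<bar> * \<bar>exp (?a u' v' z) - exp (?a u v' z)\<bar>"
        by (metis abs_ge_self abs_mult right_diff_distrib)
      also have "\<dots> \<le> norm D * R * (exp E * (d / \<epsilon>))"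
        using * inner_X_abs_le[OF z, of D] R_ge by (intro mult_mono) auto
      finally show "(D \<bullet> X z) * exp (?a u' v' z) - (D \<bullet> X z) * exp (?a u v' z)
        \<le> norm D * R * (exp E * (d / \<epsilon>))" .
    qed
    finally have "norm D * (exp (- E) * lam * norm D) \<le> norm D * (R * exp E * d)"
      using eps_pos by (simp add: power2_eq_square field_simps)
    then have "exp (- E) * lam * norm D \<le> R * exp E * d \<or> norm D = 0"
      by (metis mult_le_cancel_left_pos norm_ge_zero order_le_less)
    then show ?thesis
    proof
      assume "exp (- E) * lam * norm D \<le> R * exp E * d"
      then show ?thesis unfolding D_def using lam_pos by (simp add: field_simps)
    next
      assume "norm D = 0"
      then show ?thesis using d0 lam_pos R_ge by (simp add: D_def)
    qed
  qed
  show thesis by (rule that[OF _ main]) (use lam_pos R_ge in auto)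
qed

end

section \<open>The h-update: bounds, normalisation, and the gain of each half step\<close>

context quantile_dual
begin

text \<open>Jensen as in \<open>fup_le\<close>, now over \<open>u\<close>: centring removes both the
  f-term and the g-term.\<close>

lemma hup_le:
  assumes f: "bounded_measurable M f" and g: "bounded_measurable M g" and z: "z \<in> space N"
    and f0: "(\<integral>u. f u \<partial>M) = 0" and g0: "(\<integral>u. g u \<partial>M) = 0"
  shows "hup f g z \<le> C"
proof -
  have bc: "bounded_measurable M (\<lambda>u. c u z)" using bm_Pair2[of _ _ c, OF bm_c z] .
  have bx: "bounded_measurable M (\<lambda>u. xi f g (hup f g) u z)"
    unfolding xi_def by (intro bm_intros f g bc)
  have i: "integrable M f" "integrable M g" "integrable M (\<lambda>u. c u z)"
    by (intro M1.bm_integrable f g bc)+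
  have "(\<integral>u. 1 + xi f g (hup f g) u z / \<epsilon> \<partial>M) \<le> (\<integral>u. gibbs f g (hup f g) u z \<partial>M)"
    unfolding gibbs_def by (intro M1.bm_integral_mono bm_intros bx exp_ge_add_one_self)
  also have "\<dots> = 1" by (rule integral_gibbs_hup[OF f g z])
  finally have "(\<integral>u. xi f g (hup f g) u z \<partial>M) \<le> 0"
    using M1.bm_integrable[OF bx] eps_pos by (simp add: M1.prob_space field_simps)
  moreover have "(\<integral>u. xi f g (hup f g) u z \<partial>M) = hup f g z - (\<integral>u. c u z \<partial>M)"
    unfolding xi_def using i f0 g0 by (simp add: M1.prob_space)
  moreover have "(\<integral>u. c u z \<partial>M) \<le> C" using c_le z by (intro M1.bm_integral_le bc)
  ultimately show ?thesis by simp
qed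

lemma hup_abs_le:
  assumes f: "bounded_measurable M f" and g: "bounded_measurable M g" and z: "z \<in> space N"
    and F: "\<And>u. u \<in> space M \<Longrightarrow> \<bar>f u\<bar> \<le> F" and G: "\<And>u. u \<in> space M \<Longrightarrow> norm (g u) \<le> G"
  shows "\<bar>hup f g z\<bar> \<le> C + F + G * R"
proof -
  let ?B = "C + F + G * R"
  have "\<bar>(f u + g u \<bullet> X z - c u z) / \<epsilon>\<bar> \<le> ?B / \<epsilon>" if u: "u \<in> space M" for u
  proof -
    have "\<bar>g u \<bullet> X z\<bar> \<le> norm (g u) * R" by (rule inner_X_abs_le[OF z])
    also have "\<dots> \<le> G * R" using G[OF u] R_ge by (intro mult_right_mono) auto
    finally have "\<bar>f u + g u \<bullet> X z - c u z\<bar> \<le> ?B"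
      using F[OF u] c_nonneg[OF u z] c_le[OF u z] by linarith
    then show ?thesis using eps_pos by (simp add: abs_divide divide_right_mono)
  qed
  then have b: "- (?B / \<epsilon>) \<le> (f u + g u \<bullet> X z - c u z) / \<epsilon>" "(f u + g u \<bullet> X z - c u z) / \<epsilon> \<le> ?B / \<epsilon>"
    if "u \<in> space M" for u using that by (auto simp only: abs_le_iff minus_le_iff)
  have bm: "bounded_measurable M (\<lambda>u. (f u + g u \<bullet> X z - c u z) / \<epsilon>)"
    by (intro bm_intros f g bm_Pair2[of _ _ c, OF bm_c z])
  have "\<bar>ln (\<integral>u. exp ((f u + g u \<bullet> X z - c u z) / \<epsilon>) \<partial>M)\<bar> \<le> ?B / \<epsilon>"
    using M1.exp_integral_bounds(1,2)[OF bm b] by (simp add: abs_le_iff minus_le_iff)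
  then have "\<epsilon> * \<bar>ln (\<integral>u. exp ((f u + g u \<bullet> X z - c u z) / \<epsilon>) \<partial>M)\<bar> \<le> ?B"
    using eps_pos by (simp add: field_simps)
  then show ?thesis using eps_pos by (simp add: hup_def abs_mult)
qed

text \<open>It shows that the normalised h of the algorithm is itself an h-update, namely of the
  centred pair.\<close>

lemma hup_shift:
  assumes "bounded_measurable M f" "bounded_measurable M g" "z \<in> space N"
  shows "hup (\<lambda>u. f u - a) (\<lambda>u. g u - b) z = hup f g z + a + b \<bullet> X z"
proof -
  let ?W = "\<integral>u. exp ((f u + g u \<bullet> X z - c u z) / \<epsilon>) \<partial>M"
  have W: "0 < ?W" using assms by (intro M1.exp_integral_pos bm_intros bm_Pair2[of _ _ c, OF bm_c])
  have "(f u - a + (g u - b) \<bullet> X z - c u z) / \<epsilon> = - (a + b \<bullet> X z) / \<epsilon> + (f u + g u \<bullet> X z - c u z) / \<epsilon>" for u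
    by (simp add: inner_diff_left flip: add_divide_distrib)
  then have "hup (\<lambda>u. f u - a) (\<lambda>u. g u - b) z = - \<epsilon> * ln (exp (- (a + b \<bullet> X z) / \<epsilon>) * ?W)"
    by (simp add: hup_def exp_add)
  also have "\<dots> = hup f g z + a + b \<bullet> X z"
    using W eps_pos by (simp add: ln_mult_pos hup_def distrib_left)
  finally show ?thesis .
qed

lemma D_eq_of_fup:
  assumes "bm_triple (fup g h) g h"
  shows "D (fup g h) g h = (\<integral>u. fup g h u \<partial>M) + (\<integral>z. h z \<partial>N)"
proof -
  have "(\<integral>w. gibbs (fup g h) g h (fst w) (snd w) \<partial>P) = (\<integral>u. (\<integral>z. gibbs (fup g h) g h u z \<partial>N) \<partial>M)"
    by (rule bm_Fubini1[OF gibbs_bm[OF assms]])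
  also have "\<dots> = (\<integral>u. 1 \<partial>M)"
    using assms by (intro Bochner_Integration.integral_cong refl integral_gibbs_fup) (auto simp: bm_triple_def)
  finally show ?thesis by (simp add: D_def M1.prob_space)
qed

lemma integral_gibbs_hup_P:
  assumes "bounded_measurable M f" "bounded_measurable M g"
  shows "(\<integral>w. gibbs f g (hup f g) (fst w) (snd w) \<partial>P) = 1"
proof -
  have t: "bm_triple f g (hup f g)" using assms bm_hup by (auto simp: bm_triple_def)
  have "(\<integral>w. gibbs f g (hup f g) (fst w) (snd w) \<partial>P) = (\<integral>z. (\<integral>u. gibbs f g (hup f g) u z \<partial>M) \<partial>N)"
    by (rule bm_Fubini2[OF gibbs_bm[OF t]])
  also have "\<dots> = (\<integral>z. 1 \<partial>N)"
    using assms by (intro Bochner_Integration.integral_cong refl integral_gibbs_hup)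
  finally show ?thesis by (simp add: M2.prob_space)
qed

lemma D_eq_of_hup:
  assumes "bounded_measurable M f" "bounded_measurable M g"
  shows "D f g (hup f g) = (\<integral>u. f u \<partial>M) + (\<integral>z. hup f g z \<partial>N)"
  using integral_gibbs_hup_P[OF assms] by (simp add: D_def)

text \<open>Since \<open>h\<close> is kept, the exponents differ in an (f, g)-direction, and the
  gradient at the updated pair is orthogonal to those; concavity does the rest.\<close>

lemma D_half_step_ge:
  assumes t: "bm_triple f g h" and gt: "bounded_measurable M gt"
    and s: "\<And>u. u \<in> space M \<Longrightarrow> stationary h u (gt u)"
  shows "D f g h \<le> D (fup gt h) gt h"
proof -
  note bm = t[unfolded bm_triple_def]
  let ?ft = "fup gt h"
  have t': "bm_triple ?ft gt h" using bm gt bm_fup by (auto simp: bm_triple_def)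
  \<comment> \<open>Any common lower bound on the exponents will do, since the quadratic term is
    dropped below.\<close>
  obtain A where A: "\<forall>w\<in>space P. norm (xi f g h (fst w) (snd w)) \<le> A"
    using bounded_measurableD(2)[OF xi_bm[OF t]] by blast
  obtain B where B: "\<forall>w\<in>space P. norm (xi ?ft gt h (fst w) (snd w)) \<le> B"
    using bounded_measurableD(2)[OF xi_bm[OF t']] by blast
  have b: "- max A B \<le> xi ?ft gt h u z" "- max A B \<le> xi f g h u z" if "u \<in> space M" "z \<in> space N" for u z
    using A[rule_format, of "(u, z)"] B[rule_format, of "(u, z)"] that
    by (auto simp: space_pair_measure abs_le_iff minus_le_iff le_max_iff_disj)
  let ?d = "\<lambda>w. xi f g h (fst w) (snd w) - xi ?ft gt h (fst w) (snd w)"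
  have d: "?d w = (f (fst w) - ?ft (fst w)) + (g (fst w) - gt (fst w)) \<bullet> X (snd w)" for w
    by (simp add: xi_def inner_diff_left)
  have "D f g h - D ?ft gt h \<le> (\<integral>w. (1 - gibbs ?ft gt h (fst w) (snd w)) * ?d w
      - exp (- max A B / \<epsilon>) / (2 * \<epsilon>) * (?d w)\<^sup>2 \<partial>P)"
    by (rule D_diff_le[OF t' t b])
  also have "\<dots> \<le> (\<integral>w. (1 - gibbs ?ft gt h (fst w) (snd w)) * ?d w \<partial>P)"
    using eps_pos by (intro bm_integral_mono bm_intros gibbs_bm xi_bm t t') auto
  also have "\<dots> = 0"
    unfolding d
  proof (rule integral_fg_stationary[of "gibbs ?ft gt h" "\<lambda>u. f u - ?ft u" "\<lambda>u. g u - gt u"])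
    show "bounded_measurable P (\<lambda>w. gibbs ?ft gt h (fst w) (snd w))" by (rule gibbs_bm[OF t'])
    show "bounded_measurable M (\<lambda>u. f u - ?ft u)" "bounded_measurable M (\<lambda>u. g u - gt u)"
      using bm gt bm_fup by (auto intro!: bm_diff)
  qed (use bm s in \<open>auto intro: integral_gibbs_fup integral_gibbs_fup_X\<close>)
  finally show ?thesis by simp
qed

text \<open>The old density is the new one times \<open>r\<close>, and the new one has mass 1 in
  \<open>u\<close>. So the exponential term changes by the integral of r - 1, and the linear term by
  that of -\<epsilon> * ln r.\<close>

lemma D_hup_gain:
  assumes f: "bounded_measurable M f" and g: "bounded_measurable M g" and h: "bounded_measurable N h"
  defines "r \<equiv> \<lambda>z. exp ((h z - hup f g z) / \<epsilon>)"
  shows "D f g (hup f g) - D f g h = \<epsilon> * (\<integral>z. r z - 1 - ln (r z) \<partial>N)"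
proof -
  have bh: "bounded_measurable N (hup f g)" using f g by (rule bm_hup)
  have br: "bounded_measurable N r" unfolding r_def by (intro bm_intros h bh)
  have t: "bm_triple f g (hup f g)" using f g bh by (simp add: bm_triple_def)
  have p: "gibbs f g h u z = gibbs f g (hup f g) u z * r z" for u z
  proof -
    have "xi f g h u z / \<epsilon> = xi f g (hup f g) u z / \<epsilon> + (h z - hup f g z) / \<epsilon>"
      by (simp add: xi_def flip: add_divide_distrib)
    then show ?thesis by (simp add: gibbs_def r_def exp_add)
  qed
  have "(\<integral>w. gibbs f g h (fst w) (snd w) \<partial>P) = (\<integral>z. (\<integral>u. gibbs f g (hup f g) u z * r z \<partial>M) \<partial>N)"
    unfolding p by (rule bm_Fubini2) (intro bm_intros gibbs_bm t bm_snd[OF br])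
  also have "\<dots> = (\<integral>z. r z \<partial>N)"
    using integral_gibbs_hup[OF f g] by (intro Bochner_Integration.integral_cong) auto
  finally have 1: "(\<integral>w. gibbs f g h (fst w) (snd w) \<partial>P) = (\<integral>z. r z \<partial>N)" .
  have "(\<integral>z. r z - 1 - ln (r z) \<partial>N) = (\<integral>z. r z - 1 - (h z - hup f g z) / \<epsilon> \<partial>N)"
    by (simp add: r_def)
  also have "\<dots> = (\<integral>z. r z \<partial>N) - 1 - ((\<integral>z. h z \<partial>N) - (\<integral>z. hup f g z \<partial>N)) / \<epsilon>"
    using br h bh by (simp add: M2.bm_integrable M2.prob_space)
  finally have 2: "\<epsilon> * (\<integral>z. r z - 1 - ln (r z) \<partial>N)
      = \<epsilon> * (\<integral>z. r z \<partial>N) - \<epsilon> - (\<integral>z. h z \<partial>N) + (\<integral>z. hup f g z \<partial>N)"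
    using eps_pos by (simp add: field_simps)
  show ?thesis unfolding 2 D_def 1 integral_gibbs_hup_P[OF f g] by (simp add: algebra_simps)
qed

end

section \<open>One Sinkhorn iteration\<close>

text \<open>The constants enter as inequalities, each the first entry of the corresponding maximum,
  with \<open>1 / lam\<close> in place of the operator norm of the inverse. \<open>H0\<close> stands
  for the sup norm of the initial h.\<close>

locale quantile_dual_bounds = quantile_dual M N X c \<epsilon> R C L lam
  for M :: "'a measure" and N :: "'z measure" and X :: "'z \<Rightarrow> 'e::euclidean_space"
    and c :: "'a \<Rightarrow> 'z \<Rightarrow> real" and \<epsilon> R C L lam +
  fixes Kf Kg Kh D0 H0 :: real
  assumes Kf_ge: "L + C + max (- D0) 0 + H0 \<le> Kf"
    and Kg_ge: "4 * (R / lam) * (4 * C - 3/2 * D0 + Kf + H0 + \<epsilon> * ln (3/2)) \<le> Kg"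
    and Kh_ge: "C + Kf + Kg * R \<le> Kh"
    and H0_nonneg: "0 \<le> H0"
begin

definition K where "K = Kf + Kg * R + Kh + C"

definition centered where
  "centered f g h \<longleftrightarrow> bm_triple f g h \<and> (\<integral>u. f u \<partial>M) = 0 \<and> (\<integral>u. g u \<partial>M) = 0
    \<and> (\<forall>u\<in>space M. \<bar>f u\<bar> \<le> Kf) \<and> (\<forall>u\<in>space M. norm (g u) \<le> Kg) \<and> (\<forall>z\<in>space N. \<bar>h z\<bar> \<le> Kh)"

text \<open>
  The constraints on the integral of \<open>h\<close> and of its negative part hold with \<open>H0\<close> bounding \<open>h\<close> at
  the start of the iteration, and with \<open>h \<le> C\<close> and \<open>D0 \<le> \<integral>h\<close> afterwards.
\<close>

definition sinkhorn_invariant where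
  "sinkhorn_invariant f g h \<longleftrightarrow> centered f g h \<and> D0 \<le> D f g h
    \<and> (\<integral>z. h z \<partial>N) \<le> C + H0 \<and> - max (- D0) 0 - H0 \<le> (\<integral>z. h z \<partial>N)
    \<and> (\<integral>z. max (- h z) 0 \<partial>N) \<le> 3 * C - 3/2 * D0 + H0"

text \<open>The iterates are prescribed only on the supports, while the step lemmas speak of
  explicit functions.\<close>

lemma invariant_cong:
  assumes "sinkhorn_invariant f g h" and f: "\<And>u. u \<in> space M \<Longrightarrow> f' u = f u" and g: "\<And>u. u \<in> space M \<Longrightarrow> g' u = g u"
    and h: "\<And>z. z \<in> space N \<Longrightarrow> h' z = h z"
  shows "sinkhorn_invariant f' g' h'"
proof -
  have "(\<integral>u. f' u \<partial>M) = (\<integral>u. f u \<partial>M)" "(\<integral>u. g' u \<partial>M) = (\<integral>u. g u \<partial>M)"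
    "(\<integral>z. h' z \<partial>N) = (\<integral>z. h z \<partial>N)" "(\<integral>z. max (- h' z) 0 \<partial>N) = (\<integral>z. max (- h z) 0 \<partial>N)"
    using f g h by (auto intro!: Bochner_Integration.integral_cong)
  moreover have "bm_triple f' g' h' \<longleftrightarrow> bm_triple f g h"
    unfolding bm_triple_def using bounded_measurable_cong[of M f' f] bounded_measurable_cong[of M g' g]
      bounded_measurable_cong[of N h' h] f g h by simp
  moreover have "D f' g' h' = D f g h" using f g h by (rule D_cong)
  ultimately show ?thesis using assms by (simp add: sinkhorn_invariant_def centered_def)
qed

lemma xi_abs_le:
  assumes u: "u \<in> space M" and z: "z \<in> space N"
    and "\<bar>f u\<bar> \<le> Kf" "norm (g u) \<le> Kg" "\<bar>h z\<bar> \<le> Kh"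
  shows "\<bar>xi f g h u z\<bar> \<le> K"
proof -
  have "\<bar>g u \<bullet> X z\<bar> \<le> norm (g u) * R" by (rule inner_X_abs_le[OF z])
  also have "\<dots> \<le> Kg * R" using assms R_ge by (intro mult_right_mono) auto
  finally show ?thesis unfolding xi_def K_def using assms c_nonneg[OF u z] c_le[OF u z] by linarith
qed

lemma gibbs_le:
  assumes "u \<in> space M" "z \<in> space N" "\<bar>f u\<bar> \<le> Kf" "norm (g u) \<le> Kg" "\<bar>h z\<bar> \<le> Kh"
  shows "gibbs f g h u z \<le> exp (K / \<epsilon>)"
  using xi_abs_le[of u z f g h, OF assms] eps_pos by (simp add: gibbs_def divide_right_mono abs_le_iff)

lemma K_nonneg:
  assumes "centered f g h"
  shows "0 \<le> K"
proof -
  obtain u z where "u \<in> space M" "z \<in> space N" using M1.not_empty M2.not_empty by blast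
  then have "\<bar>xi f g h u z\<bar> \<le> K" using assms by (intro xi_abs_le) (auto simp: centered_def)
  then show ?thesis by linarith
qed

text \<open>One iteration from a triple satisfying the invariant. Measurability of \<open>gt\<close>
  is assumed here and supplied later by \<open>bm_of_stationary\<close>.\<close>

context
  fixes f g h gt
  assumes sinkhorn_invariant: "sinkhorn_invariant f g h" and gt: "bounded_measurable M gt"
    and s: "\<And>u. u \<in> space M \<Longrightarrow> stationary h u (gt u)"
begin

lemma step_bms:
  "bm_triple f g h" "bounded_measurable N h" "bounded_measurable M (fup gt h)" "bm_triple (fup gt h) gt h"
  using sinkhorn_invariant gt bm_fup by (auto simp: sinkhorn_invariant_def centered_def bm_triple_def)

lemma step_fup_osc:
  assumes "u \<in> space M"
  shows "\<bar>fup gt h u - (\<integral>u. fup gt h u \<partial>M)\<bar> \<le> L"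
proof -
  have *: "\<bar>fup gt h u - fup gt h v\<bar> \<le> L" if "v \<in> space M" for v
    using fup_osc[where g=gt, OF step_bms(2) s assms that] .
  have "(\<integral>u. fup gt h u \<partial>M) \<le> fup gt h u + L"
    using * by (intro M1.bm_integral_le step_bms) (auto simp: abs_le_iff algebra_simps)
  moreover have "fup gt h u - L \<le> (\<integral>u. fup gt h u \<partial>M)"
    using * by (intro M1.bm_integral_ge step_bms) (auto simp: abs_le_iff algebra_simps)
  ultimately show ?thesis by (simp add: abs_le_iff)
qed

lemma step_D0: "D0 \<le> D (fup gt h) gt h"
  using D_half_step_ge[OF step_bms(1) gt s] sinkhorn_invariant by (simp add: sinkhorn_invariant_def)

text \<open>The mean of \<open>fup\<close> lies between D0 and C, each diminished by the integral of
  \<open>h\<close>: the lower bound is ascent of the objective, the upper one Jensen. The invariant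
  bounds that integral on both sides, and the oscillation adds \<open>L\<close>.\<close>

lemma step_fup_abs_le:
  assumes u: "u \<in> space M"
  shows "\<bar>fup gt h u\<bar> \<le> Kf"
proof -
  have "(\<integral>u. fup gt h u \<partial>M) \<le> C - (\<integral>z. h z \<partial>N)"
    by (intro M1.bm_integral_le step_bms fup_le)
  moreover have "D0 \<le> (\<integral>u. fup gt h u \<partial>M) + (\<integral>z. h z \<partial>N)"
    using step_D0 by (simp add: D_eq_of_fup[OF step_bms(4)])
  ultimately show ?thesis
    using step_fup_osc[OF u] Kf_ge sinkhorn_invariant by (auto simp: sinkhorn_invariant_def max_def split: if_splits)
qed

text \<open>Half of \<open>Kg\<close>, because subtracting the mean may double the norm; this
  explains the 4 in \<open>K_g\<close> against the 2 in \<open>stationary_norm_le\<close>.\<close>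

lemma step_gt_le:
  assumes u: "u \<in> space M"
  shows "norm (gt u) \<le> Kg / 2"
proof -
  have "norm (gt u) \<le> 2 * R / lam * (\<epsilon> * ln (3/2) + C + Kf + (3 * C - 3/2 * D0 + H0))"
    using step_fup_abs_le[OF u] sinkhorn_invariant
    by (intro stationary_norm_le[of h u gt, OF step_bms(2) u s[OF u]]) (auto simp: sinkhorn_invariant_def)
  also have "\<dots> = 4 * (R / lam) * (4 * C - 3/2 * D0 + Kf + H0 + \<epsilon> * ln (3/2)) / 2"
    by (simp add: algebra_simps)
  finally show ?thesis using Kg_ge by simp
qed

text \<open>\<open>ft\<close> and \<open>ht\<close> are the raw updates, the primed functions the
  next iterate. \<open>h'\<close> is written as an h-update instead of a shift of \<open>ht\<close>,
  so that the h-constraint and \<open>hup_le\<close> apply to it directly.\<close>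

abbreviation "ft \<equiv> fup gt h"
abbreviation "ht \<equiv> hup ft gt"
abbreviation "f' \<equiv> \<lambda>u. ft u - (\<integral>u. ft u \<partial>M)"
abbreviation "g' \<equiv> \<lambda>u. gt u - (\<integral>u. gt u \<partial>M)"
abbreviation "h' \<equiv> hup f' g'"

lemma step_bms':
  "bounded_measurable M f'" "bounded_measurable M g'" "bounded_measurable N h'" "bm_triple f' g' h'"
  "bounded_measurable N ht" "bm_triple ft gt ht"
  using step_bms(3) gt by (auto simp: bm_triple_def intro!: bm_intros bm_hup)

lemma step_integrals: "(\<integral>u. f' u \<partial>M) = 0" "(\<integral>u. g' u \<partial>M) = 0"
  using M1.bm_integrable[OF step_bms(3)] M1.bm_integrable[OF gt] by (simp_all add: M1.prob_space)

text \<open>Centring only moves a constant and a linear function of \<open>X\<close> from f and g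
  into h.\<close>

lemma step_xi: "z \<in> space N \<Longrightarrow> xi f' g' h' u z = xi ft gt ht u z"
  using hup_shift[OF step_bms(3) gt, of z "\<integral>u. ft u \<partial>M" "\<integral>u. gt u \<partial>M"]
  by (simp add: xi_def inner_diff_left)

lemma step_D_shift: "D f' g' h' = D ft gt ht"
  unfolding D_eq[OF step_bms'(4)] D_eq[OF step_bms'(6)]
  by (intro arg_cong2[where f="(+)"] refl Bochner_Integration.integral_cong)
    (auto simp: gibbs_def step_xi space_pair_measure)

lemma step_centered: "centered f' g' h'"
proof -
  have f: "\<bar>f' u\<bar> \<le> Kf" if "u \<in> space M" for u
    using step_fup_osc[OF that] Kf_ge C_nonneg H0_nonneg by linarith
  have b: "norm (\<integral>u. gt u \<partial>M) \<le> Kg / 2"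
    by (intro M1.bm_norm_integral_le gt step_gt_le)
  have g: "norm (g' u) \<le> Kg" if "u \<in> space M" for u
    using norm_triangle_ineq4[of "gt u" "\<integral>u. gt u \<partial>M"] step_gt_le[OF that] b by linarith
  have "\<bar>h' z\<bar> \<le> Kh" if "z \<in> space N" for z
    using hup_abs_le[OF step_bms'(1,2) that f g] Kh_ge by linarith
  with f g show ?thesis by (simp add: centered_def step_bms' step_integrals)
qed

lemma step_gain:
  "D f' g' h' - D ft gt h
    = \<epsilon> * (\<integral>z. exp ((h z - ht z) / \<epsilon>) - 1 - ln (exp ((h z - ht z) / \<epsilon>)) \<partial>N)"
  using D_hup_gain[OF step_bms(3) gt step_bms(2)] by (simp add: step_D_shift)

lemma step_increase: "D f g h \<le> D f' g' h'"
proof -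
  have "0 \<le> (\<integral>z. exp ((h z - ht z) / \<epsilon>) - 1 - ln (exp ((h z - ht z) / \<epsilon>)) \<partial>N)"
    using exp_ge_add_one_self by (intro integral_nonneg_AE AE_I2) (simp add: le_diff_eq add.commute)
  then show ?thesis
    using step_gain D_half_step_ge[OF step_bms(1) gt s] eps_pos by (smt (verit) mult_nonneg_nonneg)
qed

text \<open>With \<open>f'\<close> centred and Gibbs mass 1 the objective equals the integral of
  \<open>h'\<close>, so ascent bounds that integral below by D0. As C - h' is nonnegative and
  dominates the negative part of \<open>h'\<close>, the latter has integral at most C - D0, which
  the invariant allows because D0 <= C.\<close>

lemma step_invariant: "sinkhorn_invariant f' g' h'"
proof -
  have D: "D f' g' h' = (\<integral>z. h' z \<partial>N)"
    using D_eq_of_hup[OF step_bms'(1,2)] step_integrals(1) by simp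
  have D0: "D0 \<le> D f' g' h'" using step_increase sinkhorn_invariant by (simp add: sinkhorn_invariant_def)
  have h'C: "h' z \<le> C" if "z \<in> space N" for z
    by (rule hup_le[OF step_bms'(1,2) that step_integrals])
  have hC: "(\<integral>z. h' z \<partial>N) \<le> C" by (intro M2.bm_integral_le step_bms' h'C)
  have "(\<integral>z. max (- h' z) 0 \<partial>N) \<le> (\<integral>z. C - h' z \<partial>N)"
    using h'C C_nonneg by (intro M2.bm_integral_mono bm_intros step_bms') auto
  also have "\<dots> = C - (\<integral>z. h' z \<partial>N)"
    using M2.bm_integrable[OF step_bms'(3)] by (simp add: M2.prob_space)
  finally have "(\<integral>z. max (- h' z) 0 \<partial>N) \<le> C - (\<integral>z. h' z \<partial>N)" .
  then show ?thesis using D D0 hC step_centered C_nonneg H0_nonneg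
    unfolding sinkhorn_invariant_def by (auto simp: max_def)
qed

text \<open>Strong concavity is applied at the new iterate, towards the comparison triple. The
  densities \<open>?p\<close> and \<open>?q\<close> are those before and after the h-update, and
  \<open>r\<close> is their quotient.\<close>

lemma step_gap:
  assumes opt: "centered fb gb hb"
  shows "D fb gb hb - D f' g' h' \<le> exp (3 * K / \<epsilon>) * (D f' g' h' - D f g h)"
proof -
  have bb: "bounded_measurable M fb" "bounded_measurable M gb" "bounded_measurable N hb"
    using opt by (auto simp: centered_def bm_triple_def)
  let ?p = "gibbs ft gt h" and ?q = "gibbs f' g' h'"
  define r where "r z = exp ((h z - ht z) / \<epsilon>)" for z
  define a where "a u = fb u - f' u" for u
  define b where "b u = gb u - g' u" for u
  define d where "d z = hb z - h' z" for z
  define \<kappa> where "\<kappa> = exp (- K / \<epsilon>) / (2 * \<epsilon>)"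
  have \<kappa>: "0 < \<kappa>" using eps_pos by (simp add: \<kappa>_def)
  have br: "bounded_measurable N r" unfolding r_def by (intro bm_intros step_bms step_bms')
  have ba: "bounded_measurable M a" and bmb: "bounded_measurable M b" and bd: "bounded_measurable N d"
    unfolding a_def b_def d_def by (intro bb step_bms step_bms' bm_diff)+
  let ?A = "\<lambda>w. a (fst w) + b (fst w) \<bullet> X (snd w)"
  let ?d = "\<lambda>w. d (snd w)"
  let ?P = "\<lambda>w. ?p (fst w) (snd w)" and ?Q = "\<lambda>w. ?q (fst w) (snd w)"
  have bA: "bounded_measurable P ?A" by (intro bm_intros bm_fst[OF ba] bm_fst[OF bmb] bm_snd[OF bm_X])
  have bd': "bounded_measurable P ?d" by (rule bm_snd[OF bd])
  have bp: "bounded_measurable P ?P" by (rule gibbs_bm[OF step_bms(4)])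
  have bq: "bounded_measurable P ?Q" by (rule gibbs_bm[OF step_bms'(4)])
  have q1: "(\<integral>u. ?q u z \<partial>M) = 1" if "z \<in> space N" for z
    by (rule integral_gibbs_hup[OF step_bms'(1,2) that])
  have pq: "?p u z = ?q u z * r z" if "z \<in> space N" for u z
  proof -
    have "xi ft gt h u z / \<epsilon> = xi f' g' h' u z / \<epsilon> + (h z - ht z) / \<epsilon>"
      unfolding step_xi[OF that] by (simp add: xi_def flip: add_divide_distrib)
    then show ?thesis by (simp add: gibbs_def r_def exp_add)
  qed
  have c': "\<bar>f' u\<bar> \<le> Kf" "norm (g' u) \<le> Kg" "\<bar>h' z\<bar> \<le> Kh" if "u \<in> space M" "z \<in> space N" for u z
    using step_centered that by (auto simp: centered_def)
  have cb: "\<bar>fb u\<bar> \<le> Kf" "norm (gb u) \<le> Kg" "\<bar>hb z\<bar> \<le> Kh" if "u \<in> space M" "z \<in> space N" for u z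
    using opt that by (auto simp: centered_def)
  have q_le: "?q u z \<le> exp (K / \<epsilon>)" if "u \<in> space M" "z \<in> space N" for u z
    using c'[OF that] by (intro gibbs_le that)
  have p_le: "?p u z \<le> exp (K / \<epsilon>)" if "u \<in> space M" "z \<in> space N" for u z
  proof (intro gibbs_le that)
    show "\<bar>ft u\<bar> \<le> Kf" by (rule step_fup_abs_le[OF that(1)])
    show "norm (gt u) \<le> Kg" using step_gt_le[OF that(1)] norm_ge_zero[of "gt u"] by linarith
    show "\<bar>h z\<bar> \<le> Kh" using sinkhorn_invariant that by (auto simp: sinkhorn_invariant_def centered_def)
  qed
  have xi_ge: "- K \<le> xi f' g' h' u z" "- K \<le> xi fb gb hb u z" if "u \<in> space M" "z \<in> space N" for u z
    using xi_abs_le[of u z f' g' h', OF that c'[OF that]] xi_abs_le[of u z fb gb hb, OF that cb[OF that]]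
    by (simp_all add: abs_le_iff minus_le_iff)
  have dxi: "xi fb gb hb (fst w) (snd w) - xi f' g' h' (fst w) (snd w) = ?A w + ?d w" for w
    by (simp add: xi_def a_def b_def d_def inner_diff_left)
  have "D fb gb hb - D f' g' h' \<le> (\<integral>w. (1 - ?Q w) * (?A w + ?d w) - \<kappa> * (?A w + ?d w)\<^sup>2 \<partial>P)"
    using D_diff_le[of f' g' h' fb gb hb K] step_bms'(4) opt xi_ge
    unfolding dxi \<kappa>_def by (simp add: centered_def)
  also have "\<dots> = (\<integral>w. (1 - ?Q w) * ?A w \<partial>P) + (\<integral>w. (1 - ?Q w) * ?d w \<partial>P)
      - \<kappa> * (\<integral>w. (?A w + ?d w)\<^sup>2 \<partial>P)"
  proof -
    have i: "integrable P (\<lambda>w. (1 - ?Q w) * ?A w)" "integrable P (\<lambda>w. (1 - ?Q w) * ?d w)"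
        "integrable P (\<lambda>w. (?A w + ?d w)\<^sup>2)"
      by (intro bm_integrable bm_mult bm_power2 bm_diff bm_add bm_const bA bd' bq)+
    have "(\<integral>w. (1 - ?Q w) * (?A w + ?d w) - \<kappa> * (?A w + ?d w)\<^sup>2 \<partial>P)
      = (\<integral>w. ((1 - ?Q w) * ?A w + (1 - ?Q w) * ?d w) - \<kappa> * (?A w + ?d w)\<^sup>2 \<partial>P)"
      by (simp only: distrib_left)
    also have "\<dots> = (\<integral>w. (1 - ?Q w) * ?A w + (1 - ?Q w) * ?d w \<partial>P) - (\<integral>w. \<kappa> * (?A w + ?d w)\<^sup>2 \<partial>P)"
      using i by (intro Bochner_Integration.integral_diff Bochner_Integration.integrable_add integrable_mult_right)
    also have "(\<integral>w. (1 - ?Q w) * ?A w + (1 - ?Q w) * ?d w \<partial>P)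
        = (\<integral>w. (1 - ?Q w) * ?A w \<partial>P) + (\<integral>w. (1 - ?Q w) * ?d w \<partial>P)"
      using i by (intro Bochner_Integration.integral_add)
    finally show ?thesis by simp
  qed
  also have "(\<integral>w. (1 - ?Q w) * ?d w \<partial>P) = 0"
    by (rule integral_h_stationary[of ?q, OF bq q1 bd])
  \<comment> \<open>\<open>1 - ?P\<close> is orthogonal to \<open>?A\<close> because
    \<open>?p\<close> satisfies the (f, g)-constraints. Subtracting it leaves a factor that vanishes
    if the h-update changes nothing.\<close>
  also have "(\<integral>w. (1 - ?Q w) * ?A w \<partial>P) = (\<integral>w. (?P w - ?Q w) * ?A w \<partial>P)"
  proof -
    have "(\<integral>w. (1 - ?P w) * ?A w \<partial>P) = 0"
      by (intro integral_fg_stationary[of ?p a b] bp ba bmb integral_gibbs_fup integral_gibbs_fup_X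
          step_bms s)
    moreover have "(\<integral>w. (1 - ?Q w) * ?A w \<partial>P) = (\<integral>w. (1 - ?P w) * ?A w + (?P w - ?Q w) * ?A w \<partial>P)"
      by (simp add: algebra_simps)
    moreover have "\<dots> = (\<integral>w. (1 - ?P w) * ?A w \<partial>P) + (\<integral>w. (?P w - ?Q w) * ?A w \<partial>P)"
      by (intro Bochner_Integration.integral_add bm_integrable bm_mult bm_diff bm_const bA bp bq)
    ultimately show ?thesis by simp
  qed
  \<comment> \<open>\<open>a\<close> and \<open>b\<close> are centred, so the square of the sum
    splits and the part in \<open>d\<close> can be discarded.\<close>
  also have "(\<integral>w. (?P w - ?Q w) * ?A w \<partial>P) + 0 - \<kappa> * (\<integral>w. (?A w + ?d w)\<^sup>2 \<partial>P)
      \<le> (\<integral>w. (?P w - ?Q w) * ?A w \<partial>P) - \<kappa> * (\<integral>w. (?A w)\<^sup>2 \<partial>P)"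
  proof -
    have "(\<integral>u. a u \<partial>M) = 0" "(\<integral>u. b u \<partial>M) = 0"
      unfolding a_def b_def using opt step_integrals step_bms' bb
      by (simp_all add: centered_def M1.bm_integrable)
    then have "(\<integral>w. (?A w)\<^sup>2 \<partial>P) \<le> (\<integral>w. (?A w + ?d w)\<^sup>2 \<partial>P)"
      using integral_square_split[of a b d] ba bmb bd by (simp add: bm_triple_def)
    then show ?thesis using \<kappa> by simp
  qed
  also have "\<dots> = (\<integral>w. (?P w - ?Q w) * ?A w - \<kappa> * (?A w)\<^sup>2 \<partial>P)"
    by (subst Bochner_Integration.integral_diff)
      (auto intro!: bm_integrable bm_mult bm_diff bm_const bm_power2 bA bp bq)
  also have "\<dots> \<le> (\<integral>w. exp (K / \<epsilon>) / (4 * \<kappa>) * (?Q w * (r (snd w) - 1)\<^sup>2) \<partial>P)"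
  proof (intro bm_integral_mono bm_mult bm_diff bm_const bm_power2 bA bp bq bm_snd[OF br])
    fix w assume "w \<in> space P"
    then have w: "fst w \<in> space M" "snd w \<in> space N" by (auto simp: space_pair_measure)
    define x y where "x = ?P w - ?Q w" and "y = ?A w"
    \<comment> \<open>Completing the square lets the concavity term absorb the unknown
      \<open>y\<close>.\<close>
    have "0 \<le> (x - 2 * \<kappa> * y)\<^sup>2" by simp
    then have "x * y - \<kappa> * y\<^sup>2 \<le> x\<^sup>2 / (4 * \<kappa>)"
      using \<kappa> by (simp add: field_simps power2_eq_square)
    also have "x\<^sup>2 = ?Q w * (?Q w * (r (snd w) - 1)\<^sup>2)"
      unfolding x_def pq[OF w(2)] by (simp add: power2_eq_square algebra_simps)
    \<comment> \<open>Only one of the two factors \<open>?Q w\<close> is estimated; the other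
      integrates to 1 over \<open>u\<close>.\<close>
    also have "\<dots> / (4 * \<kappa>) \<le> exp (K / \<epsilon>) * (?Q w * (r (snd w) - 1)\<^sup>2) / (4 * \<kappa>)"
      using q_le[OF w] gibbs_pos[of f' g' h' "fst w" "snd w"] \<kappa>
      by (intro divide_right_mono mult_right_mono) auto
    finally show "(?P w - ?Q w) * ?A w - \<kappa> * (?A w)\<^sup>2
        \<le> exp (K / \<epsilon>) / (4 * \<kappa>) * (?Q w * (r (snd w) - 1)\<^sup>2)"
      by (simp add: x_def y_def)
  qed
  also have "\<dots> = exp (K / \<epsilon>) / (4 * \<kappa>) * (\<integral>z. (r z - 1)\<^sup>2 \<partial>N)"
  proof -
    have "(\<integral>w. ?Q w * (r (snd w) - 1)\<^sup>2 \<partial>P) = (\<integral>z. (\<integral>u. ?q u z * (r z - 1)\<^sup>2 \<partial>M) \<partial>N)"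
      by (rule bm_Fubini2[of "\<lambda>u z. ?q u z * (r z - 1)\<^sup>2"])
        (intro bm_mult bm_diff bm_const bm_power2 bq bm_snd[OF br])
    also have "\<dots> = (\<integral>z. (r z - 1)\<^sup>2 \<partial>N)"
      using q1 by (intro Bochner_Integration.integral_cong) auto
    finally show ?thesis by simp
  qed
  also have "\<dots> \<le> exp (K / \<epsilon>) / (4 * \<kappa>) * (\<integral>z. 2 * exp (K / \<epsilon>) * (r z - 1 - ln (r z)) \<partial>N)"
  proof (intro mult_left_mono M2.bm_integral_mono)
    show "bounded_measurable N (\<lambda>z. (r z - 1)\<^sup>2)" by (intro bm_intros br)
    show "bounded_measurable N (\<lambda>z. 2 * exp (K / \<epsilon>) * (r z - 1 - ln (r z)))"
      by (simp add: r_def) (intro bm_intros step_bms step_bms')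
    fix z assume z: "z \<in> space N"
    \<comment> \<open>\<open>r\<close> is the marginal of \<open>?p\<close> and therefore inherits
      its upper bound.\<close>
    have "(\<integral>u. ?p u z \<partial>M) = r z"
      using q1[OF z] by (simp add: pq[OF z])
    moreover have "(\<integral>u. ?p u z \<partial>M) \<le> exp (K / \<epsilon>)"
      by (intro M1.bm_integral_le bm_Pair2[of _ _ ?p, OF bp z] p_le z)
    ultimately show "(r z - 1)\<^sup>2 \<le> 2 * exp (K / \<epsilon>) * (r z - 1 - ln (r z))"
      using K_nonneg[OF opt] eps_pos by (intro power2_diff_one_le_entropy) (auto simp: r_def)
  qed (use \<kappa> in auto)
  also have "\<dots> = exp (K / \<epsilon>) * exp (K / \<epsilon>) / (2 * \<kappa> * \<epsilon>) * (\<epsilon> * (\<integral>z. r z - 1 - ln (r z) \<partial>N))"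
    using \<kappa> eps_pos by (simp only: integral_mult_right_zero) (simp add: divide_simps)
  also have "\<epsilon> * (\<integral>z. r z - 1 - ln (r z) \<partial>N) = D f' g' h' - D ft gt h"
    unfolding step_gain r_def ..
  also have "exp (K / \<epsilon>) * exp (K / \<epsilon>) / (2 * \<kappa> * \<epsilon>) = exp (3 * K / \<epsilon>)"
    using eps_pos by (simp add: \<kappa>_def exp_minus field_simps flip: exp_add)
  \<comment> \<open>The preceding (f, g)-update can only enlarge the gain.\<close>
  also have "exp (3 * K / \<epsilon>) * (D f' g' h' - D ft gt h) \<le> exp (3 * K / \<epsilon>) * (D f' g' h' - D f g h)"
    using D_half_step_ge[OF step_bms(1) gt s] by (intro mult_left_mono) auto
  finally show ?thesis .
qed

end

text \<open>The fixed-point equations make the gradient at (fb, gb, hb) vanish in every direction,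
  so only the quadratic term of \<open>D_diff_le\<close> is left. The estimate also provides
  nonnegativity of the gap along the iterates.\<close>

lemma gap_ge_L2:
  assumes t: "centered f g h" and opt: "centered fb gb hb"
    and fb: "\<And>u. u \<in> space M \<Longrightarrow> fb u = fup gb hb u" and gb: "\<And>u. u \<in> space M \<Longrightarrow> stationary hb u (gb u)"
    and hb: "\<And>z. z \<in> space N \<Longrightarrow> hb z = hup fb gb z"
  shows "exp (- K / \<epsilon>) / (2 * \<epsilon>) * ((\<integral>u. (f u - fb u)\<^sup>2 \<partial>M) + lam * (\<integral>u. (norm (g u - gb u))\<^sup>2 \<partial>M)
      + (\<integral>z. (h z - hb z)\<^sup>2 \<partial>N)) \<le> D fb gb hb - D f g h"
proof -
  have bb: "bounded_measurable M fb" "bounded_measurable M gb" "bounded_measurable N hb" "bm_triple fb gb hb"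
    using opt by (auto simp: centered_def bm_triple_def)
  have bt: "bounded_measurable M f" "bounded_measurable M g" "bounded_measurable N h" "bm_triple f g h"
    using t by (auto simp: centered_def bm_triple_def)
  define a where "a u = f u - fb u" for u
  define b where "b u = g u - gb u" for u
  define d where "d z = h z - hb z" for z
  define \<kappa> where "\<kappa> = exp (- K / \<epsilon>) / (2 * \<epsilon>)"
  have \<kappa>: "0 < \<kappa>" using eps_pos by (simp add: \<kappa>_def)
  have ba: "bounded_measurable M a" and bmb: "bounded_measurable M b" and bd: "bounded_measurable N d"
    unfolding a_def b_def d_def by (intro bb bt bm_diff)+
  let ?q = "gibbs fb gb hb"
  let ?A = "\<lambda>w. a (fst w) + b (fst w) \<bullet> X (snd w)"
  let ?d = "\<lambda>w. d (snd w)"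
  let ?Q = "\<lambda>w. ?q (fst w) (snd w)"
  have bA: "bounded_measurable P ?A" by (intro bm_intros bm_fst[OF ba] bm_fst[OF bmb] bm_snd[OF bm_X])
  have bd': "bounded_measurable P ?d" by (rule bm_snd[OF bd])
  have bq: "bounded_measurable P ?Q" by (rule gibbs_bm[OF bb(4)])
  have xi_ge: "- K \<le> xi fb gb hb u z" "- K \<le> xi f g h u z" if "u \<in> space M" "z \<in> space N" for u z
    using xi_abs_le[of u z f g h, OF that] xi_abs_le[of u z fb gb hb, OF that] that t opt
    by (simp_all add: abs_le_iff minus_le_iff centered_def)
  have dxi: "xi f g h (fst w) (snd w) - xi fb gb hb (fst w) (snd w) = ?A w + ?d w" for w
    by (simp add: xi_def a_def b_def d_def inner_diff_left)
  have "D f g h - D fb gb hb \<le> (\<integral>w. (1 - ?Q w) * (?A w + ?d w) - \<kappa> * (?A w + ?d w)\<^sup>2 \<partial>P)"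
    using D_diff_le[of fb gb hb f g h K] bb(4) bt(4) xi_ge
    unfolding dxi \<kappa>_def by simp
  also have "\<dots> = (\<integral>w. ((1 - ?Q w) * ?A w + (1 - ?Q w) * ?d w) - \<kappa> * (?A w + ?d w)\<^sup>2 \<partial>P)"
    by (simp only: distrib_left)
  also have "\<dots> = (\<integral>w. (1 - ?Q w) * ?A w \<partial>P) + (\<integral>w. (1 - ?Q w) * ?d w \<partial>P)
      - \<kappa> * (\<integral>w. (?A w + ?d w)\<^sup>2 \<partial>P)"
  proof -
    have i: "integrable P (\<lambda>w. (1 - ?Q w) * ?A w)" "integrable P (\<lambda>w. (1 - ?Q w) * ?d w)"
        "integrable P (\<lambda>w. (?A w + ?d w)\<^sup>2)"
      by (intro bm_integrable bm_mult bm_power2 bm_diff bm_add bm_const bA bd' bq)+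
    have "(\<integral>w. ((1 - ?Q w) * ?A w + (1 - ?Q w) * ?d w) - \<kappa> * (?A w + ?d w)\<^sup>2 \<partial>P)
      = (\<integral>w. (1 - ?Q w) * ?A w + (1 - ?Q w) * ?d w \<partial>P) - (\<integral>w. \<kappa> * (?A w + ?d w)\<^sup>2 \<partial>P)"
      using i by (intro Bochner_Integration.integral_diff Bochner_Integration.integrable_add integrable_mult_right)
    also have "(\<integral>w. (1 - ?Q w) * ?A w + (1 - ?Q w) * ?d w \<partial>P)
        = (\<integral>w. (1 - ?Q w) * ?A w \<partial>P) + (\<integral>w. (1 - ?Q w) * ?d w \<partial>P)"
      using i by (intro Bochner_Integration.integral_add)
    finally show ?thesis by simp
  qed
  also have "(\<integral>w. (1 - ?Q w) * ?d w \<partial>P) = 0"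
  proof (rule integral_h_stationary[of ?q, OF bq _ bd])
    fix z assume z: "z \<in> space N"
    show "(\<integral>u. ?q u z \<partial>M) = 1"
      using integral_gibbs_hup[OF bb(1,2) z] hb[OF z] by (simp add: gibbs_def xi_def)
  qed
  also have "(\<integral>w. (1 - ?Q w) * ?A w \<partial>P) = 0"
  proof (intro integral_fg_stationary[of ?q a b] bq ba bmb)
    fix u assume u: "u \<in> space M"
    show "(\<integral>z. ?q u z \<partial>N) = 1"
      using integral_gibbs_fup[OF bb(3) u, of gb] fb[OF u] by (simp add: gibbs_def xi_def)
    show "(\<integral>z. ?q u z *\<^sub>R X z \<partial>N) = 0" by (rule integral_gibbs_fup_X[of hb u gb, OF gb[OF u]])
  qed
  finally have "\<kappa> * (\<integral>w. (?A w + ?d w)\<^sup>2 \<partial>P) \<le> D fb gb hb - D f g h" by simp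
  moreover have "(\<integral>u. a u \<partial>M) = 0" "(\<integral>u. b u \<partial>M) = 0"
    unfolding a_def b_def using opt t bb bt
    by (simp_all add: centered_def M1.bm_integrable)
  then have "(\<integral>w. (?A w + ?d w)\<^sup>2 \<partial>P) = (\<integral>w. (?A w)\<^sup>2 \<partial>P) + (\<integral>z. (d z)\<^sup>2 \<partial>N)"
    using integral_square_split[of a b d] ba bmb bd by (simp add: bm_triple_def)
  then have "\<kappa> * ((\<integral>u. (a u)\<^sup>2 \<partial>M) + lam * (\<integral>u. (norm (b u))\<^sup>2 \<partial>M) + (\<integral>z. (d z)\<^sup>2 \<partial>N))
      \<le> \<kappa> * (\<integral>w. (?A w + ?d w)\<^sup>2 \<partial>P)"
    using integral_square_ge[OF ba bmb] \<kappa> by (intro mult_left_mono) auto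
  ultimately show ?thesis by (simp add: \<kappa>_def a_def b_def d_def)
qed

end

section \<open>Measures restricted to their supports\<close>

text \<open>\<open>dual_obj\<close> integrates over a subset of the product, whereas the abstract
  objective uses the product of the restricted measures.\<close>

lemma restrict_space_pair_measure:
  assumes "sigma_finite_measure M" "sigma_finite_measure N" and A: "A \<in> sets M" and B: "B \<in> sets N"
  shows "restrict_space M A \<Otimes>\<^sub>M restrict_space N B = restrict_space (M \<Otimes>\<^sub>M N) (A \<times> B)"
    (is "?P = ?R")
proof (rule pair_measure_eqI)
  interpret N: sigma_finite_measure N by fact
  show "sigma_finite_measure (restrict_space M A)" "sigma_finite_measure (restrict_space N B)"
    using assms by (auto intro: sigma_finite_measure_restrict_space)
  have sp: "A \<subseteq> space M" "B \<subseteq> space N" using A B by (auto dest: sets.sets_into_space)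
  have spP: "space ?P = A \<times> B" "space ?R = A \<times> B"
    using sp by (auto simp: space_pair_measure space_restrict_space)
  have AB: "A \<times> B \<in> sets (M \<Otimes>\<^sub>M N)" using A B by simp
  show "sets ?P = sets ?R"
  proof (intro equalityI subsetI)
    fix Z assume Z: "Z \<in> sets ?P"
    \<comment> \<open>The identity, written as a pair, is measurable in both directions; its
      preimages give the two inclusions of sigma-algebras.\<close>
    have "(\<lambda>w. (fst w, snd w)) \<in> ?R \<rightarrow>\<^sub>M ?P"
      by (intro measurable_Pair measurable_restrict_space2 measurable_restrict_space1
          measurable_fst measurable_snd) (auto simp: spP)
    from measurable_sets[OF this Z] show "Z \<in> sets ?R"
      using sets.sets_into_space[OF Z] by (simp add: spP Int_absorb2 vimage_def)
  next
    fix Z assume "Z \<in> sets ?R"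
    then obtain Y where Y: "Y \<in> sets (M \<Otimes>\<^sub>M N)" "Z = (A \<times> B) \<inter> Y"
      by (auto simp: sets_restrict_space)
    have "(\<lambda>w. (fst w, snd w)) \<in> ?P \<rightarrow>\<^sub>M M \<Otimes>\<^sub>M N"
      using measurable_fst[of "restrict_space M A" "restrict_space N B"]
        measurable_snd[of "restrict_space M A" "restrict_space N B"]
      unfolding measurable_restrict_space2_iff by (intro measurable_Pair) auto
    from measurable_sets[OF this Y(1)] show "Z \<in> sets ?P"
      by (simp add: spP Y(2) Int_commute vimage_def)
  qed
  fix X Y assume X: "X \<in> sets (restrict_space M A)" and Y: "Y \<in> sets (restrict_space N B)"
  then have XY: "X \<in> sets M" "Y \<in> sets N" "X \<subseteq> A" "Y \<subseteq> B"
    using A B by (auto simp: sets_restrict_space_iff)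
  then show "emeasure (restrict_space M A) X * emeasure (restrict_space N B) Y = emeasure ?R (X \<times> Y)"
    using A B AB sp N.emeasure_pair_measure_Times[of X M Y]
    by (simp add: emeasure_restrict_space Int_absorb2 Sigma_mono space_pair_measure Times_Int_Times)
qed

lemma set_lebesgue_integral_restrict_space:
  fixes f :: "'a \<Rightarrow> 'b::{banach, second_countable_topology}"
  assumes "S \<in> sets M"
  shows "(LINT x:S|M. f x) = integral\<^sup>L (restrict_space M S) f"
  using assms by (simp add: set_lebesgue_integral_def integral_restrict_space sets.Int_space_eq2)

lemma bounded_measurable_continuous_on:
  fixes f :: "'a::topological_space \<Rightarrow> 'b::euclidean_space"
  assumes "sets M = sets borel" "compact S" "continuous_on S f"
  shows "bounded_measurable (restrict_space M S) f"
proof -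
  have "f \<in> borel_measurable (restrict_space borel S)"
    using assms(3) by (rule borel_measurable_continuous_on_restrict)
  then have "f \<in> borel_measurable (restrict_space M S)"
    using measurable_cong_sets[OF sets_restrict_space_cong[OF assms(1)] refl] by blast
  moreover obtain B where "\<And>x. x \<in> S \<Longrightarrow> norm (f x) \<le> B"
    using compact_imp_bounded[OF compact_continuous_image[OF assms(3,2)]] by (auto simp: bounded_iff)
  ultimately show ?thesis by (intro bounded_measurableI[of _ _ B]) (auto simp: space_restrict_space)
qed

lemma norm_le_sup_norm:
  assumes "compact S" "continuous_on S f" "x \<in> S"
  shows "norm (f x) \<le> sup_norm S f"
proof -
  have "compact ((\<lambda>x. norm (f x)) ` S)"
    by (intro compact_continuous_image continuous_on_norm assms)
  then show ?thesis unfolding sup_norm_def using assms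
    by (intro cSUP_upper bounded_imp_bdd_above compact_imp_bounded)
qed

section \<open>The concrete problem as an instance of the abstract one\<close>

locale quantile_regression_data =
  fixes \<mu> :: "(real ^ 'm) measure" and \<nu> :: "((real ^ 'n) \<times> (real ^ 'm)) measure" and \<epsilon> :: real
  assumes prob_\<mu>: "prob_space \<mu>" and sets_\<mu>: "sets \<mu> = sets borel"
    and prob_\<nu>: "prob_space \<nu>" and sets_\<nu>: "sets \<nu> = sets borel"
    and compact_U: "compact (measure_support \<mu>)"
    and compact_suppX: "compact (suppX \<nu>)" and compact_suppY: "compact (suppY \<nu>)"
    and mean_0: "(LINT z|\<nu>. fst z) = 0"
    and invertible_moment: "invertible (second_moment_X \<nu>)"
    and eps: "\<epsilon> > 0"
begin

abbreviation "U \<equiv> measure_support \<mu>"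
abbreviation "S \<equiv> suppXY \<nu>"
abbreviation "MU \<equiv> restrict_space \<mu> U"
abbreviation "NU \<equiv> restrict_space \<nu> S"
abbreviation "lam \<equiv> smallest_eigenvalue (second_moment_X \<nu>)"

lemma compact_S: "compact S"
  unfolding suppXY_def by (intro compact_Times compact_suppX compact_suppY)

lemma sets_U: "U \<in> sets \<mu>" and sets_S: "S \<in> sets \<nu>"
  using compact_imp_closed[OF compact_U] compact_imp_closed[OF compact_S] by (simp_all add: sets_\<mu> sets_\<nu>)

lemma space_MU: "space MU = U" and space_NU: "space NU = S"
  using sets_eq_imp_space_eq[OF sets_\<mu>] sets_eq_imp_space_eq[OF sets_\<nu>]
  by (simp_all add: space_restrict_space)

lemma space_NU_D: "z \<in> space NU \<Longrightarrow> fst z \<in> suppX \<nu>" "z \<in> space NU \<Longrightarrow> snd z \<in> suppY \<nu>"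
  unfolding space_NU by (auto simp: suppXY_def)

lemma prob_MU: "prob_space MU" and prob_NU: "prob_space NU"
  using prob_space.emeasure_eq_1_AE[OF prob_\<mu> sets_U AE_in_measure_support[OF sets_\<mu>]]
    prob_space.emeasure_eq_1_AE[OF prob_\<nu> sets_S AE_in_suppXY[OF sets_\<nu>]]
  by (simp_all add: prob_space_restrict_space sets_U sets_S)

sublocale MU: prob_space MU by (rule prob_MU)
sublocale NU: prob_space NU by (rule prob_NU)
sublocale pair_prob_space MU NU ..

lemma bm_id: "bounded_measurable MU (\<lambda>u. u)" and bm_NU_fst: "bounded_measurable NU fst"
  and bm_NU_snd: "bounded_measurable NU snd"
  by (intro bounded_measurable_continuous_on sets_\<mu> sets_\<nu> compact_U compact_S continuous_intros)+

lemma bm_cost: "bounded_measurable (MU \<Otimes>\<^sub>M NU) (\<lambda>w. cost (fst w) (snd (snd w)))"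
  unfolding cost_def
  by (intro bm_intros bm_fst[OF bm_id] bm_snd[OF bm_NU_snd])

lemma U_nonempty: "U \<noteq> {}" and S_nonempty: "S \<noteq> {}"
  using MU.not_empty NU.not_empty by (simp_all add: space_MU space_NU)

lemma suppY_nonempty: "suppY \<nu> \<noteq> {}"
  using S_nonempty by (auto simp: suppXY_def)

lemma integral_NU:
  fixes f :: "_ \<Rightarrow> 'b::euclidean_space"
  assumes "f \<in> borel_measurable borel"
  shows "integral\<^sup>L NU f = integral\<^sup>L \<nu> f"
proof -
  have f: "f \<in> borel_measurable \<nu>" using assms measurable_cong_sets[OF sets_\<nu> refl] by blast
  have "integral\<^sup>L NU f = (\<integral>z. indicator S z *\<^sub>R f z \<partial>\<nu>)"
    using sets_S by (simp add: integral_restrict_space sets.Int_space_eq2)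
  also have "\<dots> = integral\<^sup>L \<nu> f"
  proof (rule integral_cong_AE)
    show "AE z in \<nu>. indicator S z *\<^sub>R f z = f z"
      using AE_in_suppXY[OF sets_\<nu>] by eventually_elim simp
  qed (use f sets_S in auto)
  finally show ?thesis .
qed

lemma second_moment_component: "second_moment_X \<nu> $ i $ j = (\<integral>z. fst z $ i * fst z $ j \<partial>NU)"
proof -
  have "(\<lambda>z::(real ^ 'n) \<times> (real ^ 'm). fst z $ i * fst z $ j) \<in> borel_measurable borel"
    by (intro borel_measurable_continuous_onI continuous_intros)
  then show ?thesis by (simp add: second_moment_X_def integral_NU)
qed

lemma second_moment_quadratic: "v \<bullet> (second_moment_X \<nu> *v v) = (\<integral>z. (v \<bullet> fst z)\<^sup>2 \<partial>NU)"
proof -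
  have b: "bounded_measurable NU (\<lambda>z. fst z $ i)" for i
    by (intro bounded_measurable_continuous_on sets_\<nu> compact_S continuous_intros)
  have "v \<bullet> (second_moment_X \<nu> *v v) = (\<Sum>i\<in>UNIV. \<Sum>j\<in>UNIV. v $ i * (v $ j * (\<integral>z. fst z $ i * fst z $ j \<partial>NU)))"
    by (simp add: inner_vec_def matrix_vector_mult_def second_moment_component sum_distrib_left mult_ac)
  also have "\<dots> = (\<integral>z. (\<Sum>i\<in>UNIV. \<Sum>j\<in>UNIV. v $ i * (v $ j * (fst z $ i * fst z $ j))) \<partial>NU)"
    by (subst Bochner_Integration.integral_sum, intro Bochner_Integration.integrable_sum NU.bm_integrable bm_intros b,
        intro sum.cong refl, subst Bochner_Integration.integral_sum, intro NU.bm_integrable bm_intros b) simp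
  also have "\<dots> = (\<integral>z. (v \<bullet> fst z)\<^sup>2 \<partial>NU)"
    by (simp add: inner_vec_def power2_eq_square sum_product mult_ac)
  finally show ?thesis .
qed

lemma transpose_second_moment: "transpose (second_moment_X \<nu>) = second_moment_X \<nu>"
  by (simp add: transpose_def second_moment_X_def vec_eq_iff mult.commute)

lemma lam_le_quadratic: "lam * (norm v)\<^sup>2 \<le> (\<integral>z. (v \<bullet> fst z)\<^sup>2 \<partial>NU)"
  using smallest_eigenvalue_Rayleigh[OF transpose_second_moment]
  by (metis second_moment_quadratic)

lemma lam_pos: "0 < lam"
  and inverse_lam_le_onorm: "1 / lam \<le> onorm (\<lambda>v. matrix_inv (second_moment_X \<nu>) *v v)"
proof -
  let ?A = "second_moment_X \<nu>"
  obtain v where v: "v \<noteq> 0" "?A *v v = lam *\<^sub>R v"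
    using smallest_eigenvalue_Rayleigh[OF transpose_second_moment] by blast
  have "0 \<le> (\<integral>z. (v \<bullet> fst z)\<^sup>2 \<partial>NU)" by simp
  also have "\<dots> = lam * (norm v)\<^sup>2"
    using v by (simp flip: second_moment_quadratic add: power2_norm_eq_inner)
  finally have "0 \<le> lam" using v by (simp add: zero_le_mult_iff)
  moreover have "lam \<noteq> 0"
  proof
    assume "lam = 0"
    then have "?A *v v = 0" using v by simp
    moreover obtain B where "B ** ?A = mat 1" using invertible_moment by (auto simp: invertible_def)
    ultimately have "v = 0" by (metis matrix_vector_mul_assoc matrix_vector_mul_lid matrix_vector_mult_0_right)
    with v show False by simp
  qed
  ultimately show "0 < lam" by simp
  then show "1 / lam \<le> onorm (\<lambda>v. matrix_inv ?A *v v)"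
    using inverse_eigenvalue_le_onorm[OF invertible_moment v(2,1)] by simp
qed

lemma M_x_ge_1: "1 \<le> M_x \<nu>"
  by (simp add: M_x_def)

lemma norm_le_M_x: "x \<in> suppX \<nu> \<Longrightarrow> norm x \<le> M_x \<nu>"
  using norm_le_sup_norm[OF compact_suppX continuous_on_id, of x]
  by (simp add: M_x_def sup_norm_def)

lemma cost_le_cost_sup:
  assumes "u \<in> U" "y \<in> suppY \<nu>"
  shows "cost u y \<le> cost_sup \<mu> \<nu>"
proof -
  have "compact ((\<lambda>(u, y). cost u y) ` (U \<times> suppY \<nu>))"
    unfolding cost_def case_prod_beta'
    by (intro compact_continuous_image compact_Times compact_U compact_suppY continuous_intros) simp
  then show ?thesis
    unfolding cost_sup_def using assms
    by (intro cSUP_upper2[where x="(u, y)"] bounded_imp_bdd_above compact_imp_bounded) auto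
qed

text \<open>A difference of squares: half the sum of the two norms is at most \<open>L_c\<close>,
  and their difference at most the distance of \<open>u\<close> and \<open>v\<close>.\<close>

lemma cost_diff_le:
  assumes u: "u \<in> U" and v: "v \<in> U" and y: "y \<in> suppY \<nu>"
  shows "\<bar>cost u y - cost v y\<bar> \<le> L_c \<mu> \<nu> * dist u v"
proof -
  have n: "norm u \<le> (SUP u\<in>U. norm u)" "norm v \<le> (SUP u\<in>U. norm u)" "norm y \<le> (SUP y\<in>suppY \<nu>. norm y)"
    using norm_le_sup_norm[OF compact_U continuous_on_id] norm_le_sup_norm[OF compact_suppY continuous_on_id]
      u v y by (auto simp: sup_norm_def)
  have "cost u y - cost v y = (norm (u - y) - norm (v - y)) * ((norm (u - y) + norm (v - y)) / 2)"
    by (simp add: cost_def power2_eq_square algebra_simps)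
  then have "\<bar>cost u y - cost v y\<bar> = \<bar>(norm (u - y) - norm (v - y)) * ((norm (u - y) + norm (v - y)) / 2)\<bar>"
    by (rule arg_cong)
  also have "\<dots> = \<bar>norm (u - y) - norm (v - y)\<bar> * ((norm (u - y) + norm (v - y)) / 2)"
    by (simp add: abs_mult)
  also have "\<dots> \<le> dist u v * L_c \<mu> \<nu>"
  proof (rule mult_mono)
    show "\<bar>norm (u - y) - norm (v - y)\<bar> \<le> dist u v"
      using norm_triangle_ineq3[of "u - y" "v - y"] by (simp add: dist_norm)
    show "(norm (u - y) + norm (v - y)) / 2 \<le> L_c \<mu> \<nu>"
      using n norm_triangle_ineq4[of u y] norm_triangle_ineq4[of v y] unfolding L_c_def by simp
  qed auto
  finally show ?thesis by (simp add: mult.commute)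
qed

lemma L_c_nonneg: "0 \<le> L_c \<mu> \<nu>"
proof -
  obtain u y where "u \<in> U" "y \<in> suppY \<nu>" using U_nonempty suppY_nonempty by blast
  then have "norm u \<le> sup_norm U (\<lambda>u. u)" "norm y \<le> sup_norm (suppY \<nu>) (\<lambda>y. y)"
    using norm_le_sup_norm[OF compact_U continuous_on_id] norm_le_sup_norm[OF compact_suppY continuous_on_id] by auto
  then show ?thesis using norm_ge_zero[of u] norm_ge_zero[of y] unfolding L_c_def sup_norm_def by linarith
qed

sublocale quantile_dual MU NU fst "\<lambda>u z. cost u (snd z)" \<epsilon> "M_x \<nu>" "cost_sup \<mu> \<nu>"
  "L_c \<mu> \<nu> * diameter U" lam
proof unfold_locales
  show "fst \<in> borel_measurable NU" using bounded_measurableD(1)[OF bm_NU_fst] .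
  show "(\<integral>z. fst z \<partial>NU) = 0"
    using mean_0 by (simp add: integral_NU borel_measurable_continuous_onI continuous_on_fst)
  show "(\<lambda>w. cost (fst w) (snd (snd w))) \<in> borel_measurable (MU \<Otimes>\<^sub>M NU)"
    using bounded_measurableD(1)[OF bm_cost] .
  show "\<bar>cost u (snd z) - cost u' (snd z)\<bar> \<le> L_c \<mu> \<nu> * diameter U"
    if "u \<in> space MU" "u' \<in> space MU" "z \<in> space NU" for u u' z
  proof -
    have m: "u \<in> U" "u' \<in> U" "snd z \<in> suppY \<nu>" using that space_NU_D by (auto simp: space_MU)
    have "L_c \<mu> \<nu> * dist u u' \<le> L_c \<mu> \<nu> * diameter U"
      using L_c_nonneg diameter_bounded_bound[OF compact_imp_bounded[OF compact_U] m(1,2)]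
      by (intro mult_left_mono)
    then show ?thesis using cost_diff_le[OF m] by linarith
  qed
qed (auto simp: space_MU space_NU_D norm_le_M_x M_x_ge_1 lam_le_quadratic lam_pos
    cost_le_cost_sup eps, auto simp: cost_def)

text \<open>It holds for arbitrary functions: a set integral over a measurable support and the
  integral for the restricted measure agree as Bochner integrals even without measurability.\<close>

lemma dual_obj_eq: "dual_obj \<mu> \<nu> \<epsilon> f g h = D f g h"
proof -
  have P: "MU \<Otimes>\<^sub>M NU = restrict_space (\<mu> \<Otimes>\<^sub>M \<nu>) (U \<times> S)"
    using prob_\<mu> prob_\<nu> by (intro restrict_space_pair_measure sets_U sets_S)
      (auto intro: prob_space_imp_sigma_finite)
  have "gibbs_kernel \<epsilon> f g h = (\<lambda>w. gibbs f g h (fst w) (snd w))"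
    by (auto simp: gibbs_kernel_def gibbs_def xi_def fun_eq_iff)
  then show ?thesis
    using sets_U sets_S unfolding dual_obj_def D_def P
    by (simp add: set_lebesgue_integral_restrict_space)
qed

lemma g_equation_eq: "g_equation \<nu> \<epsilon> g h u \<longleftrightarrow> stationary h u (g u)"
  using sets_S unfolding g_equation_def stationary_def
  by (simp add: set_lebesgue_integral_restrict_space case_prod_beta')

lemma f_update_eq: "f_update \<nu> \<epsilon> g h = fup g h"
  using sets_S unfolding f_update_def fup_def fun_eq_iff
  by (simp add: set_lebesgue_integral_restrict_space case_prod_beta')

lemma h_update_eq: "h_update \<mu> \<epsilon> f g = hup f g"
  using sets_U unfolding h_update_def hup_def fun_eq_iff
  by (simp add: set_lebesgue_integral_restrict_space case_prod_beta')

text \<open>The algorithm only asks that \<open>gt\<close> solve the equation on the support. The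
  Lipschitz dependence of solutions on the cost makes it continuous there.\<close>

lemma bm_of_stationary:
  assumes h: "bounded_measurable NU h" and s: "\<And>u. u \<in> U \<Longrightarrow> stationary h u (gt u)"
  shows "bounded_measurable MU gt"
proof (intro bounded_measurable_continuous_on sets_\<mu> compact_U)
  obtain B where B: "0 \<le> B" "\<And>u u' v v' d. u \<in> space MU \<Longrightarrow> u' \<in> space MU \<Longrightarrow> stationary h u v
      \<Longrightarrow> stationary h u' v' \<Longrightarrow> (\<And>z. z \<in> space NU \<Longrightarrow> \<bar>cost u (snd z) - cost u' (snd z)\<bar> \<le> d)
      \<Longrightarrow> norm (v - v') \<le> B * d"
    using stationary_lipschitz[OF h] by blast
  have "(B * L_c \<mu> \<nu>)-lipschitz_on U gt"
  proof (rule lipschitz_onI)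
    fix u u' assume u: "u \<in> U" "u' \<in> U"
    have "norm (gt u - gt u') \<le> B * (L_c \<mu> \<nu> * dist u u')"
      using u s by (intro B(2)[of u u'] cost_diff_le space_NU_D) (auto simp: space_MU)
    then show "dist (gt u) (gt u') \<le> B * L_c \<mu> \<nu> * dist u u'" by (simp add: dist_norm mult.assoc)
  qed (use B L_c_nonneg in auto)
  then show "continuous_on U gt" by (rule lipschitz_on_continuous_on)
qed

end

section \<open>The rate of convergence\<close>

text \<open>The hypothesis bounds the new gap, not the old one, by the decrease; hence a factor 1 /
  (1 + \<tau>) per step for any \<tau> up to 1 / E.\<close>

lemma geometric_decay_of_gap:
  fixes G :: "nat \<Rightarrow> real"
  assumes gap: "\<And>t. G (Suc t) \<le> E * (G t - G (Suc t))" and nonneg: "\<And>t. 0 \<le> G t"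
    and E: "0 < E" and \<tau>: "0 \<le> \<tau>" "\<tau> * E \<le> 1"
  shows "G t \<le> (1 + \<tau>) powi (- int t) * G 0"
proof -
  have step: "(1 + \<tau>) * G (Suc t) \<le> G t" for t
  proof -
    have "0 \<le> E * (G t - G (Suc t))" using gap[of t] nonneg[of "Suc t"] by linarith
    then have d: "0 \<le> G t - G (Suc t)" using E by (simp add: zero_le_mult_iff)
    have "\<tau> * G (Suc t) \<le> \<tau> * (E * (G t - G (Suc t)))" using gap \<tau> by (intro mult_left_mono)
    also have "\<dots> = \<tau> * E * (G t - G (Suc t))" by simp
    also have "\<dots> \<le> 1 * (G t - G (Suc t))" using \<tau> d by (intro mult_right_mono)
    finally show ?thesis by (simp add: algebra_simps)
  qed
  have "(1 + \<tau>) ^ t * G t \<le> G 0" for t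
  proof (induction t)
    case (Suc t)
    have "(1 + \<tau>) ^ t * ((1 + \<tau>) * G (Suc t)) \<le> (1 + \<tau>) ^ t * G t"
      using step \<tau> by (intro mult_left_mono) auto
    with Suc show ?case by (simp add: algebra_simps)
  qed simp
  then show ?thesis using \<tau> by (simp add: power_int_minus field_simps)
qed

context quantile_regression_data
begin

text \<open>This is what the last two entries of each maximum in the constants are for: they place
  the dual potentials and the initial triple in the class of the iterates.\<close>

lemma centeredI:
  assumes "quantile_dual_bounds MU NU fst (\<lambda>u z. cost u (snd z)) \<epsilon> (M_x \<nu>) (cost_sup \<mu> \<nu>)
      (L_c \<mu> \<nu> * diameter U) lam Kf Kg Kh D0 H0"
    and t: "admissible_triple \<mu> \<nu> f g h"
    and le: "sup_norm U f \<le> Kf" "sup_norm U g \<le> Kg" "sup_norm S h \<le> Kh"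
  shows "quantile_dual_bounds.centered MU NU Kf Kg Kh f g h"
proof -
  interpret B: quantile_dual_bounds MU NU fst "\<lambda>u z. cost u (snd z)" \<epsilon> "M_x \<nu>" "cost_sup \<mu> \<nu>"
    "L_c \<mu> \<nu> * diameter U" lam Kf Kg Kh D0 H0 by fact
  have c: "continuous_on U f" "continuous_on U g" "continuous_on S h"
    using t by (auto simp: admissible_triple_def C_diamond_def)
  have "\<And>u. u \<in> U \<Longrightarrow> norm (f u) \<le> Kf" "\<And>u. u \<in> U \<Longrightarrow> norm (g u) \<le> Kg" "\<And>z. z \<in> S \<Longrightarrow> norm (h z) \<le> Kh"
    using norm_le_sup_norm[OF compact_U c(1)] norm_le_sup_norm[OF compact_U c(2)]
      norm_le_sup_norm[OF compact_S c(3)] le by (meson order_trans)+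
  moreover have "bm_triple f g h"
    unfolding bm_triple_def using c
    by (intro conjI bounded_measurable_continuous_on sets_\<mu> sets_\<nu> compact_U compact_S)
  moreover have "(\<integral>u. f u \<partial>MU) = 0" "(\<integral>u. g u \<partial>MU) = 0"
    using t sets_U by (auto simp: admissible_triple_def C_diamond_def set_lebesgue_integral_restrict_space)
  ultimately show ?thesis by (simp add: B.centered_def space_MU space_NU)
qed

end

theorem theorem3p1:
  fixes \<mu> :: "(real ^ 'm) measure"
    and \<nu> :: "((real ^ 'n) \<times> (real ^ 'm)) measure"
    and \<epsilon> :: real
    and f :: "nat \<Rightarrow> real ^ 'm \<Rightarrow> real"
    and g :: "nat \<Rightarrow> real ^ 'm \<Rightarrow> real ^ 'n"
    and h :: "nat \<Rightarrow> (real ^ 'n) \<times> (real ^ 'm) \<Rightarrow> real"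
    and fb :: "real ^ 'm \<Rightarrow> real"
    and gb :: "real ^ 'm \<Rightarrow> real ^ 'n"
    and hb :: "(real ^ 'n) \<times> (real ^ 'm) \<Rightarrow> real"
    and \<tau> :: real
  assumes "prob_space \<mu>" and "sets \<mu> = sets borel"
    and "prob_space \<nu>" and "sets \<nu> = sets borel"
    and "compact (measure_support \<mu>)" and "compact (suppX \<nu>)" and "compact (suppY \<nu>)"
    and "(LINT z|\<nu>. fst z) = 0"
    and "invertible (second_moment_X \<nu>)"
    and "\<epsilon> > 0"
    and "admissible_triple \<mu> \<nu> (f 0) (g 0) (h 0)"
    and "\<And>t. sinkhorn_step \<mu> \<nu> \<epsilon> (h t) (f (Suc t)) (g (Suc t)) (h (Suc t))"
    and "dual_potentials \<mu> \<nu> \<epsilon> fb gb hb"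
    and "\<tau> = rate \<mu> \<nu> \<epsilon> (f 0) (g 0) (h 0) fb gb hb"
  shows "\<tau> > 0 \<and>
    (\<forall>t. dual_obj \<mu> \<nu> \<epsilon> fb gb hb - dual_obj \<mu> \<nu> \<epsilon> (f t) (g t) (h t)
          \<le> (1 + \<tau>) powi (- int t)
            * (dual_obj \<mu> \<nu> \<epsilon> fb gb hb - dual_obj \<mu> \<nu> \<epsilon> (f 0) (g 0) (h 0))) \<and>
    (\<lambda>t. L2_dist_sq \<mu> (measure_support \<mu>) (f t) fb + L2_dist_sq \<mu> (measure_support \<mu>) (g t) gb
          + L2_dist_sq \<nu> (suppXY \<nu>) (h t) hb)
      \<in> O(\<lambda>t. (1 + \<tau>) powi (- int t))"
proof -
  interpret Q: quantile_regression_data \<mu> \<nu> \<epsilon> by (rule quantile_regression_data.intro) fact+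
  let ?U = "measure_support \<mu>" and ?S = "suppXY \<nu>" and ?C = "cost_sup \<mu> \<nu>" and ?R = "M_x \<nu>"
  let ?lam = "smallest_eigenvalue (second_moment_X \<nu>)"
  define D0 where "D0 = dual_obj \<mu> \<nu> \<epsilon> (f 0) (g 0) (h 0)"
  define H0 where "H0 = sup_norm ?S (h 0)"
  define Kf where "Kf = K_f \<mu> \<nu> D0 (f 0) (h 0) fb"
  define Kg where "Kg = K_g \<mu> \<nu> \<epsilon> D0 Kf (g 0) (h 0) gb"
  define Kh where "Kh = K_h \<mu> \<nu> Kf Kg (h 0) hb"
  have adm: "admissible_triple \<mu> \<nu> fb gb hb" using assms(13) by (simp add: dual_potentials_def)
  have cont0: "continuous_on ?U (f 0)" "continuous_on ?U (g 0)" "continuous_on ?S (h 0)"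
    using assms(11) by (auto simp: admissible_triple_def C_diamond_def)
  have bm0: "Q.bm_triple (f 0) (g 0) (h 0)"
    unfolding Q.bm_triple_def using cont0
    by (intro conjI bounded_measurable_continuous_on Q.sets_\<mu> Q.sets_\<nu> Q.compact_U Q.compact_S)
  have D0: "D0 = Q.D (f 0) (g 0) (h 0)" by (simp add: D0_def Q.dual_obj_eq)
  \<comment> \<open>It makes the bracket in \<open>K_g\<close> nonnegative, which is needed to pass
    from \<open>1 / lam\<close> to the operator norm, as well as the term 3 * C - 3/2 * D0 in the
    invariant.\<close>
  have D0_le: "D0 \<le> ?C" unfolding D0 by (rule Q.D_le_C[OF bm0])
  have h0: "\<bar>h 0 z\<bar> \<le> H0" if "z \<in> ?S" for z
    using norm_le_sup_norm[OF Q.compact_S cont0(3) that] by (simp add: H0_def)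
  have H0: "0 \<le> H0" using h0 Q.S_nonempty by force
  have Kf: "L_c \<mu> \<nu> * diameter ?U + ?C + max (- D0) 0 + H0 \<le> Kf"
      "sup_norm ?U fb \<le> Kf" "sup_norm ?U (f 0) \<le> Kf"
    by (simp_all add: Kf_def K_f_def H0_def)
  have Kg: "4 * onorm (\<lambda>v. matrix_inv (second_moment_X \<nu>) *v v) * ?R
        * (4 * ?C - 3 / 2 * D0 + Kf + H0 + \<epsilon> * ln (3 / 2)) \<le> Kg"
      "sup_norm ?U gb \<le> Kg" "sup_norm ?U (g 0) \<le> Kg"
    by (simp_all add: Kg_def K_g_def H0_def)
  have Kh: "?C + Kf + Kg * ?R \<le> Kh" "sup_norm ?S hb \<le> Kh" "sup_norm ?S (h 0) \<le> Kh"
    by (simp_all add: Kh_def K_h_def)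
  have B: "quantile_dual_bounds Q.MU Q.NU fst (\<lambda>u z. cost u (snd z)) \<epsilon> ?R ?C
      (L_c \<mu> \<nu> * diameter ?U) ?lam Kf Kg Kh D0 H0"
  proof unfold_locales
    have "0 \<le> L_c \<mu> \<nu> * diameter ?U"
      using Q.L_c_nonneg diameter_ge_0[OF compact_imp_bounded[OF Q.compact_U]] by simp
    then have "0 \<le> Kf" using Kf(1) H0 Q.C_nonneg by linarith
    moreover have "0 \<le> \<epsilon> * ln (3 / 2)" using assms(10) by simp
    ultimately have "0 \<le> 4 * ?C - 3 / 2 * D0 + Kf + H0 + \<epsilon> * ln (3 / 2)"
      using D0_le H0 Q.C_nonneg by linarith
    moreover have "4 * (?R / ?lam) \<le> 4 * onorm (\<lambda>v. matrix_inv (second_moment_X \<nu>) *v v) * ?R"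
      using mult_right_mono[OF Q.inverse_lam_le_onorm, of ?R] Q.M_x_ge_1 by simp
    ultimately have "4 * (?R / ?lam) * (4 * ?C - 3 / 2 * D0 + Kf + H0 + \<epsilon> * ln (3 / 2))
      \<le> 4 * onorm (\<lambda>v. matrix_inv (second_moment_X \<nu>) *v v) * ?R
        * (4 * ?C - 3 / 2 * D0 + Kf + H0 + \<epsilon> * ln (3 / 2))" by (intro mult_right_mono)
    then show "4 * (?R / ?lam) * (4 * ?C - 3 / 2 * D0 + Kf + H0 + \<epsilon> * ln (3 / 2)) \<le> Kg"
      using Kg(1) by linarith
  qed (use Kf Kh H0 in auto)
  interpret B: quantile_dual_bounds Q.MU Q.NU fst "\<lambda>u z. cost u (snd z)" \<epsilon> ?R ?C
    "L_c \<mu> \<nu> * diameter ?U" ?lam Kf Kg Kh D0 H0 by (rule B)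
  have opt: "B.centered fb gb hb" by (rule Q.centeredI[OF B adm Kf(2) Kg(2) Kh(2)])
  have fb: "\<And>u. u \<in> ?U \<Longrightarrow> fb u = Q.fup gb hb u" and gb: "\<And>u. u \<in> ?U \<Longrightarrow> Q.stationary hb u (gb u)"
    and hb: "\<And>z. z \<in> ?S \<Longrightarrow> hb z = Q.hup fb gb z"
    using assms(13) by (auto simp: dual_potentials_def Q.g_equation_eq Q.f_update_eq Q.h_update_eq)
  define K where "K = B.K"
  have K_eq: "K_bar \<mu> \<nu> \<epsilon> (f 0) (g 0) (h 0) fb gb hb = K"
    by (simp add: K_bar_def B.K_def K_def D0_def[symmetric] Kf_def[symmetric] Kg_def[symmetric]
        Kh_def[symmetric] Let_def)
  have K0: "0 \<le> K" unfolding K_def by (rule B.K_nonneg[OF opt])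
  define G where "G t = Q.D fb gb hb - Q.D (f t) (g t) (h t)" for t

  \<comment> \<open>At the start nothing ties \<open>h 0\<close> to the objective, so
    \<open>H0\<close> alone covers its integral and its negative part.\<close>
  have invariant0: "B.sinkhorn_invariant (f 0) (g 0) (h 0)"
  proof -
    have bh: "bounded_measurable Q.NU (h 0)" using bm0 by (simp add: Q.bm_triple_def)
    have "\<bar>\<integral>z. h 0 z \<partial>Q.NU\<bar> \<le> H0"
      using Q.NU.bm_norm_integral_le[OF bh, of H0] h0 by (simp add: Q.space_NU)
    moreover have "(\<integral>z. max (- h 0 z) 0 \<partial>Q.NU) \<le> H0"
      using h0 H0 by (intro Q.NU.bm_integral_le bm_intros bh) (auto simp: Q.space_NU abs_le_iff)
    moreover have "B.centered (f 0) (g 0) (h 0)"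
      by (rule Q.centeredI[OF B assms(11) Kf(3) Kg(3) Kh(3)])
    ultimately show ?thesis
      using D0_le Q.C_nonneg unfolding B.sinkhorn_invariant_def D0 [symmetric] by (auto simp: abs_le_iff)
  qed
  have step: "B.sinkhorn_invariant (f (Suc t)) (g (Suc t)) (h (Suc t)) \<and> G (Suc t) \<le> exp (3 * K / \<epsilon>) * (G t - G (Suc t))"
    if sinkhorn_invariant: "B.sinkhorn_invariant (f t) (g t) (h t)" for t
  proof -
    have "\<exists>gt. (\<forall>u\<in>?U. Q.stationary (h t) u (gt u))
      \<and> (\<forall>u\<in>?U. f (Suc t) u = Q.fup gt (h t) u - (\<integral>u. Q.fup gt (h t) u \<partial>Q.MU))
      \<and> (\<forall>u\<in>?U. g (Suc t) u = gt u - (\<integral>u. gt u \<partial>Q.MU))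
      \<and> (\<forall>z\<in>?S. h (Suc t) z = Q.hup (Q.fup gt (h t)) gt z + (\<integral>u. Q.fup gt (h t) u \<partial>Q.MU)
          + (\<integral>u. gt u \<partial>Q.MU) \<bullet> fst z)"
      using assms(12)[of t] Q.sets_U
      by (simp add: sinkhorn_step_def Let_def Q.g_equation_eq Q.f_update_eq Q.h_update_eq
          set_lebesgue_integral_restrict_space case_prod_beta')
    then obtain gt where s: "\<And>u. u \<in> ?U \<Longrightarrow> Q.stationary (h t) u (gt u)"
      and f': "\<And>u. u \<in> ?U \<Longrightarrow> f (Suc t) u = Q.fup gt (h t) u - (\<integral>u. Q.fup gt (h t) u \<partial>Q.MU)"
      and g': "\<And>u. u \<in> ?U \<Longrightarrow> g (Suc t) u = gt u - (\<integral>u. gt u \<partial>Q.MU)"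
      and h': "\<And>z. z \<in> ?S \<Longrightarrow> h (Suc t) z = Q.hup (Q.fup gt (h t)) gt z + (\<integral>u. Q.fup gt (h t) u \<partial>Q.MU)
          + (\<integral>u. gt u \<partial>Q.MU) \<bullet> fst z"
      by blast
    have bh: "bounded_measurable Q.NU (h t)"
      using sinkhorn_invariant by (simp add: B.sinkhorn_invariant_def B.centered_def Q.bm_triple_def)
    have gt: "bounded_measurable Q.MU gt" using bh s by (rule Q.bm_of_stationary)
    have ft: "bounded_measurable Q.MU (Q.fup gt (h t))" using gt bh by (rule Q.bm_fup)
    have s': "\<And>u. u \<in> space Q.MU \<Longrightarrow> Q.stationary (h t) u (gt u)" using s by (simp add: Q.space_MU)
    let ?f = "\<lambda>u. Q.fup gt (h t) u - (\<integral>u. Q.fup gt (h t) u \<partial>Q.MU)" and ?g = "\<lambda>u. gt u - (\<integral>u. gt u \<partial>Q.MU)"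
    \<comment> \<open>By \<open>hup_shift\<close>, the shift performed by the algorithm is the
      h-update of the centred pair.\<close>
    have eq: "\<And>u. u \<in> space Q.MU \<Longrightarrow> f (Suc t) u = ?f u" "\<And>u. u \<in> space Q.MU \<Longrightarrow> g (Suc t) u = ?g u"
      "\<And>z. z \<in> space Q.NU \<Longrightarrow> h (Suc t) z = Q.hup ?f ?g z"
      using f' g' h' Q.hup_shift[OF ft gt] by (simp_all add: Q.space_MU Q.space_NU)
    have "B.sinkhorn_invariant ?f ?g (Q.hup ?f ?g)" by (rule B.step_invariant[OF sinkhorn_invariant gt s'])
    then have "B.sinkhorn_invariant (f (Suc t)) (g (Suc t)) (h (Suc t))" using eq by (rule B.invariant_cong)
    moreover have "Q.D (f (Suc t)) (g (Suc t)) (h (Suc t)) = Q.D ?f ?g (Q.hup ?f ?g)"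
      using eq by (rule Q.D_cong)
    ultimately show ?thesis
      using B.step_gap[OF sinkhorn_invariant gt s' opt] by (simp add: G_def K_def)
  qed
  have sinkhorn_invariant: "B.sinkhorn_invariant (f t) (g t) (h t)" for t by (induction t) (use invariant0 step in auto)
  define L2 where "L2 t = (\<integral>u. (f t u - fb u)\<^sup>2 \<partial>Q.MU) + (\<integral>u. (norm (g t u - gb u))\<^sup>2 \<partial>Q.MU)
      + (\<integral>z. (h t z - hb z)\<^sup>2 \<partial>Q.NU)" for t
  \<comment> \<open>\<open>gap_ge_L2\<close> weights the g-term by the eigenvalue and the others by
    1; the minimum is a common weight.\<close>
  define m where "m = exp (- K / \<epsilon>) / (2 * \<epsilon>) * min 1 ?lam"
  have m: "0 < m" using assms(10) Q.lam_pos by (simp add: m_def)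
  have L2_nonneg: "0 \<le> L2 t" for t by (simp add: L2_def)
  have L2_le: "m * L2 t \<le> G t" for t
  proof -
    let ?a = "\<integral>u. (f t u - fb u)\<^sup>2 \<partial>Q.MU" and ?b = "\<integral>u. (norm (g t u - gb u))\<^sup>2 \<partial>Q.MU"
      and ?d = "\<integral>z. (h t z - hb z)\<^sup>2 \<partial>Q.NU"
    have "min 1 ?lam * ?a \<le> 1 * ?a" "min 1 ?lam * ?b \<le> ?lam * ?b" "min 1 ?lam * ?d \<le> 1 * ?d"
      by (intro mult_right_mono; simp)+
    then have "min 1 ?lam * L2 t \<le> ?a + ?lam * ?b + ?d" by (simp add: L2_def distrib_left)
    then have "m * L2 t \<le> exp (- K / \<epsilon>) / (2 * \<epsilon>) * (?a + ?lam * ?b + ?d)"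
      using assms(10) unfolding m_def mult.assoc by (intro mult_left_mono) auto
    also have "\<dots> \<le> G t"
      using sinkhorn_invariant[of t] fb gb hb unfolding G_def K_def
      by (intro B.gap_ge_L2 opt) (auto simp: B.sinkhorn_invariant_def Q.space_MU Q.space_NU)
    finally show ?thesis .
  qed
  have G_nonneg: "0 \<le> G t" for t
    using L2_le[of t] m L2_nonneg[of t] by (smt (verit) mult_nonneg_nonneg)

  have \<tau>_eq: "\<tau> = min 1 ?lam * exp (- 5 * K / \<epsilon>) / (3 * ?R\<^sup>2)"
    using assms(14) by (simp add: rate_def K_eq)
  have \<tau>_pos: "0 < \<tau>" using Q.lam_pos Q.M_x_ge_1 unfolding \<tau>_eq by simp
  \<comment> \<open>The exponentials leave exp (-2 K / \<epsilon>), at most 1 since K is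
    nonnegative; the other factor is at most 1 as well.\<close>
  have \<tau>_le: "\<tau> * exp (3 * K / \<epsilon>) \<le> 1"
  proof -
    have "1 \<le> ?R\<^sup>2" using Q.M_x_ge_1 by simp
    then have "min 1 ?lam \<le> 3 * ?R\<^sup>2" "0 < 3 * ?R\<^sup>2" using min.cobounded1[of 1 ?lam] by linarith+
    then have "min 1 ?lam / (3 * ?R\<^sup>2) \<le> 1" by (simp only: divide_le_eq_1) auto
    moreover have "exp (- 5 * K / \<epsilon>) * exp (3 * K / \<epsilon>) \<le> 1"
      using K0 assms(10) by (simp flip: exp_add add_divide_distrib)
    ultimately have "(min 1 ?lam / (3 * ?R\<^sup>2)) * (exp (- 5 * K / \<epsilon>) * exp (3 * K / \<epsilon>)) \<le> 1 * 1"
      by (intro mult_mono) auto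
    then show ?thesis unfolding \<tau>_eq by (simp add: field_simps)
  qed
  have rate: "G t \<le> (1 + \<tau>) powi (- int t) * G 0" for t
    using step sinkhorn_invariant G_nonneg \<tau>_pos \<tau>_le by (intro geometric_decay_of_gap[of G "exp (3 * K / \<epsilon>)"]) auto

  have "(\<lambda>t. L2 t) \<in> O(\<lambda>t. (1 + \<tau>) powi (- int t))"
  proof (rule bigoI)
    show "\<forall>\<^sub>F t in at_top. norm (L2 t) \<le> G 0 / m * norm ((1 + \<tau>) powi (- int t))"
    proof (intro always_eventually allI)
      fix t
      have "L2 t \<le> G t / m" using L2_le[of t] m by (simp add: field_simps)
      also have "\<dots> \<le> (1 + \<tau>) powi (- int t) * G 0 / m"
        using rate[of t] m by (intro divide_right_mono) auto
      finally show "norm (L2 t) \<le> G 0 / m * norm ((1 + \<tau>) powi (- int t))"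
        using L2_nonneg[of t] \<tau>_pos by (simp add: mult.commute)
    qed
  qed
  moreover have "L2_dist_sq \<mu> ?U (f t) fb + L2_dist_sq \<mu> ?U (g t) gb + L2_dist_sq \<nu> ?S (h t) hb = L2 t" for t
    using Q.sets_U Q.sets_S by (simp add: L2_dist_sq_def L2_def set_lebesgue_integral_restrict_space)
  ultimately show ?thesis
    using \<tau>_pos rate by (simp add: G_def Q.dual_obj_eq)
qed

end
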